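(* Let $g\ge 0$ and $n\ge 1$ be integers with $(g,n)\neq(0,1),(0,2)$. Then Okuyama's discrete volume $N^q_{g,n}(b_1,\ldots,b_n)$ is a quasi-polynomial in $b_1^2,\ldots,b_n^2$ with coefficients in $\mathbb{Q}[\zeta_q(2),\zeta_q(4),\zeta_q(6),\ldots]$, of degree $6g-6+2n$. That is, for each parity class $\epsilon\in(\mathbb{Z}/2)^n$ there is a polynomial $P_\epsilon\in\mathbb{Q}[Z_2,Z_4,Z_6,\ldots][B_1^2,\ldots,B_n^2]$ (not depending on $q$) such that for all $0<q<1$ and all positive integers $b_1,\ldots,b_n$ with $(b_1,\ldots,b_n)\equiv\epsilon \pmod 2$, the number $N^q_{g,n}(b_1,\ldots,b_n)$ equals $P_\epsilon$ evaluated at $B_i=b_i$, $Z_{2k}=\zeta_q(2k)$; and the maximum over $\epsilon$ of the degrees of the $P_\epsilon$ is $6g-6+2n$, where $\deg B_i=1$ and $\deg Z_{2k}=2k$.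
   Context: Let $0<q<1$, $q=e^{-\lambda}$. The $q$-zeta values are $\zeta_q(s)=\sum_{m=1}^\infty \frac{q^{ms/2}}{(1-q^m)^s}$. Topological recursion. Let $x(z),y(z)$ be functions of a coordinate $z$ on $\mathbb{CP}^1$, such that $dx$ has simple zeros $\alpha$ (the branch points) and $y$ is holomorphic near them. Let $\sigma_\alpha$ be the non-trivial local holomorphic involution near $\alpha$ with $x\circ\sigma_\alpha=x$. Put $\omega_{0,1}(z)=y(z)\,dx(z)$, $\omega_{0,2}(z_1,z_2)=\frac{dz_1\,dz_2}{(z_1-z_2)^2}$, and $$K_\alpha(z_1,z)=\frac12\,\frac{\int_z^{\sigma_\alpha(z)}\omega_{0,2}(z_1,\cdot)}{\omega_{0,1}(z)-\omega_{0,1}(\sigma_\alpha(z))}.$$ For $g\ge0$, $n\ge1$, $(g,n)\ne(0,1),(0,2)$ and $S=\{2,\ldots,n\}$, define recursively $$\omega_{g,n}(z_1,z_S)=\sum_\alpha\operatorname{Res}_{z=\alpha}K_\alpha(z_1,z)\Big[\omega_{g-1,n+1}(z,\sigma_\alpha(z),z_S)+\sum^{\circ}_{g_1+g_2=g,\ I\sqcup J=S}\omega_{g_1,|I|+1}(z,z_I)\,\omega_{g_2,|J|+1}(\sigma_\alpha(z),z_J)\Big],$$ where $\circ$ means terms containing $\omega_{0,1}$ are excluded, and $\omega_{g,n}=0$ for $g<0$. Okuyama's spectral curve is $$x(z)=z+z^{-1},\qquad y(z)=\tfrac12(z-z^{-1})\prod_{k=1}^\infty\frac{(1-q^kz^2)(1-q^kz^{-2})}{(1-q^k)^2},$$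 with branch points $z=\pm1$ and $\sigma_{\pm1}(z)=1/z$. Its stable ($(g,n)\ne(0,1),(0,2)$) correlation differentials are rational with poles only at $z_i=\pm1$, and the discrete volumes $N^q_{g,n}(b_1,\ldots,b_n)$ (for positive integers $b_i$) are defined by the expansion at $z_i=0$ $$\omega_{g,n}(z_1,\ldots,z_n)=\sum_{b_1,\ldots,b_n=1}^\infty N^q_{g,n}(b_1,\ldots,b_n)\prod_{i=1}^n b_iz_i^{b_i-1}\,dz_i.$$ A quasi-polynomial is a function on tuples of positive integers that is polynomial when restricted to each residue class modulo 2. The degree of a polynomial in the $b_i$ and $\zeta_q(2k)$ is defined by $\deg b_i=1$, $\deg\zeta_q(2k)=2k$, additively on products and by the maximum over monomials; the degree of a quasi-polynomial is the maximum of the degrees of its constituent polynomials. *)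

theory Defs
  imports "HOL-Complex_Analysis.Complex_Analysis" "HOL-Library.Poly_Mapping"
begin

section \<open>Topological recursion on the projective line\<close>

text \<open>
  Everything is written in the global coordinate \<open>z\<close>. A multidifferential
  \<open>\<omega>\<^sub>g\<^sub>,\<^sub>n = W(z\<^sub>1,\<dots>,z\<^sub>n) dz\<^sub>1 \<cdots> dz\<^sub>n\<close> is represented by its coefficient \<open>W\<close>, a function of the
  list \<open>[z\<^sub>1,\<dots>,z\<^sub>n]\<close>. Substituting \<open>\<sigma>\<^sub>\<alpha>(z)\<close> for a variable is a pull-back and therefore
  contributes a factor \<open>\<sigma>\<^sub>\<alpha>'(z)\<close>. The spectral curve is given by \<open>x\<close>, \<open>y\<close>, the set \<open>A\<close> of
  branch points (simple zeros of \<open>dx\<close>), and the local involutions \<open>\<sigma> \<alpha>\<close> with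
  \<open>x \<circ> \<sigma> \<alpha> = x\<close> near \<open>\<alpha>\<close>.
\<close>

definition W02 :: "complex \<Rightarrow> complex \<Rightarrow> complex" where
  "W02 z1 z2 = 1 / (z1 - z2)\<^sup>2"

context
  fixes x y :: "complex \<Rightarrow> complex"
    and A :: "complex set"
    and \<sigma> :: "complex \<Rightarrow> complex \<Rightarrow> complex"
begin

definition W01 :: "complex \<Rightarrow> complex" where
  "W01 z = y z * deriv x z"

text \<open>
  The kernel is only used for \<open>z\<close> close to \<open>\<alpha>\<close>, where the segment from \<open>z\<close> to
  \<open>\<sigma>\<^sub>\<alpha>(z)\<close> avoids the pole \<open>z\<^sub>1 \<noteq> \<alpha>\<close> of the integrand. It is the coefficient of \<open>dz\<^sub>1 (dz)\<^sup>-\<^sup>1\<close>.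
\<close>

definition recursion_kernel :: "complex \<Rightarrow> complex \<Rightarrow> complex \<Rightarrow> complex" where
  "recursion_kernel \<alpha> z1 z =
     1 / 2 * contour_integral (linepath z (\<sigma> \<alpha> z)) (W02 z1)
       / (W01 z - W01 (\<sigma> \<alpha> z) * deriv (\<sigma> \<alpha>) z)"

text \<open>
  In \<open>TR g (z1 # zs)\<close> the set \<open>S\<close> is the set of positions of the list \<open>zs\<close>, so \<open>n\<close> is
  \<open>Suc (length zs)\<close>; \<open>I\<close> ranges over the subsets of \<open>S\<close>, and \<open>nths zs (- I)\<close> are the variables
  indexed by \<open>J = S - I\<close>. The value for the empty list (\<open>n = 0\<close>) is never used.
\<close>

function (sequential) TR :: "nat \<Rightarrow> complex list \<Rightarrow> complex" where
  "TR g [] = 0"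
| "TR g (z1 # zs) =
    (if g = 0 \<and> length zs = 0 then W01 z1
     else if g = 0 \<and> length zs = 1 then W02 z1 (hd zs)
     else (\<Sum>\<alpha>\<in>A. residue (\<lambda>z. recursion_kernel \<alpha> z1 z * deriv (\<sigma> \<alpha>) z *
        ((if g = 0 then 0 else TR (g - 1) (z # \<sigma> \<alpha> z # zs)) +
         (\<Sum>g1\<in>{..g}. \<Sum>I\<in>Pow {..<length zs}.
            (if g1 = 0 \<and> I = {} \<or> g - g1 = 0 \<and> I = {..<length zs} then 0
             else TR g1 (z # nths zs I) * TR (g - g1) (\<sigma> \<alpha> z # nths zs (- I)))))) \<alpha>))"
  by pat_completeness auto
termination
proof -
  have "2 * g1 + length (nths zs I) < 2 * g + length zs \<and>
        2 * (g - g1) + length (nths zs (- I)) < 2 * g + length zs"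
    if I: "I \<subseteq> {..<length zs}" and le: "g1 \<le> g"
      and ne: "0 < g1 \<or> I \<noteq> {}" "g = g1 \<longrightarrow> I \<noteq> {..<length zs}"
    for g g1 :: nat and zs :: "complex list" and I
  proof -
    have fin: "finite I"
      using I finite_subset by blast
    have "{i. i < length zs \<and> i \<in> I} = I" using I by auto
    then have len: "length (nths zs I) = card I"
      by (simp add: length_nths)
    have "{i. i < length zs \<and> i \<in> - I} = {..<length zs} - I" by auto
    then have len': "length (nths zs (- I)) = length zs - card I"
      using I fin by (simp add: length_nths card_Diff_subset)
    have cle: "card I \<le> length zs"
      using card_mono[OF _ I] by simp
    have clt: "card I < length zs" if "I \<noteq> {..<length zs}"
      using psubset_card_mono[of "{..<length zs}" I] I that by auto
    have cgt: "card I > 0" if "I \<noteq> {}"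
      using fin that by (simp add: card_gt_0_iff)
    have "2 * g1 + card I < 2 * g + length zs"
      using le ne(2) cle clt by (cases "g = g1") auto
    moreover have "2 * (g - g1) + (length zs - card I) < 2 * g + length zs"
      using le ne(1) cle cgt by (cases "g1 = 0") auto
    ultimately show ?thesis
      by (simp only: len len')
  qed
  then show ?thesis
    by (relation "Wellfounded.measure (\<lambda>(g, zs). 2 * g + length zs)") simp_all
qed

end


section \<open>Okuyama's spectral curve and its discrete volumes\<close>

definition okuyama_x :: "complex \<Rightarrow> complex" where
  "okuyama_x z = z + inverse z"

definition okuyama_y :: "real \<Rightarrow> complex \<Rightarrow> complex" where
  "okuyama_y q z = 1 / 2 * (z - inverse z) *
     prodinf (\<lambda>k. (1 - of_real q ^ Suc k * z\<^sup>2) * (1 - of_real q ^ Suc k * inverse (z\<^sup>2))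
            / (1 - of_real q ^ Suc k)\<^sup>2)"

definition okuyama_W :: "real \<Rightarrow> nat \<Rightarrow> complex list \<Rightarrow> complex" where
  "okuyama_W q = TR okuyama_x (okuyama_y q) {1, -1} (\<lambda>\<alpha> z. inverse z)"

lemma okuyama_branch_points:
  assumes "z \<noteq> 0"
  shows "deriv okuyama_x z = 0 \<longleftrightarrow> z \<in> {1, -1}"
proof -
  have "(okuyama_x has_field_derivative 1 - inverse (z\<^sup>2)) (at z)"
    unfolding okuyama_x_def [abs_def] using assms
    by (auto intro!: derivative_eq_intros simp: power2_eq_square)
  then have "deriv okuyama_x z = 1 - inverse (z\<^sup>2)"
    by (rule DERIV_imp_deriv)
  moreover have "1 - inverse (z\<^sup>2) = 0 \<longleftrightarrow> z\<^sup>2 = 1"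
    using assms by (auto simp: field_simps)
  ultimately show ?thesis
    by (simp add: power2_eq_1_iff)
qed

lemma okuyama_involution: "okuyama_x (inverse z) = okuyama_x z"
  by (simp add: okuyama_x_def)

definition pos_tuples :: "nat \<Rightarrow> nat list set" where
  "pos_tuples n = {bs. length bs = n \<and> (\<forall>b\<in>set bs. b > 0)}"

definition is_volume_expansion :: "real \<Rightarrow> nat \<Rightarrow> nat \<Rightarrow> (nat list \<Rightarrow> complex) \<Rightarrow> bool" where
  "is_volume_expansion q g n N \<longleftrightarrow>
     (\<exists>r>0. \<forall>zs. length zs = n \<and> (\<forall>z\<in>set zs. norm z < r) \<longrightarrow>
        ((\<lambda>bs. N bs * (\<Prod>i<n. of_nat (bs ! i) * (zs ! i) ^ (bs ! i - 1)))
           has_sum okuyama_W q g zs) (pos_tuples n))"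

text \<open>
  Coefficients of a convergent power series are unique, so the choice below is irrelevant
  on tuples of positive integers.
\<close>

definition discrete_volume :: "real \<Rightarrow> nat \<Rightarrow> nat list \<Rightarrow> complex" where
  "discrete_volume q g bs = (SOME N. is_volume_expansion q g (length bs) N) bs"

definition qzeta :: "real \<Rightarrow> nat \<Rightarrow> real" where
  "qzeta q s = suminf (\<lambda>m. q powr (real (Suc m) * real s / 2) / (1 - q ^ Suc m) ^ s)"


section \<open>Polynomials in the lengths and the \<open>q\<close>-zeta values\<close>

text \<open>
  The indeterminate \<open>B i\<close> (\<open>i < n\<close>) stands for the \<open>(i+1)\<close>-st length, and \<open>Z k\<close> (\<open>k \<ge> 1\<close>)
  stands for \<open>Z\<^sub>2\<^sub>k\<close>. A polynomial over the rationals is a finitely supported map from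
  monomials (finitely supported exponent maps) to coefficients.
\<close>

datatype indet = B nat | Z nat

type_synonym monomial = "indet \<Rightarrow>\<^sub>0 nat"
type_synonym polynomial = "monomial \<Rightarrow>\<^sub>0 rat"

text \<open>The subring \<open>\<rat>[Z\<^sub>2, Z\<^sub>4, Z\<^sub>6, \<dots>][B\<^sub>1\<^sup>2, \<dots>, B\<^sub>n\<^sup>2]\<close>.\<close>

definition square_polys :: "nat \<Rightarrow> polynomial set" where
  "square_polys n =
     {P :: polynomial. \<forall>m\<in>Poly_Mapping.keys P. Poly_Mapping.keys m \<subseteq> B ` {..<n} \<union> Z ` {1..} \<and> (\<forall>i. even (Poly_Mapping.lookup m (B i)))}"

fun indet_value :: "real \<Rightarrow> nat list \<Rightarrow> indet \<Rightarrow> real" where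
  "indet_value q bs (B i) = real (bs ! i)"
| "indet_value q bs (Z k) = qzeta q (2 * k)"

definition poly_value :: "real \<Rightarrow> nat list \<Rightarrow> polynomial \<Rightarrow> real" where
  "poly_value q bs P =
     (\<Sum>m\<in>Poly_Mapping.keys P. of_rat (Poly_Mapping.lookup P m) * (\<Prod>v\<in>Poly_Mapping.keys m. indet_value q bs v ^ Poly_Mapping.lookup m v))"

fun indet_degree :: "indet \<Rightarrow> nat" where
  "indet_degree (B i) = 1"
| "indet_degree (Z k) = 2 * k"

definition monomial_degree :: "monomial \<Rightarrow> nat" where
  "monomial_degree m = (\<Sum>v\<in>Poly_Mapping.keys m. Poly_Mapping.lookup m v * indet_degree v)"

text \<open>The degree of the zero polynomial is \<open>-\<infinity>\<close>.\<close>

definition poly_degree :: "polynomial \<Rightarrow> ereal" where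
  "poly_degree P = (SUP m\<in>Poly_Mapping.keys P. ereal (real (monomial_degree m)))"

text \<open>A parity class is given by the list telling which entries of the tuple are odd.\<close>

definition parity_classes :: "nat \<Rightarrow> bool list set" where
  "parity_classes n = {\<epsilon>. length \<epsilon> = n}"

end

theory Submission
  imports Defs
begin

text \<open>
  Near a branch point \<open>\<alpha> = \<plusminus>1\<close> put \<open>z = \<alpha> e^t\<close>, so that the involution becomes \<open>t \<mapsto> -t\<close>. With
  \<open>S = (z - 1/z)^2 = (e^t - e^(-t))^2\<close> the infinite product in \<open>y\<close> is \<open>\<Prod>\<^sub>k (1 - x\<^sub>k S)\<close>, where
  \<open>x\<^sub>k = q^k / (1 - q^k)^2\<close>, and the power sums of the \<open>x\<^sub>k\<close> are exactly the \<open>q\<close>-zeta values: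
  \<open>\<Sum>\<^sub>k x\<^sub>k^s = \<zeta>\<^sub>q(2s)\<close>. Its reciprocal is therefore \<open>\<Sum>\<^sub>j h\<^sub>j S^j\<close> with the complete homogeneous symmetric
  functions \<open>h\<^sub>j\<close> of the \<open>x\<^sub>k\<close>, which by Newton's identities are polynomials in \<open>\<zeta>\<^sub>q(2), \<dots>, \<zeta>\<^sub>q(2j)\<close> with
  nonnegative rational coefficients that do not depend on \<open>q\<close>. The parameter \<open>q\<close> enters the
  recursion in no other way.

  In the coordinate \<open>t\<close> the recursion kernel is
  \<open>1/2 (F(z\<^sub>1,t) - F(z\<^sub>1,-t)) \<cdot> (1/S) \<Sum>\<^sub>j h\<^sub>j S^j\<close> with
  \<open>F(z\<^sub>1,t) = \<alpha> e^t / (1 - \<alpha> e^t z\<^sub>1) = \<Sum>\<^sub>b (\<alpha> e^t)^b z\<^sub>1^(b-1)\<close> (\<open>kernel_density_eq\<close>). The first factor is odd in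
  \<open>t\<close>, and the coefficient of \<open>t^(2k+1)\<close> in it is \<open>\<psi>(z\<^sub>1) / (2k+1)!\<close> where
  \<open>\<psi>(z\<^sub>1) = \<Sum>\<^sub>b \<alpha>^b b^(2k+1) z\<^sub>1^(b-1)\<close>. So the residue replaces a pole coefficient at \<open>t^(-2k-2)\<close> by a multiple of \<open>\<psi>\<close>,
  whose expansion at \<open>0\<close> contributes \<open>\<alpha>^b b^(2k)\<close> to the discrete volume: an even
  quasi-polynomial. Conversely \<open>z \<psi>(z)\<close> is again even in \<open>t\<close> with rational Laurent coefficients at
  either branch point (\<open>kfun_laurent\<close>), and the even part of \<open>\<omega>\<^sub>0\<^sub>,\<^sub>2\<close> expands into the functions \<open>\<psi>\<close>
  of the other variable (\<open>W02_local\<close>). By induction on \<open>2g + n\<close> every stable \<open>\<omega>\<^sub>g\<^sub>,\<^sub>n\<close> is a finite rational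
  combination of monomials in the \<open>q\<close>-zeta values times products of functions \<open>\<psi>\<close>.

  For the degree, give \<open>t\<close> degree \<open>-1\<close>, the function \<open>\<psi>\<close> above degree \<open>2k\<close> and \<open>\<zeta>\<^sub>q(2k)\<close> degree
  \<open>2k\<close>. All expansions are filtered for this grading and the degrees add up to
  \<open>6g - 6 + 2n\<close>. Moreover the part of exact degree of every ingredient has nonnegative
  coefficients: the factor \<open>(2k+1)! / t^(2k+2)\<close> of \<open>z \<psi>(z)\<close>, the coefficients \<open>1 / (2k)!\<close> in the
  expansion of \<open>\<omega>\<^sub>0\<^sub>,\<^sub>2\<close>, the factor \<open>1 / (4 t^2)\<close> of the kernel and the \<open>h\<^sub>j\<close>. Hence nothing cancels in top degree, and a strictly positive coefficient
  propagates through the recursion at the branch point \<open>1\<close>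
  (\<open>okuyama_W_vspan_pos\<close>). On tuples of even integers all signs \<open>\<alpha>^b\<close> are \<open>1\<close>, so this coefficient
  survives in the polynomial of that parity class. Finally the coefficients of a
  convergent power series in several variables are unique (\<open>tuple_series_zero\<close>), which
  identifies these quasi-polynomials with the discrete volumes.
\<close>

unbundle fps_syntax

section \<open>Combinations of the basis differentials\<close>

definition sg :: "bool \<Rightarrow> complex" where
  "sg a = (if a then 1 else -1)"

text \<open>
  In terms of \<open>v = 1 / (1 - \<alpha> z)\<close> the operator \<open>z d/dz\<close> is \<open>(v^2 - v) d/dv\<close>, so
  \<open>(z d/dz)^(j+1) v = (v^2 - v) \<cdot> eul j\<close>.
\<close>

primrec eul :: "nat \<Rightarrow> complex poly" where
  "eul 0 = 1"
| "eul (Suc j) = pderiv ([:0, -1, 1:] * eul j)"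

text \<open>
  This is \<open>\<Sum>\<^sub>b \<alpha>^b b^(j+1) z^(b-1)\<close> with \<open>\<alpha> = sg a\<close> (\<open>psi_has_sum\<close>). The closed form in \<open>1 / (1 - \<alpha> z)\<close> is valid on the
  whole complement of the branch point, including \<open>z = 0\<close>.
\<close>

definition psi :: "bool \<Rightarrow> nat \<Rightarrow> complex \<Rightarrow> complex" where
  "psi a j z = sg a * (1 / (1 - sg a * z))\<^sup>2 * poly (eul j) (1 / (1 - sg a * z))"

definition psi_prod :: "(bool \<times> nat) list \<Rightarrow> complex list \<Rightarrow> complex" where
  "psi_prod \<kappa> zs = prod_list (map2 (\<lambda>s. psi (fst s) (2 * snd s)) \<kappa> zs)"

definition monomial_value :: "real \<Rightarrow> nat list \<Rightarrow> monomial \<Rightarrow> real" where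
  "monomial_value q bs m = (\<Prod>v\<in>Poly_Mapping.keys m. indet_value q bs v ^ Poly_Mapping.lookup m v)"

text \<open>
  A rational coefficient, a monomial in the \<open>q\<close>-zeta values, and for each variable a slot: a branch
  point (\<open>True\<close> stands for \<open>1\<close>) together with half of the exponent of the corresponding length.
\<close>

type_synonym vterm = "rat \<times> monomial \<times> (bool \<times> nat) list"

fun term_value :: "real \<Rightarrow> complex list \<Rightarrow> vterm \<Rightarrow> complex" where
  "term_value q zs (r, m, \<kappa>) = of_rat r * of_real (monomial_value q [] m) * psi_prod \<kappa> zs"

fun term_degree :: "vterm \<Rightarrow> int" where
  "term_degree (r, m, \<kappa>) = int (monomial_degree m) + 2 * int (sum_list (map snd \<kappa>))"

text \<open>
  The sign condition on coefficients of exact degree \<open>d\<close> rules out cancellation in top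
  degree. It is stable under sums and products, which is why it is made part of the definition.
\<close>

fun admissible_term :: "nat \<Rightarrow> int \<Rightarrow> vterm \<Rightarrow> bool" where
  "admissible_term n d (r, m, \<kappa>) \<longleftrightarrow> length \<kappa> = n \<and> Poly_Mapping.keys m \<subseteq> Z ` {1..} \<and>
     term_degree (r, m, \<kappa>) \<le> d \<and> (term_degree (r, m, \<kappa>) = d \<longrightarrow> 0 \<le> r)"

text \<open>
  A slot produces a pole only at its own branch point, so a positive term can be followed through
  the recursion only while all its slots stay at one branch point; here this is \<open>1\<close>.
\<close>

fun leading_term :: "nat \<Rightarrow> int \<Rightarrow> vterm \<Rightarrow> bool" where
  "leading_term n d (r, m, \<kappa>) \<longleftrightarrow> admissible_term n d (r, m, \<kappa>) \<and>
     term_degree (r, m, \<kappa>) = d \<and> 0 < r \<and> (\<forall>s\<in>set \<kappa>. fst s)"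

definition adm :: "nat \<Rightarrow> real \<Rightarrow> complex list \<Rightarrow> bool" where
  "adm n q zs \<longleftrightarrow> 0 < q \<and> q < 1 \<and> length zs = n \<and> 1 \<notin> set zs \<and> -1 \<notin> set zs"

text \<open>
  The families of functions that are sums of finitely many admissible terms. The terms
  are chosen once for all \<open>q\<close>; this makes the final polynomials independent of \<open>q\<close>.
\<close>

inductive vspan :: "nat \<Rightarrow> int \<Rightarrow> (real \<Rightarrow> complex list \<Rightarrow> complex) \<Rightarrow> bool" for n d where
  zero: "(\<And>q zs. adm n q zs \<Longrightarrow> \<Phi> q zs = 0) \<Longrightarrow> vspan n d \<Phi>"
| add_term: "vspan n d \<Phi> \<Longrightarrow> admissible_term n d t \<Longrightarrow>
    (\<And>q zs. adm n q zs \<Longrightarrow> \<Phi>' q zs = \<Phi> q zs + term_value q zs t) \<Longrightarrow> vspan n d \<Phi>'"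

definition vspan_pos :: "nat \<Rightarrow> int \<Rightarrow> (real \<Rightarrow> complex list \<Rightarrow> complex) \<Rightarrow> bool" where
  "vspan_pos n d \<Phi> \<longleftrightarrow> (\<exists>\<Phi>0 t. vspan n d \<Phi>0 \<and> leading_term n d t \<and>
     (\<forall>q zs. adm n q zs \<longrightarrow> \<Phi> q zs = \<Phi>0 q zs + term_value q zs t))"

lemma vspan_cong:
  assumes "vspan n d \<Phi>" "\<And>q zs. adm n q zs \<Longrightarrow> \<Phi>' q zs = \<Phi> q zs"
  shows "vspan n d \<Phi>'"
  using assms(1)
proof cases
  case zero
  then show ?thesis using assms(2) by (intro vspan.zero) auto
next
  case (add_term \<Phi>0 t)
  then show ?thesis using assms(2) by (auto intro: vspan.add_term[of n d \<Phi>0 t])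
qed

lemma vspan_pos_cong:
  assumes "vspan_pos n d \<Phi>" "\<And>q zs. adm n q zs \<Longrightarrow> \<Phi>' q zs = \<Phi> q zs"
  shows "vspan_pos n d \<Phi>'"
proof -
  obtain \<Phi>0 t where "vspan n d \<Phi>0" "leading_term n d t"
    "\<forall>q zs. adm n q zs \<longrightarrow> \<Phi> q zs = \<Phi>0 q zs + term_value q zs t"
    using assms(1) unfolding vspan_pos_def by blast
  then show ?thesis using assms(2) unfolding vspan_pos_def
    by (intro exI[of _ \<Phi>0] exI[of _ t]) simp
qed

lemma vspan_0 [simp]: "vspan n d (\<lambda>q zs. 0)"
  by (rule vspan.zero) simp

lemma vspan_term: "admissible_term n d t \<Longrightarrow> vspan n d (\<lambda>q zs. term_value q zs t)"
  by (rule vspan.add_term[OF vspan_0]) auto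

lemma vspan_pos_term: "leading_term n d t \<Longrightarrow> vspan_pos n d (\<lambda>q zs. term_value q zs t)"
  unfolding vspan_pos_def by (intro exI[of _ "\<lambda>q zs. 0"] exI[of _ t]) simp

lemma vspan_add:
  assumes "vspan n d \<Phi>" "vspan n d \<Psi>"
  shows "vspan n d (\<lambda>q zs. \<Phi> q zs + \<Psi> q zs)"
  using assms(2)
proof induction
  case (zero \<Psi>)
  show ?case by (rule vspan_cong[OF assms(1)]) (simp add: zero)
next
  case (add_term \<Psi> t \<Psi>')
  show ?case by (rule vspan.add_term[OF add_term.IH add_term.hyps(2)]) (simp add: add_term.hyps(3))
qed

lemma vspan_sum: "(\<And>x. x \<in> A \<Longrightarrow> vspan n d (\<Phi> x)) \<Longrightarrow> vspan n d (\<lambda>q zs. \<Sum>x\<in>A. \<Phi> x q zs)"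
  by (induction A rule: infinite_finite_induct) (auto intro: vspan_add)

lemma vspan_pos_imp_vspan:
  assumes "vspan_pos n d \<Phi>"
  shows "vspan n d \<Phi>"
proof -
  obtain \<Phi>0 t where *: "vspan n d \<Phi>0" "leading_term n d t"
    "\<forall>q zs. adm n q zs \<longrightarrow> \<Phi> q zs = \<Phi>0 q zs + term_value q zs t"
    using assms unfolding vspan_pos_def by blast
  have "admissible_term n d t" using *(2) by (cases t) simp
  then show ?thesis using * by (auto intro: vspan.add_term[OF *(1)])
qed

lemma vspan_pos_add:
  assumes "vspan_pos n d \<Phi>" "vspan n d \<Psi>"
  shows "vspan_pos n d (\<lambda>q zs. \<Phi> q zs + \<Psi> q zs)"
proof -
  obtain \<Phi>0 t where *: "vspan n d \<Phi>0" "leading_term n d t"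
    "\<forall>q zs. adm n q zs \<longrightarrow> \<Phi> q zs = \<Phi>0 q zs + term_value q zs t"
    using assms unfolding vspan_pos_def by blast
  show ?thesis unfolding vspan_pos_def
    by (intro exI[of _ "\<lambda>q zs. \<Phi>0 q zs + \<Psi> q zs"] exI[of _ t])
       (use * vspan_add[OF *(1) assms(2)] in auto)
qed

lemma vspan_pos_sum:
  assumes "finite A" "x0 \<in> A" "vspan_pos n d (\<Phi> x0)" "\<And>x. x \<in> A \<Longrightarrow> x \<noteq> x0 \<Longrightarrow> vspan n d (\<Phi> x)"
  shows "vspan_pos n d (\<lambda>q zs. \<Sum>x\<in>A. \<Phi> x q zs)"
proof -
  have "vspan_pos n d (\<lambda>q zs. \<Phi> x0 q zs + (\<Sum>x\<in>A - {x0}. \<Phi> x q zs))"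
    by (intro vspan_pos_add vspan_sum assms(3)) (use assms(4) in auto)
  then show ?thesis using assms(1,2)
    by (auto simp: sum.remove[of A x0])
qed

lemma vspan_negative_degree:
  assumes "vspan n d \<Phi>" "d < 0" "adm n q zs"
  shows "\<Phi> q zs = 0"
  using assms
proof induction
  case (add_term \<Phi> t \<Phi>')
  then show ?case by (cases t) auto
qed auto

section \<open>Products in disjoint sets of variables\<close>

lemma monomial_degree_eq:
  assumes "finite A" "Poly_Mapping.keys m \<subseteq> A"
  shows "monomial_degree m = (\<Sum>v\<in>A. Poly_Mapping.lookup m v * indet_degree v)"
  unfolding monomial_degree_def
  by (rule sum.mono_neutral_left) (use assms in \<open>auto simp: in_keys_iff\<close>)

lemma monomial_degree_add: "monomial_degree (m + m') = monomial_degree m + monomial_degree m'"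
proof -
  let ?A = "Poly_Mapping.keys m \<union> Poly_Mapping.keys m'"
  have "Poly_Mapping.keys (m + m') \<subseteq> ?A" by (rule keys_add)
  then show ?thesis
    by (simp add: monomial_degree_eq[of ?A] lookup_add algebra_simps sum.distrib)
qed

lemma monomial_value_eq:
  assumes "finite A" "Poly_Mapping.keys m \<subseteq> A"
  shows "monomial_value q bs m = (\<Prod>v\<in>A. indet_value q bs v ^ Poly_Mapping.lookup m v)"
  unfolding monomial_value_def
  by (rule prod.mono_neutral_left) (use assms in \<open>auto simp: in_keys_iff\<close>)

lemma monomial_value_add: "monomial_value q bs (m + m') = monomial_value q bs m * monomial_value q bs m'"
proof -
  let ?A = "Poly_Mapping.keys m \<union> Poly_Mapping.keys m'"
  have "Poly_Mapping.keys (m + m') \<subseteq> ?A" by (rule keys_add)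
  then show ?thesis
    by (simp add: monomial_value_eq[of ?A] lookup_add power_add prod.distrib)
qed

lemma monomial_0 [simp]: "monomial_value q bs 0 = 1" "monomial_degree 0 = 0"
  by (simp_all add: monomial_value_def monomial_degree_def)

lemma prod_list_nths:
  fixes xs :: "'a :: comm_monoid_mult list"
  shows "prod_list xs = prod_list (nths xs I) * prod_list (nths xs (- I))"
proof (induction xs arbitrary: I)
  case (Cons x xs)
  have "- {j. Suc j \<in> I} = {j. Suc j \<in> - I}" by auto
  then show ?case using Cons[of "{j. Suc j \<in> I}"] by (auto simp: nths_Cons ac_simps)
qed auto

lemma sum_list_nths:
  fixes xs :: "'a :: comm_monoid_add list"
  shows "sum_list xs = sum_list (nths xs I) + sum_list (nths xs (- I))"
proof (induction xs arbitrary: I)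
  case (Cons x xs)
  have "- {j. Suc j \<in> I} = {j. Suc j \<in> - I}" by auto
  then show ?case using Cons[of "{j. Suc j \<in> I}"] by (auto simp: nths_Cons ac_simps)
qed auto

lemma nths_zip: "nths (zip xs ys) I = zip (nths xs I) (nths ys I)"
  if "length xs = length ys"
  using that by (induction xs ys arbitrary: I rule: list_induct2) (auto simp: nths_Cons)

text \<open>
  The recursion distributes the variables over two factors by positions; conversely slots for
  the two factors have to be merged into slots for all variables.
\<close>

lemma ex_interleaving:
  assumes "length xs = length (nths zs I)" "length ys = length (nths zs (- I))"
  shows "\<exists>\<kappa>. length \<kappa> = length zs \<and> nths \<kappa> I = xs \<and> nths \<kappa> (- I) = ys \<and> set \<kappa> \<subseteq> set xs \<union> set ys"
  using assms
proof (induction zs arbitrary: I xs ys)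
  case (Cons z zs)
  define I' where "I' = {j. Suc j \<in> I}"
  have I': "- I' = {j. Suc j \<in> - I}" by (auto simp: I'_def)
  show ?case
  proof (cases "0 \<in> I")
    case True
    then obtain x xs' where xs: "xs = x # xs'" "length xs' = length (nths zs I')"
      using Cons.prems(1) by (cases xs) (auto simp: nths_Cons I'_def)
    have "length ys = length (nths zs (- I'))"
      using Cons.prems(2) True by (simp add: nths_Cons I')
    from Cons.IH[OF xs(2) this] obtain \<kappa> where "length \<kappa> = length zs" "nths \<kappa> I' = xs'"
      "nths \<kappa> (- I') = ys" "set \<kappa> \<subseteq> set xs' \<union> set ys" by blast
    then show ?thesis using True
      by (intro exI[of _ "x # \<kappa>"]) (auto simp: nths_Cons I' xs(1) simp flip: I'_def)
  next
    case False
    then obtain x ys' where ys: "ys = x # ys'" "length ys' = length (nths zs (- I'))"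
      using Cons.prems(2) by (cases ys) (auto simp: nths_Cons I')
    have "length xs = length (nths zs I')"
      using Cons.prems(1) False by (simp add: nths_Cons I'_def)
    from Cons.IH[OF this ys(2)] obtain \<kappa> where "length \<kappa> = length zs" "nths \<kappa> I' = xs"
      "nths \<kappa> (- I') = ys'" "set \<kappa> \<subseteq> set xs \<union> set ys'" by blast
    then show ?thesis using False
      by (intro exI[of _ "x # \<kappa>"]) (auto simp: nths_Cons I' ys(1) simp flip: I'_def)
  qed
qed auto

lemma psi_prod_nths:
  assumes "length \<kappa> = length zs"
  shows "psi_prod \<kappa> zs = psi_prod (nths \<kappa> I) (nths zs I) * psi_prod (nths \<kappa> (- I)) (nths zs (- I))"
  unfolding psi_prod_def by (subst prod_list_nths[of _ I]) (simp add: nths_map nths_zip assms)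

lemma psi_prod_Cons: "psi_prod ((b, k) # \<kappa>) (z # zs) = psi b (2 * k) z * psi_prod \<kappa> zs"
  by (simp add: psi_prod_def)

lemma term_product:
  assumes n1: "\<And>zs :: complex list. length zs = n \<Longrightarrow> length (nths zs I) = n1"
    and n2: "\<And>zs :: complex list. length zs = n \<Longrightarrow> length (nths zs (- I)) = n2"
    and ok: "admissible_term n1 d1 t1" "admissible_term n2 d2 t2"
  shows "\<exists>t. admissible_term n (d1 + d2) t \<and>
    (leading_term n1 d1 t1 \<and> leading_term n2 d2 t2 \<longrightarrow> leading_term n (d1 + d2) t) \<and>
    (\<forall>q ws. length ws = n \<longrightarrow>
       term_value q ws t = term_value q (nths ws I) t1 * term_value q (nths ws (- I)) t2)"
proof -
  obtain r1 m1 \<kappa>1 where t1: "t1 = (r1, m1, \<kappa>1)" by (cases t1)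
  obtain r2 m2 \<kappa>2 where t2: "t2 = (r2, m2, \<kappa>2)" by (cases t2)
  obtain \<kappa> where \<kappa>: "length \<kappa> = n" "nths \<kappa> I = \<kappa>1" "nths \<kappa> (- I) = \<kappa>2" "set \<kappa> \<subseteq> set \<kappa>1 \<union> set \<kappa>2"
    using ex_interleaving[of \<kappa>1 "replicate n (0 :: complex)" I \<kappa>2] n1[of "replicate n 0"] n2[of "replicate n 0"]
      ok t1 t2 by auto
  have wt: "sum_list (map snd \<kappa>) = sum_list (map snd \<kappa>1) + sum_list (map snd \<kappa>2)"
    using sum_list_nths[of "map snd \<kappa>" I] \<kappa> by (simp add: nths_map)
  have deg: "term_degree (r1 * r2, m1 + m2, \<kappa>) = term_degree t1 + term_degree t2"
    by (simp add: t1 t2 wt monomial_degree_add)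
  have keys: "Poly_Mapping.keys (m1 + m2) \<subseteq> Z ` {1..}"
    using keys_add[of m1 m2] ok t1 t2 by auto
  show ?thesis
  proof (intro exI[of _ "(r1 * r2, m1 + m2, \<kappa>)"] conjI allI impI)
    show *: "admissible_term n (d1 + d2) (r1 * r2, m1 + m2, \<kappa>)"
      using ok deg keys \<kappa>(1) unfolding t1 t2 by auto
    show "leading_term n (d1 + d2) (r1 * r2, m1 + m2, \<kappa>)"
      if "leading_term n1 d1 t1 \<and> leading_term n2 d2 t2"
      using that * deg \<kappa>(4) unfolding t1 t2 by auto
    fix q :: real and ws :: "complex list" assume "length ws = n"
    then show "term_value q ws (r1 * r2, m1 + m2, \<kappa>) =
        term_value q (nths ws I) t1 * term_value q (nths ws (- I)) t2"
      using psi_prod_nths[of \<kappa> ws I] \<kappa> by (simp add: t1 t2 monomial_value_add of_rat_mult)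
  qed
qed

lemma adm_nths:
  assumes "adm n q zs" "\<And>zs :: complex list. length zs = n \<Longrightarrow> length (nths zs I) = n1"
  shows "adm n1 q (nths zs I)"
  using assms unfolding adm_def by (auto dest: in_set_nthsD)

text \<open>
  Products of terms in disjoint sets of variables are terms, and degrees add. A product has
  exact degree \<open>d1 + d2\<close> only if both factors have exact degree, so the sign condition persists.
\<close>

lemma vspan_mult:
  assumes n1: "\<And>zs :: complex list. length zs = n \<Longrightarrow> length (nths zs I) = n1"
    and n2: "\<And>zs :: complex list. length zs = n \<Longrightarrow> length (nths zs (- I)) = n2"
    and "vspan n1 d1 \<Phi>" "vspan n2 d2 \<Psi>"
  shows "vspan n (d1 + d2) (\<lambda>q zs. \<Phi> q (nths zs I) * \<Psi> q (nths zs (- I)))"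
  using assms(3)
proof induction
  case (zero \<Phi>)
  then show ?case using adm_nths[OF _ n1] by (intro vspan.zero) auto
next
  case (add_term \<Phi> t1 \<Phi>')
  note ok1 = \<open>admissible_term n1 d1 t1\<close>
  have "vspan n (d1 + d2) (\<lambda>q zs. term_value q (nths zs I) t1 * \<Psi> q (nths zs (- I)))"
    using assms(4)
  proof induction
    case (zero \<Psi>)
    then show ?case using adm_nths[OF _ n2] by (intro vspan.zero) auto
  next
    case (add_term \<Psi> t2 \<Psi>')
    obtain t where t: "admissible_term n (d1 + d2) t" "\<And>q ws. length ws = n \<Longrightarrow>
       term_value q ws t = term_value q (nths ws I) t1 * term_value q (nths ws (- I)) t2"
      using term_product[of n I n1 n2 d1 t1 d2 t2, OF n1 n2 ok1 \<open>admissible_term n2 d2 t2\<close>] by blast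
    show ?case
    proof (rule vspan.add_term[OF add_term.IH t(1)])
      fix q zs assume z: "adm n q zs"
      then have "length zs = n" by (simp add: adm_def)
      then show "term_value q (nths zs I) t1 * \<Psi>' q (nths zs (- I)) =
          term_value q (nths zs I) t1 * \<Psi> q (nths zs (- I)) + term_value q zs t"
        by (simp add: t(2) add_term.hyps(3)[OF adm_nths[OF z n2]] algebra_simps)
    qed
  qed
  from vspan_add[OF add_term.IH this] show ?case
  proof (rule vspan_cong)
    fix q zs assume z: "adm n q zs"
    show "\<Phi>' q (nths zs I) * \<Psi> q (nths zs (- I)) = \<Phi> q (nths zs I) * \<Psi> q (nths zs (- I)) +
        term_value q (nths zs I) t1 * \<Psi> q (nths zs (- I))"
      by (simp add: add_term.hyps(3)[OF adm_nths[OF z n1]] algebra_simps)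
  qed
qed

lemma vspan_pos_mult:
  assumes n1: "\<And>zs :: complex list. length zs = n \<Longrightarrow> length (nths zs I) = n1"
    and n2: "\<And>zs :: complex list. length zs = n \<Longrightarrow> length (nths zs (- I)) = n2"
    and "vspan_pos n1 d1 \<Phi>" "vspan_pos n2 d2 \<Psi>"
  shows "vspan_pos n (d1 + d2) (\<lambda>q zs. \<Phi> q (nths zs I) * \<Psi> q (nths zs (- I)))"
proof -
  obtain \<Phi>0 t1 where 1: "vspan n1 d1 \<Phi>0" "leading_term n1 d1 t1"
    "\<forall>q zs. adm n1 q zs \<longrightarrow> \<Phi> q zs = \<Phi>0 q zs + term_value q zs t1"
    using assms(3) unfolding vspan_pos_def by blast
  obtain \<Psi>0 t2 where 2: "vspan n2 d2 \<Psi>0" "leading_term n2 d2 t2"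
    "\<forall>q zs. adm n2 q zs \<longrightarrow> \<Psi> q zs = \<Psi>0 q zs + term_value q zs t2"
    using assms(4) unfolding vspan_pos_def by blast
  have ok: "admissible_term n1 d1 t1" "admissible_term n2 d2 t2"
    using 1(2) 2(2) by (cases t1; cases t2; simp)+
  obtain t where t: "leading_term n (d1 + d2) t" "\<And>q ws. length ws = n \<Longrightarrow>
       term_value q ws t = term_value q (nths ws I) t1 * term_value q (nths ws (- I)) t2"
    using term_product[of n I n1 n2 d1 t1 d2 t2, OF n1 n2 ok] 1(2) 2(2) by blast
  define R where "R q zs = \<Phi>0 q (nths zs I) * \<Psi> q (nths zs (- I)) +
     term_value q (nths zs I) t1 * \<Psi>0 q (nths zs (- I))" for q zs
  have "vspan n (d1 + d2) R"
    unfolding R_def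
    by (intro vspan_add vspan_mult[OF n1 n2] vspan_mult[OF n1 n2, where \<Phi>="\<lambda>q zs. term_value q zs t1"]
        1 2 vspan_pos_imp_vspan[OF assms(4)] vspan_term ok)
  moreover have "\<Phi> q (nths zs I) * \<Psi> q (nths zs (- I)) = R q zs + term_value q zs t"
    if z: "adm n q zs" for q zs
  proof -
    have "length zs = n" using z by (simp add: adm_def)
    then show ?thesis
      using 1(3) 2(3) adm_nths[OF z n1] adm_nths[OF z n2] by (simp add: R_def t(2) algebra_simps)
  qed
  ultimately show ?thesis unfolding vspan_pos_def using t(1) by blast
qed

lemma vspan_const:
  assumes "0 < d \<or> d = 0 \<and> 0 \<le> r \<or> r = 0"
  shows "vspan 0 d (\<lambda>q zs. of_rat r)"
proof (cases "r = 0")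
  case False
  have "vspan 0 d (\<lambda>q zs. term_value q zs (r, 0, []))"
    by (rule vspan_term) (use assms False in auto)
  then show ?thesis by (rule vspan_cong) (auto simp: adm_def psi_prod_def)
qed simp

lemma vspan_pos_const:
  assumes "0 < r"
  shows "vspan_pos 0 0 (\<lambda>q zs. of_rat r)"
proof -
  have "vspan_pos 0 0 (\<lambda>q zs. term_value q zs (r, 0, []))"
    by (rule vspan_pos_term) (use assms in auto)
  then show ?thesis by (rule vspan_pos_cong) (auto simp: adm_def psi_prod_def)
qed

lemma vspan_mult_const:
  assumes "vspan 0 d1 \<Phi>" "vspan n d2 \<Psi>"
  shows "vspan n (d1 + d2) (\<lambda>q zs. \<Phi> q [] * \<Psi> q zs)"
  using vspan_mult[OF _ _ assms, of n "{}"] by (simp add: nths_all)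

lemma vspan_pos_mult_const:
  assumes "vspan_pos 0 d1 \<Phi>" "vspan_pos n d2 \<Psi>"
  shows "vspan_pos n (d1 + d2) (\<lambda>q zs. \<Phi> q [] * \<Psi> q zs)"
  using vspan_pos_mult[OF _ _ assms, of n "{}"] by (simp add: nths_all)

lemma nths_first:
  assumes "zs \<noteq> []"
  shows "nths zs {0} = [hd zs]" "nths zs (- {0}) = tl zs"
proof -
  obtain y ys where zs: "zs = y # ys" using assms by (cases zs) auto
  have "{j. Suc j \<in> {0}} = {}" "{j. Suc j \<in> - {0}} = UNIV" by auto
  then show "nths zs {0} = [hd zs]" "nths zs (- {0}) = tl zs"
    by (simp_all add: zs nths_Cons nths_all)
qed

lemma vspan_psi:
  assumes "0 < r"
  shows "vspan 1 (2 * int k) (\<lambda>q zs. of_rat r * psi a (2 * k) (hd zs))"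
    and "a \<Longrightarrow> vspan_pos 1 (2 * int k) (\<lambda>q zs. of_rat r * psi a (2 * k) (hd zs))"
proof -
  have *: "term_value q zs (r, 0, [(a, k)]) = of_rat r * psi a (2 * k) (hd zs)" if "adm 1 q zs" for q zs
    using that by (cases zs) (auto simp: adm_def psi_prod_def)
  have "vspan 1 (2 * int k) (\<lambda>q zs. term_value q zs (r, 0, [(a, k)]))"
    by (rule vspan_term) (use assms in auto)
  then show "vspan 1 (2 * int k) (\<lambda>q zs. of_rat r * psi a (2 * k) (hd zs))"
    by (rule vspan_cong) (rule *[symmetric])
  assume a
  then have "vspan_pos 1 (2 * int k) (\<lambda>q zs. term_value q zs (r, 0, [(a, k)]))"
    by (intro vspan_pos_term) (use assms in auto)
  then show "vspan_pos 1 (2 * int k) (\<lambda>q zs. of_rat r * psi a (2 * k) (hd zs))"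
    by (rule vspan_pos_cong) (rule *[symmetric])
qed

lemma vspan_Cons:
  assumes "0 < r" "vspan n d \<Phi>"
  shows "vspan (Suc n) (2 * int k + d) (\<lambda>q zs. of_rat r * psi a (2 * k) (hd zs) * \<Phi> q (tl zs))"
proof -
  have *: "length (nths zs {0}) = 1" "length (nths zs (- {0})) = n" if "length zs = Suc n" for zs :: "complex list"
  proof -
    have "zs \<noteq> []" using that by auto
    then show "length (nths zs {0}) = 1" "length (nths zs (- {0})) = n" using that by (simp_all add: nths_first)
  qed
  show ?thesis
    using vspan_mult[OF * vspan_psi(1)[OF assms(1), of k a] assms(2)]
  proof (rule vspan_cong)
    fix q and zs :: "complex list" assume "adm (Suc n) q zs"
    then have "zs \<noteq> []" by (auto simp: adm_def)
    then show "of_rat r * psi a (2 * k) (hd zs) * \<Phi> q (tl zs) =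
        of_rat r * psi a (2 * k) (hd (nths zs {0})) * \<Phi> q (nths zs (- {0}))"
      by (simp add: nths_first)
  qed
qed

lemma vspan_pos_Cons:
  assumes "0 < r" "vspan_pos n d \<Phi>"
  shows "vspan_pos (Suc n) (2 * int k + d) (\<lambda>q zs. of_rat r * psi True (2 * k) (hd zs) * \<Phi> q (tl zs))"
proof -
  have *: "length (nths zs {0}) = 1" "length (nths zs (- {0})) = n" if "length zs = Suc n" for zs :: "complex list"
  proof -
    have "zs \<noteq> []" using that by auto
    then show "length (nths zs {0}) = 1" "length (nths zs (- {0})) = n" using that by (simp_all add: nths_first)
  qed
  show ?thesis
    using vspan_pos_mult[OF * vspan_psi(2)[OF assms(1) TrueI, of k] assms(2)]
  proof (rule vspan_pos_cong)
    fix q and zs :: "complex list" assume "adm (Suc n) q zs"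
    then have "zs \<noteq> []" by (auto simp: adm_def)
    then show "of_rat r * psi True (2 * k) (hd zs) * \<Phi> q (tl zs) =
        of_rat r * psi True (2 * k) (hd (nths zs {0})) * \<Phi> q (nths zs (- {0}))"
      by (simp add: nths_first)
  qed simp
qed

section \<open>Laurent series with coefficients in the span\<close>

text \<open>
  Here the local coordinate has degree \<open>-1\<close>. Odd coefficients are left unconstrained above
  the lower bound: those of the expansion of \<open>\<omega>\<^sub>0\<^sub>,\<^sub>2\<close> are not in the span, but they never meet the odd
  kernel in a residue.
\<close>

definition lfam :: "nat \<Rightarrow> int \<Rightarrow> (real \<Rightarrow> complex list \<Rightarrow> complex fls) \<Rightarrow> bool" where
  "lfam n d G \<longleftrightarrow> (\<forall>i. even i \<longrightarrow> vspan n (d + i) (\<lambda>q zs. G q zs $$ i)) \<and>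
     (\<forall>i q zs. adm n q zs \<longrightarrow> i < - d \<longrightarrow> G q zs $$ i = 0)"

definition lfam_even :: "nat \<Rightarrow> int \<Rightarrow> (real \<Rightarrow> complex list \<Rightarrow> complex fls) \<Rightarrow> bool" where
  "lfam_even n d G \<longleftrightarrow> lfam n d G \<and> (\<forall>i q zs. adm n q zs \<longrightarrow> odd i \<longrightarrow> G q zs $$ i = 0)"

lemma lfam_0 [simp]: "lfam n d (\<lambda>q zs. 0)" "lfam_even n d (\<lambda>q zs. 0)"
  by (simp_all add: lfam_def lfam_even_def)

lemma lfam_evenI:
  assumes "\<And>i. even i \<Longrightarrow> vspan n (d + i) (\<lambda>q zs. G q zs $$ i)"
    and "\<And>i q zs. adm n q zs \<Longrightarrow> odd i \<Longrightarrow> G q zs $$ i = 0"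
  shows "lfam_even n d G"
  unfolding lfam_even_def lfam_def
proof (intro conjI allI impI)
  fix i q zs assume *: "adm n q zs" "i < - d"
  show "G q zs $$ i = 0"
  proof (cases "even i")
    case True
    then show ?thesis using vspan_negative_degree[OF assms(1)[of i] _ *(1)] * by simp
  qed (use assms(2) * in auto)
qed (use assms in auto)

lemma lfam_add:
  assumes "lfam n d F" "lfam n d G"
  shows "lfam n d (\<lambda>q zs. F q zs + G q zs)"
  using assms unfolding lfam_def by (auto intro: vspan_add)

lemma lfam_even_add:
  assumes "lfam_even n d F" "lfam_even n d G"
  shows "lfam_even n d (\<lambda>q zs. F q zs + G q zs)"
  using assms unfolding lfam_even_def by (auto intro: lfam_add)

lemma lfam_sum: "(\<And>x. x \<in> A \<Longrightarrow> lfam n d (G x)) \<Longrightarrow> lfam n d (\<lambda>q zs. \<Sum>x\<in>A. G x q zs)"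
  by (induction A rule: infinite_finite_induct) (auto intro: lfam_add)

lemma fls_times_nth_interval:
  fixes F G :: "complex fls"
  assumes "\<And>i. i < - d1 \<Longrightarrow> F $$ i = 0" "\<And>i. i < - d2 \<Longrightarrow> G $$ i = 0"
  shows "(F * G) $$ m = (\<Sum>i\<in>{- d1..m + d2}. F $$ i * G $$ (m - i))"
proof (cases "F = 0 \<or> G = 0")
  case False
  have sub: "- d1 \<le> fls_subdegree F" "- d2 \<le> fls_subdegree G"
    using False assms nth_fls_subdegree_nonzero by (metis not_le)+
  show ?thesis
    unfolding fls_times_nth(2)
  proof (rule sum.mono_neutral_left)
    show "{fls_subdegree F..m - fls_subdegree G} \<subseteq> {- d1..m + d2}" using sub by auto
    show "\<forall>i\<in>{- d1..m + d2} - {fls_subdegree F..m - fls_subdegree G}. F $$ i * G $$ (m - i) = 0"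
    proof
      fix i assume "i \<in> {- d1..m + d2} - {fls_subdegree F..m - fls_subdegree G}"
      then have "i < fls_subdegree F \<or> m - i < fls_subdegree G" by auto
      then show "F $$ i * G $$ (m - i) = 0" by auto
    qed
  qed simp
qed auto

text \<open>
  Since the odd coefficients of the second factor vanish, an even coefficient of the product
  involves only even coefficients of the first.
\<close>

lemma lfam_mult_nth:
  assumes n1: "\<And>zs :: complex list. length zs = n \<Longrightarrow> length (nths zs I) = n1"
    and n2: "\<And>zs :: complex list. length zs = n \<Longrightarrow> length (nths zs (- I)) = n2"
    and F: "lfam n1 d1 F" and G: "lfam_even n2 d2 G" and adm: "adm n q zs" and m: "even m"
  shows "(F q (nths zs I) * G q (nths zs (- I))) $$ m =
    (\<Sum>i\<in>{i \<in> {- d1..m + d2}. even i}. F q (nths zs I) $$ i * G q (nths zs (- I)) $$ (m - i))"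
proof -
  note adms = adm_nths[OF adm n1] adm_nths[OF adm n2]
  have "(F q (nths zs I) * G q (nths zs (- I))) $$ m =
      (\<Sum>i\<in>{- d1..m + d2}. F q (nths zs I) $$ i * G q (nths zs (- I)) $$ (m - i))"
    by (rule fls_times_nth_interval) (use F G adms in \<open>auto simp: lfam_def lfam_even_def\<close>)
  also have "\<dots> = (\<Sum>i\<in>{i \<in> {- d1..m + d2}. even i}. F q (nths zs I) $$ i * G q (nths zs (- I)) $$ (m - i))"
    by (rule sum.mono_neutral_right) (use G adms m in \<open>auto simp: lfam_even_def\<close>)
  finally show ?thesis .
qed

lemma lfam_mult:
  assumes n1: "\<And>zs :: complex list. length zs = n \<Longrightarrow> length (nths zs I) = n1"
    and n2: "\<And>zs :: complex list. length zs = n \<Longrightarrow> length (nths zs (- I)) = n2"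
    and F: "lfam n1 d1 F" and G: "lfam_even n2 d2 G"
  shows "lfam n (d1 + d2) (\<lambda>q zs. F q (nths zs I) * G q (nths zs (- I)))"
  unfolding lfam_def
proof (intro conjI allI impI)
  fix m :: int assume m: "even m"
  have "vspan n (d1 + d2 + m) (\<lambda>q zs. \<Sum>i\<in>{i \<in> {- d1..m + d2}. even i}.
      F q (nths zs I) $$ i * G q (nths zs (- I)) $$ (m - i))"
  proof (rule vspan_sum)
    fix i assume i: "i \<in> {i \<in> {- d1..m + d2}. even i}"
    have "vspan n ((d1 + i) + (d2 + (m - i))) (\<lambda>q zs. F q (nths zs I) $$ i * G q (nths zs (- I)) $$ (m - i))"
      by (rule vspan_mult[OF n1 n2]) (use F G i m in \<open>auto simp: lfam_def lfam_even_def\<close>)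
    then show "vspan n (d1 + d2 + m) (\<lambda>q zs. F q (nths zs I) $$ i * G q (nths zs (- I)) $$ (m - i))"
      by (simp add: algebra_simps)
  qed
  then show "vspan n (d1 + d2 + m) (\<lambda>q zs. (F q (nths zs I) * G q (nths zs (- I))) $$ m)"
    by (rule vspan_cong) (rule lfam_mult_nth[OF n1 n2 F G _ m])
next
  fix m q zs assume adm: "adm n q zs" and m: "m < - (d1 + d2)"
  note adms = adm_nths[OF adm n1] adm_nths[OF adm n2]
  have "(F q (nths zs I) * G q (nths zs (- I))) $$ m =
      (\<Sum>i\<in>{- d1..m + d2}. F q (nths zs I) $$ i * G q (nths zs (- I)) $$ (m - i))"
    by (rule fls_times_nth_interval) (use F G adms in \<open>auto simp: lfam_def lfam_even_def\<close>)
  then show "(F q (nths zs I) * G q (nths zs (- I))) $$ m = 0" using m by simp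
qed

lemma lfam_even_mult:
  assumes n1: "\<And>zs :: complex list. length zs = n \<Longrightarrow> length (nths zs I) = n1"
    and n2: "\<And>zs :: complex list. length zs = n \<Longrightarrow> length (nths zs (- I)) = n2"
    and F: "lfam_even n1 d1 F" and G: "lfam_even n2 d2 G"
  shows "lfam_even n (d1 + d2) (\<lambda>q zs. F q (nths zs I) * G q (nths zs (- I)))"
  unfolding lfam_even_def
proof (intro conjI allI impI)
  show "lfam n (d1 + d2) (\<lambda>q zs. F q (nths zs I) * G q (nths zs (- I)))"
    using lfam_mult[OF n1 n2 _ G] F by (auto simp: lfam_even_def)
  fix m q zs assume adm: "adm n q zs" and m: "odd (m :: int)"
  note adms = adm_nths[OF adm n1] adm_nths[OF adm n2]
  have "(F q (nths zs I) * G q (nths zs (- I))) $$ m =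
      (\<Sum>i\<in>{- d1..m + d2}. F q (nths zs I) $$ i * G q (nths zs (- I)) $$ (m - i))"
    by (rule fls_times_nth_interval) (use F G adms in \<open>auto simp: lfam_def lfam_even_def\<close>)
  also have "\<dots> = 0"
  proof (rule sum.neutral, rule ballI)
    fix i assume "i \<in> {- d1..m + d2}"
    have "odd i \<or> odd (m - i)" using m by auto
    then show "F q (nths zs I) $$ i * G q (nths zs (- I)) $$ (m - i) = 0"
      using F G adms by (auto simp: lfam_even_def simp del: even_diff)
  qed
  finally show "(F q (nths zs I) * G q (nths zs (- I))) $$ m = 0" .
qed

lemma lfam_mult_leading:
  assumes n1: "\<And>zs :: complex list. length zs = n \<Longrightarrow> length (nths zs I) = n1"
    and n2: "\<And>zs :: complex list. length zs = n \<Longrightarrow> length (nths zs (- I)) = n2"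
    and F: "lfam n1 d1 F" and G: "lfam_even n2 d2 G"
    and ij: "even i" "even j" "- d1 \<le> i" "- d2 \<le> j"
    and pos: "vspan_pos n1 (d1 + i) (\<lambda>q zs. F q zs $$ i)" "vspan_pos n2 (d2 + j) (\<lambda>q zs. G q zs $$ j)"
  shows "vspan_pos n (d1 + d2 + (i + j)) (\<lambda>q zs. (F q (nths zs I) * G q (nths zs (- I))) $$ (i + j))"
proof -
  let ?m = "i + j"
  have m: "even ?m" using ij by simp
  have "vspan_pos n (d1 + d2 + ?m) (\<lambda>q zs. \<Sum>i\<in>{i \<in> {- d1..?m + d2}. even i}.
      F q (nths zs I) $$ i * G q (nths zs (- I)) $$ (?m - i))"
  proof (rule vspan_pos_sum[of _ i])
    have "vspan_pos n ((d1 + i) + (d2 + j)) (\<lambda>q zs. F q (nths zs I) $$ i * G q (nths zs (- I)) $$ j)"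
      by (rule vspan_pos_mult[OF n1 n2]) (use pos in auto)
    then show "vspan_pos n (d1 + d2 + ?m) (\<lambda>q zs. F q (nths zs I) $$ i * G q (nths zs (- I)) $$ (?m - i))"
      by (simp add: algebra_simps)
    show "finite {i \<in> {- d1..?m + d2}. even i}" by (rule finite_Collect_conjI) simp
    show "i \<in> {i \<in> {- d1..?m + d2}. even i}" using ij by auto
  next
    fix k assume k: "k \<in> {i \<in> {- d1..?m + d2}. even i}"
    have "vspan n ((d1 + k) + (d2 + (?m - k))) (\<lambda>q zs. F q (nths zs I) $$ k * G q (nths zs (- I)) $$ (?m - k))"
      by (rule vspan_mult[OF n1 n2]) (use F G k m in \<open>auto simp: lfam_def lfam_even_def\<close>)
    then show "vspan n (d1 + d2 + ?m) (\<lambda>q zs. F q (nths zs I) $$ k * G q (nths zs (- I)) $$ (?m - k))"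
      by (simp add: algebra_simps)
  qed
  then show ?thesis
    by (rule vspan_pos_cong) (rule lfam_mult_nth[OF n1 n2 F G _ m])
qed

lemma lfam_even_mult_const:
  assumes "lfam_even 0 d1 F" "lfam_even n d2 G"
  shows "lfam_even n (d1 + d2) (\<lambda>q zs. F q [] * G q zs)"
  using lfam_even_mult[OF _ _ assms, of n "{}"] by (simp add: nths_all)

lemma lfam_mult_const:
  assumes "lfam_even 0 d1 F" "lfam n d2 G"
  shows "lfam n (d1 + d2) (\<lambda>q zs. F q [] * G q zs)"
  using lfam_mult[OF _ _ assms(2,1), of n "UNIV"] by (simp add: nths_all mult.commute add.commute)

lemma lfam_mult_const_leading:
  assumes "lfam_even 0 d1 F" "lfam n d2 G" "even i" "even j" "- d1 \<le> i" "- d2 \<le> j"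
    and "vspan_pos 0 (d1 + i) (\<lambda>q zs. F q zs $$ i)" "vspan_pos n (d2 + j) (\<lambda>q zs. G q zs $$ j)"
  shows "vspan_pos n (d1 + d2 + (i + j)) (\<lambda>q zs. (F q [] * G q zs) $$ (i + j))"
  using lfam_mult_leading[OF _ _ assms(2,1) assms(4,3) assms(6,5) assms(8,7), of n "UNIV"]
  by (simp add: nths_all mult.commute add.commute)

section \<open>Even power series with rational coefficients\<close>

text \<open>
  Rationality and evenness are tracked together because both are inherited by products and
  inverses.
\<close>

definition evrat :: "complex fps \<Rightarrow> bool" where
  "evrat f \<longleftrightarrow> (\<forall>n. fps_nth f n \<in> \<rat> \<and> (odd n \<longrightarrow> fps_nth f n = 0))"

lemma evrat_1 [simp]: "evrat 1"
  by (auto simp: evrat_def)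

lemma evrat_mult: "evrat f \<Longrightarrow> evrat g \<Longrightarrow> evrat (f * g)"
  unfolding evrat_def fps_mult_nth
proof (intro allI conjI impI)
  fix n assume *: "\<forall>n. fps_nth f n \<in> \<rat> \<and> (odd n \<longrightarrow> fps_nth f n = 0)"
     "\<forall>n. fps_nth g n \<in> \<rat> \<and> (odd n \<longrightarrow> fps_nth g n = 0)"
  show "(\<Sum>i = 0..n. fps_nth f i * fps_nth g (n - i)) \<in> \<rat>"
    using * by (intro Rats_sum Rats_mult) auto
  assume n: "odd n"
  show "(\<Sum>i = 0..n. fps_nth f i * fps_nth g (n - i)) = 0"
  proof (rule sum.neutral, rule ballI)
    fix i assume "i \<in> {0..n}"
    then have "odd i \<or> odd (n - i)" using n by auto
    then show "fps_nth f i * fps_nth g (n - i) = 0" using * by (auto simp del: even_diff_nat)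
  qed
qed

lemma evrat_power: "evrat f \<Longrightarrow> evrat (f ^ n)"
  by (induction n) (auto intro: evrat_mult)

lemma evrat_inverse:
  assumes "evrat f"
  shows "evrat (inverse f)"
proof -
  have *: "natfun_inverse f n \<in> \<rat> \<and> (odd n \<longrightarrow> natfun_inverse f n = 0)" for n
  proof (induction n rule: less_induct)
    case (less n)
    show ?case
    proof (cases n)
      case 0
      then show ?thesis using assms by (auto simp: evrat_def intro: Rats_inverse)
    next
      case (Suc k)
      have eq: "natfun_inverse f n = - inverse (fps_nth f 0) * (\<Sum>i = 1..n. fps_nth f i * natfun_inverse f (n - i))"
        by (simp add: Suc)
      have "natfun_inverse f n \<in> \<rat>"
        unfolding eq using assms less by (intro Rats_mult Rats_sum) (auto simp: evrat_def intro: Rats_inverse)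
      moreover have "natfun_inverse f n = 0" if n: "odd n"
      proof -
        have "(\<Sum>i = 1..n. fps_nth f i * natfun_inverse f (n - i)) = 0"
        proof (rule sum.neutral, rule ballI)
          fix i assume i: "i \<in> {1..n}"
          then have "odd i \<or> odd (n - i)" using n by auto
          then show "fps_nth f i * natfun_inverse f (n - i) = 0"
            using less[of "n - i"] i assms by (auto simp: evrat_def)
        qed
        then show ?thesis unfolding eq by simp
      qed
      ultimately show ?thesis by blast
    qed
  qed
  then show ?thesis by (simp add: evrat_def fps_inverse_def)
qed

text \<open>The power series of \<open>2 sinh (c t) / t\<close>.\<close>

definition sinhc :: "complex \<Rightarrow> complex fps" where
  "sinhc c = Abs_fps (\<lambda>n. fps_nth (fps_exp c - fps_exp (- c)) (Suc n))"

lemma fact_in_Rats: "(fact n :: complex) \<in> \<rat>"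
  by (metis Rats_of_nat of_nat_fact)

lemma evrat_sinhc: "c \<in> \<rat> \<Longrightarrow> evrat (sinhc c)"
  by (auto simp: evrat_def sinhc_def simp del: fact_Suc of_nat_Suc power_Suc
      intro!: Rats_diff Rats_divide Rats_power fact_in_Rats)

lemma sinhc_X: "fps_exp c - fps_exp (- c) = fps_X * sinhc c"
proof (rule fps_ext)
  fix n show "fps_nth (fps_exp c - fps_exp (- c)) n = fps_nth (fps_X * sinhc c) n"
    by (cases n) (simp_all add: sinhc_def del: fact_Suc of_nat_Suc power_Suc)
qed

lemma sinhc_0: "fps_nth (sinhc c) 0 = 2 * c"
  by (simp add: sinhc_def)

definition coshs :: "complex \<Rightarrow> complex fps" where
  "coshs c = fps_exp c + fps_exp (- c)"

lemma evrat_coshs: "c \<in> \<rat> \<Longrightarrow> evrat (coshs c)"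
  by (auto simp: evrat_def coshs_def intro!: Rats_add Rats_divide fact_in_Rats)

section \<open>Residues under a change of coordinate\<close>

lemma fls_deriv_compose_fps_to_fls:
  fixes B :: "complex fps"
  assumes "fps_nth H 0 = 0" "H \<noteq> 0"
  shows "fls_deriv (fls_compose_fps (fps_to_fls B) H) =
    fls_compose_fps (fls_deriv (fps_to_fls B)) H * fps_to_fls (fps_deriv H)"
  using assms
  by (simp add: fls_deriv_fps_to_fls fps_compose_deriv fls_times_fps_to_fls)

text \<open>
  The chain rule for Laurent series follows from the one for power series after multiplication
  with a power of the variable, which clears the pole.
\<close>

lemma fls_deriv_compose:
  fixes A :: "complex fls"
  assumes "fps_nth H 0 = 0" "H \<noteq> 0"
  shows "fls_deriv (fls_compose_fps A H) = fls_compose_fps (fls_deriv A) H * fps_to_fls (fps_deriv H)"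
proof -
  define n where "n = nat (- fls_subdegree A)"
  have "\<exists>B. A * fls_X ^ n = fps_to_fls B"
  proof -
    have "fls_subdegree (A * fls_X ^ n) \<ge> 0"
      by (cases "A = 0") (auto simp: n_def)
    then show ?thesis by (metis fls_regpart_to_fls_trivial)
  qed
  then obtain B where B: "A * fls_X ^ n = fps_to_fls B" by blast
  let ?c = "\<lambda>F. fls_compose_fps F H"
  let ?H = "fps_to_fls H"
  have H: "?H \<noteq> 0" using assms by simp
  have mult: "?c (F * G) = ?c F * ?c G" for F G
    by (rule fls_compose_fps_mult) (use assms in auto)
  have cX: "?c (fls_X ^ n) = ?H ^ n" using assms by (simp add: fls_compose_fps_power)
  have dX: "fls_X ^ n = fps_to_fls (fps_X ^ n :: complex fps)"
    by (simp add: fps_to_fls_power)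
  let ?D = "fps_to_fls (fps_deriv H)"
  have "fls_deriv (?c (A * fls_X ^ n)) = ?c (fls_deriv (A * fls_X ^ n)) * ?D"
    unfolding B by (rule fls_deriv_compose_fps_to_fls[OF assms])
  then have "fls_deriv (?c A) * ?H ^ n + ?c A * fls_deriv (?c (fls_X ^ n)) =
     (?c (fls_deriv A) * ?H ^ n + ?c A * ?c (fls_deriv (fls_X ^ n))) * ?D"
    using assms by (simp add: mult cX fls_compose_fps_add algebra_simps)
  moreover have "fls_deriv (?c (fls_X ^ n)) = ?c (fls_deriv (fls_X ^ n)) * ?D"
    unfolding dX by (rule fls_deriv_compose_fps_to_fls[OF assms])
  ultimately have "fls_deriv (?c A) * ?H ^ n = ?c (fls_deriv A) * ?D * ?H ^ n"
    by (simp add: algebra_simps)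
  then show ?thesis using H by simp
qed

text \<open>
  Apart from its residue part a Laurent series is a derivative. The substitution turns derivatives
  into derivatives, which have no residue, and turns \<open>1/X\<close> into the logarithmic derivative of
  a series with a simple zero.
\<close>

lemma fls_residue_compose:
  fixes G :: "complex fls"
  assumes "fps_nth H 0 = 0" "fps_nth H 1 \<noteq> 0"
  shows "fls_residue (fls_compose_fps G H * fps_to_fls (fps_deriv H)) = fls_residue G"
proof -
  have H: "H \<noteq> 0" using assms(2) by auto
  define c where "c = fls_residue G"
  define A where "A = fls_integral (G - fls_const c * fls_X_inv)"
  have "fls_deriv A = G - fls_const c * fls_X_inv"
    unfolding A_def by (rule fls_deriv_fls_integral) (simp add: c_def)
  then have "G = fls_const c * fls_X_inv + fls_deriv A" by simp
  moreover have "fls_compose_fps fls_X_inv H = inverse (fps_to_fls H)"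
    using assms H by (simp add: fls_compose_fps_inverse flip: fls_inverse_X)
  ultimately have "fls_compose_fps G H * fps_to_fls (fps_deriv H) =
     fls_const c * (inverse (fps_to_fls H) * fls_deriv (fps_to_fls H)) + fls_deriv (fls_compose_fps A H)"
    using assms H
    by (simp add: fls_compose_fps_add fls_compose_fps_mult fls_deriv_compose algebra_simps fls_deriv_fps_to_fls)
  moreover have "fls_residue (inverse (fps_to_fls H) * fls_deriv (fps_to_fls H)) = 1"
  proof -
    have "subdegree H = 1" using assms by (intro subdegreeI) auto
    then show ?thesis
      by (simp only: fls_residue_deriv_times_inverse_eq_subdegree fls_subdegree_fls_to_fps) simp
  qed
  ultimately show ?thesis using fls_residue_deriv[of "fls_compose_fps A H"]
    by (simp add: c_def)
qed

text \<open>
  The residues in the recursion are taken in \<open>z\<close>, while evenness and the degree are visible only in the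
  logarithmic coordinate \<open>t\<close> with \<open>z = \<alpha> e^t\<close>.
\<close>

lemma residue_exp_coordinate:
  assumes "\<alpha> \<noteq> 0" "(\<lambda>t. f (\<alpha> * exp t) * (\<alpha> * exp t)) has_laurent_expansion G"
  shows "residue f \<alpha> = fls_residue G"
proof -
  \<comment> \<open>the coordinate change \<open>t = L (z - \<alpha>)\<close>\<close>
  define L where "L w = Ln (1 + w / \<alpha>)" for w
  have ana: "L analytic_on {0}"
    unfolding L_def by (intro analytic_intros) (use assms in auto)
  define H where "H = fps_expansion L 0"
  have LH: "L has_fps_expansion H"
    unfolding H_def by (rule analytic_at_imp_has_fps_expansion_0[OF ana])
  have H0: "fps_nth H 0 = 0"
    using has_fps_expansion_imp_0_eq_fps_nth_0[OF LH] by (simp add: L_def)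
  have dL: "(L has_field_derivative 1 / (\<alpha> + w)) (at w)" if "w \<in> ball 0 (norm \<alpha>)" for w
  proof -
    have "norm (w / \<alpha>) < 1" using that assms(1) by (simp add: norm_divide)
    then have "1 + w / \<alpha> \<notin> \<real>\<^sub>\<le>\<^sub>0"
      using abs_Re_le_cmod[of "w / \<alpha>"] by (auto simp: complex_nonpos_Reals_iff)
    moreover have "\<alpha> + w \<noteq> 0"
      using that by (auto simp: add_eq_0_iff)
    ultimately show ?thesis
      unfolding L_def using assms(1)
      by (auto intro!: derivative_eq_intros simp: divide_simps)
  qed
  have dH: "(\<lambda>w. 1 / (\<alpha> + w)) has_laurent_expansion fls_deriv (fps_to_fls H)"
    by (rule has_laurent_expansion_deriv'[OF has_laurent_expansion_fps[OF LH] open_ball, of 0 "norm \<alpha>"])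
       (use dL assms(1) in auto)
  have H1: "fps_nth H 1 \<noteq> 0"
  proof -
    have "(\<lambda>w. 1 / (\<alpha> + w)) has_fps_expansion fps_deriv H"
    proof -
      have "deriv L has_fps_expansion fps_deriv H" by (intro fps_expansion_intros LH)
      moreover have "eventually (\<lambda>w. deriv L w = 1 / (\<alpha> + w)) (nhds 0)"
        using eventually_nhds_in_open[of "ball 0 (norm \<alpha>)" 0] assms(1) dL
        by (auto elim!: eventually_mono intro!: DERIV_imp_deriv)
      ultimately show ?thesis using has_fps_expansion_cong[of "deriv L" "\<lambda>w. 1 / (\<alpha> + w)"] by blast
    qed
    from has_fps_expansion_imp_0_eq_fps_nth_0[OF this] have "fps_nth H 1 = 1 / \<alpha>" by simp
    then show ?thesis using assms(1) by simp
  qed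
  have "((\<lambda>t. f (\<alpha> * exp t) * (\<alpha> * exp t)) \<circ> L) has_laurent_expansion fls_compose_fps G H"
    by (rule has_laurent_expansion_compose[OF assms(2) has_laurent_expansion_fps[OF LH] H0]) (use H1 in auto)
  from has_laurent_expansion_mult[OF this dH]
  have "(\<lambda>w. f (\<alpha> + w)) has_laurent_expansion (fls_compose_fps G H * fls_deriv (fps_to_fls H))"
  proof (rule iffD1[OF has_laurent_expansion_cong[OF _ refl], rotated])
    have "eventually (\<lambda>w. w \<in> ball 0 (norm \<alpha>)) (at (0::complex))"
      using assms(1) by (intro eventually_at_in_open') auto
    then show "\<forall>\<^sub>F w in at 0. ((\<lambda>t. f (\<alpha> * exp t) * (\<alpha> * exp t)) \<circ> L) w * (1 / (\<alpha> + w)) = f (\<alpha> + w)"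
    proof eventually_elim
      case (elim w)
      have nz: "\<alpha> + w \<noteq> 0"
        using elim by (auto simp: add_eq_0_iff)
      then have "1 + w / \<alpha> \<noteq> 0" using assms(1) by (simp add: field_simps)
      then have "\<alpha> * exp (L w) = \<alpha> + w" using assms(1) by (simp add: L_def field_simps)
      then show ?case using nz by simp
    qed
  qed
  from has_laurent_expansion_residue[OF this] show ?thesis
    using fls_residue_compose[OF H0 H1, of G] by (simp only: fls_deriv_fps_to_fls)
qed

section \<open>The kernel function\<close>

text \<open>
  The derivative of order \<open>j + 1\<close> of \<open>c e^t / (1 - c e^t z)\<close> with respect to \<open>t\<close>. At \<open>t = 0\<close> this is \<open>psi\<close>; for
  \<open>z = 1\<close> and \<open>c = \<plusminus>1\<close> it is \<open>psi\<close>, times its variable, near a branch point. One function thus serves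
  both for the Taylor coefficients of the kernel and for the expansion of the result.
\<close>

definition kfun :: "complex \<Rightarrow> complex \<Rightarrow> nat \<Rightarrow> complex \<Rightarrow> complex" where
  "kfun c z j t = c * exp t * (1 / (1 - c * exp t * z))\<^sup>2 * poly (eul j) (1 / (1 - c * exp t * z))"

lemma psi_eq_kfun: "psi a j z = kfun (sg a) z j 0"
  by (simp add: psi_def kfun_def)

lemma poly_eul_Suc:
  "poly (eul (Suc j)) v = (2 * v - 1) * poly (eul j) v + (v\<^sup>2 - v) * poly (pderiv (eul j)) v"
  unfolding eul.simps pderiv_mult by (simp add: pderiv_pCons algebra_simps power2_eq_square)

lemma kfun_deriv:
  assumes "c * exp t * z \<noteq> 1"
  shows "(kfun c z j has_field_derivative kfun c z (Suc j) t) (at t)"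
proof -
  define V where "V t = 1 / (1 - c * exp t * z)" for t
  have v: "c * exp t * z * V t = V t - 1" using assms by (simp add: V_def field_simps)
  have dV: "(V has_field_derivative (V t)\<^sup>2 - V t) (at t)"
  proof -
    have "(V has_field_derivative (c * exp t * z) * V t * V t) (at t)"
      unfolding V_def [abs_def] using assms
      by (auto intro!: derivative_eq_intros simp: field_simps power2_eq_square)
    also have "(c * exp t * z) * V t * V t = (V t)\<^sup>2 - V t"
      by (simp only: v) (simp add: power2_eq_square algebra_simps)
    finally show ?thesis .
  qed
  have kfun: "kfun c z j t = c * exp t * (V t)\<^sup>2 * poly (eul j) (V t)" for j t
    by (simp add: kfun_def V_def)
  have "((\<lambda>t. c * exp t * (V t)\<^sup>2 * poly (eul j) (V t)) has_field_derivative
     (c * exp t * (V t)\<^sup>2 * poly (eul j) (V t) + c * exp t * (2 * V t * ((V t)\<^sup>2 - V t) * poly (eul j) (V t) +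
       (V t)\<^sup>2 * (poly (pderiv (eul j)) (V t) * ((V t)\<^sup>2 - V t))))) (at t)"
    using dV by (auto intro!: derivative_eq_intros DERIV_chain2[OF poly_DERIV] simp: algebra_simps)
  also have "(c * exp t * (V t)\<^sup>2 * poly (eul j) (V t) + c * exp t * (2 * V t * ((V t)\<^sup>2 - V t) * poly (eul j) (V t) +
       (V t)\<^sup>2 * (poly (pderiv (eul j)) (V t) * ((V t)\<^sup>2 - V t)))) = kfun c z (Suc j) t"
    unfolding kfun poly_eul_Suc by (simp add: algebra_simps power2_eq_square)
  finally show ?thesis unfolding kfun[abs_def] .
qed

lemma kfun_deriv_source:
  assumes "c * exp t * z \<noteq> 1"
  shows "((\<lambda>t. c * exp t / (1 - c * exp t * z)) has_field_derivative kfun c z 0 t) (at t)"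
  unfolding kfun_def using assms
  by (auto intro!: derivative_eq_intros simp: field_simps power2_eq_square)

section \<open>Local expansions of the basis functions\<close>

text \<open>
  Even with rational coefficients, a pole of order at most \<open>D\<close>, and \<open>r\<close> as coefficient of that order.
\<close>

definition evrat_fls :: "nat \<Rightarrow> rat \<Rightarrow> complex fls \<Rightarrow> bool" where
  "evrat_fls D r F \<longleftrightarrow> (\<forall>i. F $$ i \<in> \<rat> \<and> (odd i \<longrightarrow> F $$ i = 0) \<and> (i < - int D \<longrightarrow> F $$ i = 0)) \<and>
     F $$ (- int D) = of_rat r"

lemma evrat_fls_shift:
  assumes "evrat f" "fps_nth f 0 = of_rat r" "even D"
  shows "evrat_fls D r (fls_shift (int D) (fps_to_fls f))"
  using assms by (auto simp: evrat_fls_def evrat_def even_nat_iff)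

lemma evrat_fls_deriv2:
  assumes "evrat_fls D r F"
  shows "evrat_fls (D + 2) (of_nat (Suc D) * of_nat D * r) (fls_deriv (fls_deriv F))"
  unfolding evrat_fls_def
proof (intro conjI allI impI)
  fix i
  have eq: "fls_deriv (fls_deriv F) $$ i = of_int (i + 1) * (of_int (i + 2) * F $$ (i + 2))"
    by (simp add: add.assoc)
  show "fls_deriv (fls_deriv F) $$ i \<in> \<rat>"
    unfolding eq using assms by (intro Rats_mult) (auto simp: evrat_fls_def)
  show "fls_deriv (fls_deriv F) $$ i = 0" if "odd i"
    unfolding eq using assms that by (auto simp: evrat_fls_def)
  show "fls_deriv (fls_deriv F) $$ i = 0" if "i < - int (D + 2)"
    unfolding eq using assms that by (auto simp: evrat_fls_def)
next
  have "fls_deriv (fls_deriv F) $$ (- int (D + 2)) = of_int (- int (D + 2) + 1) * (of_int (- int (D + 2) + 2) * F $$ (- int D))"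
    by simp
  also have "\<dots> = of_rat (of_nat (Suc D) * of_nat D * r)"
    using assms by (simp add: evrat_fls_def of_rat_mult of_rat_add algebra_simps)
  finally show "fls_deriv (fls_deriv F) $$ (- int (D + 2)) = of_rat (of_nat (Suc D) * of_nat D * r)" .
qed

text \<open>
  Rational constants have degree \<open>0\<close>, so of all coefficients only that of \<open>t^(-D)\<close> has exact
  degree and needs a sign.
\<close>

lemma evrat_fls_lfam:
  assumes "evrat_fls D r F" "0 \<le> r"
  shows "lfam_even 0 (int D) (\<lambda>q zs. F)"
proof (rule lfam_evenI)
  fix i :: int
  obtain r' where r': "F $$ i = of_rat r'"
    using assms(1) unfolding evrat_fls_def by (metis Rats_cases)
  have "0 < int D + i \<or> int D + i = 0 \<and> 0 \<le> r' \<or> r' = 0"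
  proof (cases "i = - int D")
    case True
    then have "r' = r" using r' assms(1) by (simp add: evrat_fls_def)
    then show ?thesis using True assms(2) by simp
  next
    case False
    then have "0 < int D + i \<or> i < - int D" by linarith
    then show ?thesis using r' assms(1) by (auto simp: evrat_fls_def)
  qed
  then show "vspan 0 (int D + i) (\<lambda>q zs. F $$ i)"
    unfolding r' by (rule vspan_const)
qed (use assms in \<open>auto simp: evrat_fls_def\<close>)

lemma evrat_fls_leading:
  assumes "evrat_fls D r F" "0 < r"
  shows "vspan_pos 0 (int D + - int D) (\<lambda>q zs. F $$ (- int D))"
  using vspan_pos_const[OF assms(2)] assms(1) by (simp add: evrat_fls_def)

lemma lfam_even_const:
  assumes "vspan n d \<Phi>"
  shows "lfam_even n d (\<lambda>q zs. fls_const (\<Phi> q zs))"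
proof (rule lfam_evenI)
  fix i :: int
  show "vspan n (d + i) (\<lambda>q zs. fls_const (\<Phi> q zs) $$ i)"
    using assms by (cases "i = 0") auto
qed auto

lemma exp_ne_pm1:
  assumes "t \<in> ball 0 1 - {0 :: complex}"
  shows "exp t \<noteq> 1" "exp t \<noteq> - 1"
proof -
  have "exp (2 * t) \<noteq> 1"
  proof
    assume "exp (2 * t) = 1"
    then obtain n :: int where n: "Re (2 * t) = 0" "Im (2 * t) = of_int (2 * n) * pi"
      unfolding exp_eq_1 by blast
    have "n \<noteq> 0" using n assms by (auto simp: complex_eq_iff)
    then have "1 \<le> \<bar>real_of_int n\<bar>" by linarith
    have "pi * 1 \<le> pi * \<bar>real_of_int n\<bar>" using \<open>1 \<le> \<bar>real_of_int n\<bar>\<close> by (intro mult_left_mono) auto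
    also have "\<dots> = \<bar>Im t\<bar>" using n(2) by (simp add: abs_mult)
    also have "\<dots> \<le> norm t" by (rule abs_Im_le_cmod)
    finally show False using assms pi_gt3 by simp
  qed
  then show "exp t \<noteq> 1" "exp t \<noteq> - 1"
    by (auto simp: exp_double)
qed

lemma eventually_punctured: "eventually (\<lambda>t. t \<in> ball 0 1 - {0 :: complex}) (at 0)"
  by (rule eventually_at_in_open) auto

lemma sg_simps [simp]:
  "sg a * sg a = 1" "sg a * (sg a * x) = x" "sg a \<noteq> 0" "(sg a)\<^sup>2 = 1" "sg True = 1" "sg False = -1"
  "inverse (sg a) = sg a" "1 / sg a = sg a"
  by (auto simp: sg_def)

lemma sg_mult: "sg a * sg b = sg (a = b)"
  by (auto simp: sg_def)

lemma exp_minus_exp_fps: "(\<lambda>t. exp (c * t) - exp (- c * t)) has_fps_expansion fps_X * sinhc c" for c :: complex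
  unfolding sinhc_X[symmetric] by (intro fps_expansion_intros)

lemma inverse_sinh_square_laurent:
  assumes "c \<noteq> 0"
  shows "(\<lambda>t. 1 / (exp (c * t) - exp (- c * t))\<^sup>2) has_laurent_expansion
     fls_shift 2 (fps_to_fls ((inverse (sinhc c))\<^sup>2))"
proof -
  let ?S = "fps_to_fls (fps_X * sinhc c)"
  have "(\<lambda>t. inverse ((exp (c * t) - exp (- c * t))\<^sup>2)) has_laurent_expansion inverse (?S\<^sup>2)"
    by (intro laurent_expansion_intros has_laurent_expansion_fps exp_minus_exp_fps)
  moreover have "inverse (?S\<^sup>2) = fls_shift 2 (fps_to_fls ((inverse (sinhc c))\<^sup>2))"
  proof (rule inverse_unique)
    have "sinhc c * inverse (sinhc c) = 1"
      using assms by (simp add: inverse_mult_eq_1' sinhc_0)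
    then have "(sinhc c)\<^sup>2 * (inverse (sinhc c))\<^sup>2 = 1"
      by (simp flip: power_mult_distrib)
    then have "(fps_X * sinhc c)\<^sup>2 * (inverse (sinhc c))\<^sup>2 = fps_X\<^sup>2"
      by (simp add: power_mult_distrib mult.assoc)
    then have "fls_shift 2 (fps_to_fls ((fps_X * sinhc c)\<^sup>2 * (inverse (sinhc c))\<^sup>2)) = fls_shift 2 (fls_X\<^sup>2)"
      by (simp add: fps_to_fls_power)
    also have "\<dots> = 1" by (simp add: fls_X_power_conv_shift_1)
    finally show "?S\<^sup>2 * fls_shift 2 (fps_to_fls ((inverse (sinhc c))\<^sup>2)) = 1"
      by (simp add: fls_shifted_times_simps fls_times_fps_to_fls fps_to_fls_power)
  qed
  ultimately show ?thesis by (simp add: field_simps)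
qed

lemma inverse_cosh_square_laurent:
  "(\<lambda>t. - (1 / (exp (t / 2) + exp (- t / 2))\<^sup>2)) has_laurent_expansion
     fps_to_fls (- (inverse (coshs (1 / 2)))\<^sup>2)"
proof -
  have c: "(\<lambda>t. exp (1 / 2 * t) + exp (- (1 / 2) * t)) has_fps_expansion coshs (1 / 2)"
    unfolding coshs_def by (intro fps_expansion_intros)
  have "(\<lambda>t. - (inverse (exp (1 / 2 * t) + exp (- (1 / 2) * t)))\<^sup>2) has_fps_expansion - (inverse (coshs (1 / 2)))\<^sup>2"
    by (intro fps_expansion_intros c) (simp add: coshs_def)
  from has_laurent_expansion_fps[OF this] show ?thesis
    by (simp add: field_simps power_inverse)
qed

text \<open>
  Halving the argument makes the evenness visible: \<open>e^t / (1 - e^t)^2 = 1 / (2 sinh (t/2))^2\<close>.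
\<close>

lemma kfun_0_True: "kfun 1 1 0 t = 1 / (exp (1 / 2 * t) - exp (- (1 / 2) * t))\<^sup>2"
proof -
  define e where "e = exp (t / 2)"
  have e: "e \<noteq> 0" "exp t = e\<^sup>2" "exp (- (t / 2)) = inverse e"
    by (simp_all add: e_def exp_minus flip: exp_double)
  have "1 - e\<^sup>2 = - (e * (e - inverse e))" using e(1) by (simp add: field_simps power2_eq_square)
  then have "(1 - e\<^sup>2)\<^sup>2 = e\<^sup>2 * (e - inverse e)\<^sup>2" by (simp add: power_mult_distrib)
  then show ?thesis
    using e(1) unfolding kfun_def by (simp add: e power_divide flip: e_def)
qed

lemma kfun_0_False: "kfun (- 1) 1 0 t = - (1 / (exp (t / 2) + exp (- t / 2))\<^sup>2)"
proof -
  define e where "e = exp (t / 2)"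
  have e: "e \<noteq> 0" "exp t = e\<^sup>2" "exp (- (t / 2)) = inverse e"
    by (simp_all add: e_def exp_minus flip: exp_double)
  have "1 + e\<^sup>2 = e * (e + inverse e)" using e(1) by (simp add: field_simps power2_eq_square)
  then have "(1 + e\<^sup>2)\<^sup>2 = e\<^sup>2 * (e + inverse e)\<^sup>2" by (simp add: power_mult_distrib)
  then show ?thesis
    using e(1) unfolding kfun_def by (simp add: e power_divide flip: e_def)
qed

text \<open>
  The case \<open>k = 0\<close> is explicit, and two differentiations raise \<open>k\<close> by one, preserve evenness and multiply
  the leading coefficient by a positive number. At the other branch point (\<open>c = False\<close>) the function
  is regular, which is recorded by the leading coefficient \<open>0\<close>.
\<close>

lemma kfun_laurent:
  "\<exists>F r. evrat_fls (2 * k + 2) r F \<and> 0 \<le> r \<and> (c \<longrightarrow> 0 < r) \<and>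
     (\<forall>s\<in>{1, -1}. (\<lambda>t. kfun (sg c) 1 (2 * k) (s * t)) has_laurent_expansion F)"
proof (induction k)
  case 0
  show ?case
  proof (cases c)
    case True
    let ?f = "(inverse (sinhc (1 / 2)))\<^sup>2"
    have f: "evrat ?f" by (intro evrat_power evrat_inverse evrat_sinhc) simp
    have f0: "fps_nth ?f 0 = of_rat 1" by (simp add: sinhc_0 fps_nth_power_0)
    have "(\<lambda>t. kfun 1 1 0 (s * t)) has_laurent_expansion fls_shift 2 (fps_to_fls ?f)" if "s \<in> {1, -1}" for s
    proof -
      have "kfun 1 1 0 (s * t) = 1 / (exp (1 / 2 * t) - exp (- (1 / 2) * t))\<^sup>2" for t
        using that by (auto simp: kfun_0_True power2_commute)
      then show ?thesis using inverse_sinh_square_laurent[of "1 / 2"] by simp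
    qed
    then show ?thesis using evrat_fls_shift[OF f f0, of 2] True
      by (intro exI[of _ "fls_shift 2 (fps_to_fls ?f)"] exI[of _ 1]) (auto simp del: add_2_eq_Suc add_2_eq_Suc')
  next
    case False
    let ?f = "- (inverse (coshs (1 / 2)))\<^sup>2"
    have f: "evrat ?f"
      using evrat_power[OF evrat_inverse[OF evrat_coshs[of "1 / 2"]], of 2] by (auto simp: evrat_def)
    have f': "evrat_fls 2 0 (fps_to_fls ?f)"
      using f by (auto simp: evrat_fls_def evrat_def even_nat_iff)
    have "(\<lambda>t. kfun (- 1) 1 0 (s * t)) has_laurent_expansion fps_to_fls ?f" if "s \<in> {1, -1}" for s
    proof -
      have "kfun (- 1) 1 0 (s * t) = - (1 / (exp (t / 2) + exp (- t / 2))\<^sup>2)" for t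
        using that by (auto simp: kfun_0_False add.commute)
      then show ?thesis using inverse_cosh_square_laurent by simp
    qed
    then show ?thesis using f' False
      by (intro exI[of _ "fps_to_fls ?f"] exI[of _ 0]) (auto simp del: add_2_eq_Suc add_2_eq_Suc')
  qed
next
  case (Suc k)
  then obtain F r where F: "evrat_fls (2 * k + 2) r F" "0 \<le> r" "c \<longrightarrow> 0 < r"
    "\<And>s. s \<in> {1, -1} \<Longrightarrow> (\<lambda>t. kfun (sg c) 1 (2 * k) (s * t)) has_laurent_expansion F" by blast
  have "(\<lambda>t. kfun (sg c) 1 (2 * Suc k) (s * t)) has_laurent_expansion fls_deriv (fls_deriv F)"
    if s: "s \<in> {1, -1}" for s
  proof -
    have ne: "sg c * exp (s * t) * 1 \<noteq> 1" if "t \<in> ball 0 1 - {0}" for t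
    proof -
      have "s * t \<in> ball 0 1 - {0}" using that s by auto
      from exp_ne_pm1[OF this] show ?thesis by (cases c) (auto simp: minus_equation_iff)
    qed
    have d: "((\<lambda>t. kfun (sg c) 1 j (s * t)) has_field_derivative s * kfun (sg c) 1 (Suc j) (s * t)) (at t)"
      if "t \<in> ball 0 1 - {0}" for t j
      by (rule DERIV_chain2[of "kfun (sg c) 1 j" _ "\<lambda>t. s * t" t s, THEN DERIV_cong])
         (use kfun_deriv[OF ne[OF that]] in \<open>auto intro!: derivative_eq_intros\<close>)
    have "(\<lambda>t. s * kfun (sg c) 1 (Suc (2 * k)) (s * t)) has_laurent_expansion fls_deriv F"
      by (rule has_laurent_expansion_deriv'[OF F(4)[OF s], of "ball 0 1"]) (use d in auto)
    then have "(\<lambda>t. s * (s * kfun (sg c) 1 (Suc (Suc (2 * k))) (s * t))) has_laurent_expansion fls_deriv (fls_deriv F)"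
      by (rule has_laurent_expansion_deriv'[of _ _ "ball 0 1"])
         (use d in \<open>auto intro!: DERIV_cmult\<close>)
    then show ?thesis using s by auto
  qed
  moreover have "evrat_fls (2 * Suc k + 2) (of_nat (Suc (2 * k + 2)) * of_nat (2 * k + 2) * r) (fls_deriv (fls_deriv F))"
    using evrat_fls_deriv2[OF F(1)] by simp
  ultimately show ?case using F(2,3)
    by (intro exI[of _ "fls_deriv (fls_deriv F)"] exI[of _ "of_nat (Suc (2 * k + 2)) * of_nat (2 * k + 2) * r"])
       (auto intro!: mult_nonneg_nonneg mult_pos_pos simp del: of_nat_Suc of_nat_add of_nat_mult)
qed

lemma psi_local: "(sg a * exp t) * psi b j (sg a * exp t) = kfun (sg (a = b)) 1 j t"
  unfolding psi_def kfun_def sg_mult[symmetric] by (simp add: algebra_simps)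

section \<open>Taylor coefficients of the kernel\<close>

text \<open>
  Since successive derivatives of \<open>kfun\<close> only shift its index, all Taylor coefficients are known at once.
\<close>

lemma kfun_fps:
  assumes "c * z \<noteq> 1"
  obtains E where "kfun c z j has_fps_expansion E" "\<And>n. fps_nth E n = kfun c z (j + n) 0 / fact n"
proof -
  have ana: "kfun c z j analytic_on {0}" for j
    unfolding kfun_def[abs_def] poly_altdef using assms by (intro analytic_intros) auto
  have ev: "eventually (\<lambda>t. c * exp t * z \<noteq> 1) (nhds 0)"
  proof -
    have "isCont (\<lambda>t. c * exp t * z) 0" by (intro continuous_intros)
    then have "((\<lambda>t. c * exp t * z) \<longlongrightarrow> c * z) (nhds 0)"
      by (simp add: isCont_def tendsto_nhds_iff)
    from this assms show ?thesis by (rule tendsto_imp_eventually_ne)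
  qed
  have coeff: "fps_nth E n = kfun c z (j + n) 0 / fact n" if "kfun c z j has_fps_expansion E" for E j n
    using that
  proof (induction n arbitrary: j E)
    case 0
    then show ?case using has_fps_expansion_imp_0_eq_fps_nth_0[OF 0] by simp
  next
    case (Suc n)
    have "deriv (kfun c z j) has_fps_expansion fps_deriv E"
      by (intro fps_expansion_intros Suc.prems)
    moreover have "eventually (\<lambda>t. deriv (kfun c z j) t = kfun c z (Suc j) t) (nhds 0)"
      using ev by eventually_elim (intro DERIV_imp_deriv kfun_deriv)
    ultimately have "kfun c z (Suc j) has_fps_expansion fps_deriv E"
      using has_fps_expansion_cong by blast
    from Suc.IH[OF this] show ?case
      by (simp add: field_simps del: of_nat_Suc)
  qed
  show ?thesis
    using that analytic_at_imp_has_fps_expansion_0[OF ana] coeff by blast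
qed

section \<open>The infinite product\<close>

text \<open>
  The factors of the infinite product are \<open>1 - xcoef q k (z - 1/z)^2\<close>, and the power sums of the \<open>xcoef q k\<close>
  are the \<open>q\<close>-zeta values.
\<close>

definition xcoef :: "real \<Rightarrow> nat \<Rightarrow> real" where
  "xcoef q k = q ^ Suc k / (1 - q ^ Suc k)\<^sup>2"

text \<open>
  The logarithm of the reciprocal of the product; its constant coefficient is \<open>0\<close> because division by zero
  yields zero.
\<close>

definition log_series :: "real \<Rightarrow> complex fps" where
  "log_series q = Abs_fps (\<lambda>n. of_real (qzeta q (2 * n)) / of_nat n)"

text \<open>
  The generating function of the complete homogeneous symmetric functions of the \<open>xcoef q k\<close>.
\<close>

definition hseries :: "real \<Rightarrow> complex fps" where
  "hseries q = fps_compose (fps_exp 1) (log_series q)"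

lemma log_series_0 [simp]: "fps_nth (log_series q) 0 = 0"
  by (simp add: log_series_def)

lemma hseries_0 [simp]: "fps_nth (hseries q) 0 = 1"
  by (simp add: hseries_def)

text \<open>
  Newton's identities, read off from the differential equation \<open>H' = H \<cdot> L'\<close> of \<open>H = exp L\<close>.
\<close>

lemma hseries_Suc:
  "fps_nth (hseries q) (Suc n) =
     (\<Sum>i\<in>{0..n}. of_rat (1 / of_nat (Suc n)) * (of_real (qzeta q (2 * (Suc n - i))) * fps_nth (hseries q) i))"
proof -
  have "fps_deriv (hseries q) = hseries q * fps_deriv (log_series q)"
    unfolding hseries_def by (simp add: fps_compose_deriv)
  then have "fps_nth (fps_deriv (hseries q)) n = (\<Sum>i\<in>{0..n}. fps_nth (hseries q) i * fps_nth (fps_deriv (log_series q)) (n - i))"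
    by (simp add: fps_mult_nth)
  also have "\<dots> = (\<Sum>i\<in>{0..n}. of_real (qzeta q (2 * (Suc n - i))) * fps_nth (hseries q) i)"
  proof (rule sum.cong[OF refl])
    fix i assume "i \<in> {0..n}"
    then have "Suc n - i = Suc (n - i)" by auto
    then show "fps_nth (hseries q) i * fps_nth (fps_deriv (log_series q)) (n - i) =
        of_real (qzeta q (2 * (Suc n - i))) * fps_nth (hseries q) i"
      by (simp add: log_series_def del: of_nat_Suc)
  qed
  finally have "of_nat (Suc n) * fps_nth (hseries q) (Suc n) = (\<Sum>i\<in>{0..n}. of_real (qzeta q (2 * (Suc n - i))) * fps_nth (hseries q) i)"
    by (simp del: of_nat_Suc)
  then have "fps_nth (hseries q) (Suc n) = 1 / of_nat (Suc n) * (\<Sum>i\<in>{0..n}. of_real (qzeta q (2 * (Suc n - i))) * fps_nth (hseries q) i)"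
    by (simp add: field_simps del: of_nat_Suc)
  then show ?thesis by (simp add: sum_distrib_left of_rat_divide del: of_nat_Suc)
qed

lemma vspan_qzeta:
  assumes "k \<ge> 1"
  shows "vspan 0 (2 * int k) (\<lambda>q zs. of_real (qzeta q (2 * k)))"
proof -
  have "vspan 0 (2 * int k) (\<lambda>q zs. term_value q zs (1, Poly_Mapping.single (Z k) 1, []))"
    by (rule vspan_term) (use assms in \<open>auto simp: monomial_degree_def\<close>)
  then show ?thesis
    by (rule vspan_cong) (auto simp: monomial_value_def adm_def psi_prod_def)
qed

lemma vspan_hseries: "vspan 0 (2 * int n) (\<lambda>q zs. fps_nth (hseries q) n)"
proof (induction n rule: less_induct)
  case (less n)
  show ?case
  proof (cases n)
    case 0
    then show ?thesis using vspan_const[of 0 1] by simp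
  next
    case (Suc m)
    show ?thesis
      unfolding Suc hseries_Suc
    proof (rule vspan_sum)
      fix i assume i: "i \<in> {0..m}"
      have "vspan 0 (2 * int (Suc m - i)) (\<lambda>q zs. complex_of_real (qzeta q (2 * (Suc m - i))))"
        by (rule vspan_qzeta) (use i in auto)
      moreover have "vspan 0 (2 * int i) (\<lambda>q zs. fps_nth (hseries q) i)"
        by (rule less) (use i Suc in auto)
      ultimately have "vspan 0 (2 * int (Suc m - i) + 2 * int i)
          (\<lambda>q zs. complex_of_real (qzeta q (2 * (Suc m - i))) * fps_nth (hseries q) i)"
        by (rule vspan_mult_const)
      then have "vspan 0 (2 * int (Suc m))
          (\<lambda>q zs. complex_of_real (qzeta q (2 * (Suc m - i))) * fps_nth (hseries q) i)"
        using i by (simp add: of_nat_diff algebra_simps)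
      from vspan_mult_const[OF vspan_const[of 0 "1 / of_nat (Suc m)"] this]
      show "vspan 0 (2 * int (Suc m)) (\<lambda>q zs. of_rat (1 / of_nat (Suc m)) *
          (complex_of_real (qzeta q (2 * (Suc m - i))) * fps_nth (hseries q) i))"
        by simp
    qed
  qed
qed

definition theta_fls :: "real \<Rightarrow> complex fls" where
  "theta_fls q = fps_to_fls (fps_compose (hseries q) ((fps_X * sinhc 1)\<^sup>2))"

text \<open>
  Each power of \<open>(e^t - e^(-t))^2\<close> lowers the degree by two, as \<open>t^2\<close> does, and each index of \<open>hseries\<close> raises it
  by two. Only the leading coefficient \<open>2^(2k)\<close> of \<open>(e^t - e^(-t))^(2k)\<close> enters in exact degree.
\<close>

lemma lfam_theta: "lfam_even 0 0 (\<lambda>q zs. theta_fls q)"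
proof -
  have S: "evrat ((sinhc 1) ^ k)" for k by (intro evrat_power evrat_sinhc) simp
  have nth: "fps_nth (((fps_X * sinhc 1)\<^sup>2) ^ i) n = (if n < 2 * i then 0 else fps_nth (sinhc 1 ^ (2 * i)) (n - 2 * i))" for i n
    by (simp add: power_mult_distrib fps_X_power_mult_nth flip: power_mult)
  have "vspan 0 (0 + i) (\<lambda>q zs. theta_fls q $$ i)" if "even i" for i
  proof (cases "i < 0")
    case False
    define n where "n = nat i"
    have "vspan 0 (int n) (\<lambda>q zs. \<Sum>k\<in>{0..n}. fps_nth (hseries q) k * fps_nth (((fps_X * sinhc 1)\<^sup>2) ^ k) n)"
    proof (rule vspan_sum)
      fix k assume "k \<in> {0..n}"
      show "vspan 0 (int n) (\<lambda>q zs. fps_nth (hseries q) k * fps_nth (((fps_X * sinhc 1)\<^sup>2) ^ k) n)"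
      proof (cases "n < 2 * k")
        case True
        then show ?thesis by (simp add: nth)
      next
        case False
        obtain r where r: "fps_nth (sinhc 1 ^ (2 * k)) (n - 2 * k) = of_rat r"
          using S[of "2 * k"] unfolding evrat_def by (metis Rats_cases)
        have "0 < int n - 2 * int k \<or> int n - 2 * int k = 0 \<and> 0 \<le> r \<or> r = 0"
        proof (cases "n = 2 * k")
          case True
          have "of_rat r = (2 :: complex) ^ (2 * k)" using r True by (simp add: fps_nth_power_0 sinhc_0)
          also have "\<dots> = of_rat (2 ^ (2 * k))" by (simp add: of_rat_power)
          finally have "r = 2 ^ (2 * k)" by (simp only: of_rat_eq_iff)
          then show ?thesis using True by simp
        qed (use False in auto)
        from vspan_mult_const[OF vspan_hseries[of k] vspan_const[OF this]] show ?thesis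
          using False by (simp add: nth r)
      qed
    qed
    then show ?thesis using False by (simp add: theta_fls_def fps_compose_nth n_def)
  qed (simp add: theta_fls_def)
  moreover have "theta_fls q $$ i = 0" if "odd i" for q i
  proof (cases "i < 0")
    case False
    have "odd (nat i)" using that False by (simp add: even_nat_iff)
    then have "fps_nth (((fps_X * sinhc 1)\<^sup>2) ^ k) (nat i) = 0" for k
      using S[of "2 * k"] unfolding nth evrat_def by auto
    then show ?thesis using False by (simp add: theta_fls_def fps_compose_nth)
  qed (simp add: theta_fls_def)
  ultimately show ?thesis by (intro lfam_evenI) auto
qed

definition kernel_fls :: "real \<Rightarrow> complex fls" where
  "kernel_fls q = fls_shift 2 (fps_to_fls ((inverse (sinhc 1))\<^sup>2)) * theta_fls q"

lemma evrat_fls_inverse_sinh_square: "evrat_fls 2 (1 / 4) (fls_shift 2 (fps_to_fls ((inverse (sinhc 1))\<^sup>2)))"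
proof -
  have "evrat ((inverse (sinhc 1))\<^sup>2)" by (intro evrat_power evrat_inverse evrat_sinhc) simp
  moreover have "fps_nth ((inverse (sinhc 1))\<^sup>2) 0 = of_rat (1 / 4)"
    by (simp add: fps_nth_power_0 sinhc_0 of_rat_divide power2_eq_square)
  ultimately show ?thesis using evrat_fls_shift[of _ "1 / 4" 2] by simp
qed

lemma lfam_inverse_sinh_square:
  "lfam_even 0 2 (\<lambda>q zs. fls_shift 2 (fps_to_fls ((inverse (sinhc 1))\<^sup>2)))"
  using evrat_fls_lfam[OF evrat_fls_inverse_sinh_square] by simp

lemma inverse_sinh_square_leading:
  "vspan_pos 0 (2 + - 2) (\<lambda>q zs. fls_shift 2 (fps_to_fls ((inverse (sinhc 1))\<^sup>2)) $$ (- 2))"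
  using evrat_fls_leading[OF evrat_fls_inverse_sinh_square] by simp

lemma lfam_kernel: "lfam_even 0 2 (\<lambda>q zs. kernel_fls q)"
  using lfam_even_mult_const[OF lfam_inverse_sinh_square lfam_theta] by (simp add: kernel_fls_def)

lemma kernel_leading: "vspan_pos 0 (2 + - 2) (\<lambda>q zs. kernel_fls q $$ (- 2))"
proof -
  have "theta_fls q $$ 0 = 1" for q by (simp add: theta_fls_def)
  then have *: "vspan_pos 0 (0 + 0) (\<lambda>q zs. theta_fls q $$ 0)"
    using vspan_pos_const[of 1] by simp
  have "lfam 0 0 (\<lambda>q zs. theta_fls q)" using lfam_theta by (simp add: lfam_even_def)
  from lfam_mult_const_leading[OF lfam_inverse_sinh_square this _ _ _ _ inverse_sinh_square_leading *]
  have "vspan_pos 0 (2 + 0 + (- 2 + 0)) (\<lambda>q zs. (fls_shift 2 (fps_to_fls ((inverse (sinhc 1))\<^sup>2)) * theta_fls q) $$ (- 2 + 0))"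
    by auto
  then show ?thesis by (simp only: kernel_fls_def) simp
qed

lemma xcoef_bounds:
  assumes "0 < q" "q < 1"
  shows "0 < xcoef q k" "xcoef q k \<le> q ^ Suc k / (1 - q)\<^sup>2" "summable (xcoef q)"
proof -
  have *: "0 < xcoef q k \<and> xcoef q k \<le> q ^ Suc k / (1 - q)\<^sup>2" for k
  proof -
    have "q ^ Suc k \<le> q" using power_decreasing[of 1 "Suc k" q] assms by simp
    then have "(1 - q)\<^sup>2 \<le> (1 - q ^ Suc k)\<^sup>2" using assms by (intro power_mono) auto
    moreover have "0 < q ^ Suc k" using assms by simp
    moreover have "0 < (1 - q)\<^sup>2" using assms by simp
    ultimately show ?thesis unfolding xcoef_def
      by (auto intro!: divide_pos_pos divide_left_mono mult_pos_pos simp del: power_Suc)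
  qed
  then show "0 < xcoef q k" "xcoef q k \<le> q ^ Suc k / (1 - q)\<^sup>2" by auto
  have "summable (\<lambda>k. q ^ Suc k / (1 - q)\<^sup>2)"
    using assms by (intro summable_divide) (simp add: summable_geometric summable_mult)
  then show "summable (xcoef q)"
    by (rule summable_comparison_test_ev[rotated]) (use * in \<open>auto simp: abs_of_pos\<close>)
qed

lemma qzeta_eq:
  assumes "0 < q" "q < 1"
  shows "qzeta q (2 * s) = suminf (\<lambda>k. xcoef q k ^ s)"
proof -
  have "q powr (real (Suc m) * real (2 * s) / 2) / (1 - q ^ Suc m) ^ (2 * s) = xcoef q m ^ s" for m
  proof -
    have "real (Suc m) * real (2 * s) / 2 = real (Suc m * s)" by (simp add: field_simps)
    then have "q powr (real (Suc m) * real (2 * s) / 2) = q powr real (Suc m * s)" by (simp only:)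
    also have "\<dots> = (q ^ Suc m) ^ s" using assms by (simp only: powr_realpow power_mult)
    finally show ?thesis unfolding xcoef_def by (simp add: power_divide power_mult)
  qed
  then show ?thesis unfolding qzeta_def by presburger
qed

text \<open>
  Take logarithms of the factors, expand them, and sum first over the factors. The double series
  converges absolutely for \<open>|w| < 1 / \<Sum>\<^sub>k xcoef q k\<close>, because every \<open>xcoef q k\<close> is bounded by their sum.
\<close>

lemma theta_expansion:
  assumes q: "0 < q" "q < 1"
  shows "(\<lambda>w. 1 / prodinf (\<lambda>k. 1 - of_real (xcoef q k) * w)) has_fps_expansion hseries q"
proof -
  define X where "X = suminf (xcoef q)"
  note x = xcoef_bounds[OF q]
  have xX: "xcoef q k \<le> X" for k
    unfolding X_def using sum_le_suminf[OF x(3), of "{k}"] x(1) by (auto simp: less_imp_le)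
  have X0: "0 < X" using x(1)[of 0] xX[of 0] by linarith
  have main: "(\<lambda>s. fps_nth (log_series q) s * w ^ s) sums suminf (\<lambda>k. - Ln (1 - of_real (xcoef q k) * w)) \<and>
      summable (\<lambda>k. - Ln (1 - of_real (xcoef q k) * w)) \<and> (\<forall>k. 1 - of_real (xcoef q k) * w \<noteq> 0)"
    if w: "norm w < 1 / X" for w :: complex
  proof -
    define r where "r = X * norm w"
    have r: "0 \<le> r" "r < 1" using w X0 by (auto simp: r_def field_simps)
    define u where "u k = of_real (xcoef q k) * w" for k
    have ur: "norm (u k) \<le> r" for k
      unfolding u_def r_def using xX[of k] x(1)[of k] by (auto simp: norm_mult intro!: mult_right_mono)
    define f where "f k s = u k ^ Suc s / of_nat (Suc s)" for k s
    have nf: "norm (f k s) \<le> norm (u k) * r ^ s" for k s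
    proof -
      have "norm (f k s) = norm (u k) ^ Suc s / real (Suc s)"
        by (simp add: f_def norm_divide norm_mult norm_power del: of_nat_Suc)
      also have "\<dots> \<le> norm (u k) ^ Suc s / 1" by (intro divide_left_mono) auto
      also have "\<dots> \<le> norm (u k) * r ^ s"
        using power_mono[OF ur[of k], of s] by (simp add: mult_left_mono)
      finally show ?thesis .
    qed
    have su: "summable (\<lambda>k. norm (u k))"
      unfolding u_def using x(1) x(3) by (simp add: norm_mult summable_mult2 abs_of_pos)
    have suminf_r: "((\<lambda>s. norm (u k) * r ^ s) has_sum norm (u k) * (1 / (1 - r))) UNIV" for k
      using geometric_sums[of r] r by (intro has_sum_cmult_right norm_summable_imp_has_sum) (auto simp: summable_geometric)
    have "(\<lambda>(k, s). norm (u k) * r ^ s) summable_on (UNIV \<times> UNIV)"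
    proof (rule summable_on_SigmaI)
      show "((\<lambda>s. case (k, s) of (k, s) \<Rightarrow> norm (u k) * r ^ s) has_sum norm (u k) * (1 / (1 - r))) UNIV" for k
        using suminf_r by simp
      show "(\<lambda>k. norm (u k) * (1 / (1 - r))) summable_on UNIV"
        using su r by (intro norm_summable_imp_summable_on) (auto intro!: summable_divide simp: abs_mult)
    qed (use r in auto)
    then have "(\<lambda>x. norm (case x of (k, s) \<Rightarrow> f k s)) summable_on (UNIV \<times> UNIV)"
      by (rule summable_on_comparison_test) (use nf in auto)
    then have sum2: "(\<lambda>(k, s). f k s) summable_on (UNIV \<times> UNIV)"
      by (rule abs_summable_summable)
    have inner1: "((\<lambda>s. f k s) has_sum - Ln (1 - u k)) UNIV" for k
    proof (rule norm_summable_imp_has_sum)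
      show "summable (\<lambda>s. norm (f k s))"
        by (rule summable_comparison_test'[of "\<lambda>s. norm (u k) * r ^ s" 0])
           (use r nf in \<open>auto intro!: summable_mult summable_geometric\<close>)
      have "norm (- u k) < 1" using ur[of k] r by simp
      from Ln_series'[OF this] have "(\<lambda>n. - (u k ^ n) / of_nat n) sums Ln (1 - u k)" by simp
      from sums_minus[OF this] have "(\<lambda>n. u k ^ n / of_nat n) sums (- Ln (1 - u k))" by simp
      then show "(\<lambda>s. f k s) sums (- Ln (1 - u k))"
        unfolding f_def by (subst sums_Suc_iff) simp
    qed
    have inner2: "((\<lambda>k. f k s) has_sum (of_real (qzeta q (2 * Suc s)) / of_nat (Suc s) * w ^ Suc s)) UNIV" for s
    proof (rule norm_summable_imp_has_sum)
      have sx: "summable (\<lambda>k. xcoef q k ^ Suc s)"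
      proof (rule summable_comparison_test'[of "\<lambda>k. xcoef q k * X ^ s" 0])
        show "summable (\<lambda>k. xcoef q k * X ^ s)" by (intro summable_mult2 x)
        show "norm (xcoef q k ^ Suc s) \<le> xcoef q k * X ^ s" for k
          using power_mono[OF xX[of k], of s] x(1)[of k] by (simp add: abs_mult)
      qed
      show "summable (\<lambda>k. norm (f k s))"
        by (rule summable_comparison_test'[of "\<lambda>k. norm (u k) * r ^ s" 0])
           (use nf su in \<open>auto intro!: summable_mult2\<close>)
      have "(\<lambda>k. xcoef q k ^ Suc s) sums qzeta q (2 * Suc s)"
        unfolding qzeta_eq[OF q] by (rule summable_sums[OF sx])
      then have "(\<lambda>k. complex_of_real (xcoef q k ^ Suc s)) sums of_real (qzeta q (2 * Suc s))"
        by (simp only: sums_of_real_iff)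
      from sums_mult2[OF this, of "w ^ Suc s / of_nat (Suc s)"]
      show "(\<lambda>k. f k s) sums (of_real (qzeta q (2 * Suc s)) / of_nat (Suc s) * w ^ Suc s)"
        unfolding f_def u_def by (simp add: power_mult_distrib del: of_nat_Suc power_Suc mult_Suc_right)
    qed
    have ne: "1 - u k \<noteq> 0" for k
      using ur[of k] r by (metis eq_iff_diff_eq_0 leD norm_one)
    have o1: "((\<lambda>k. - Ln (1 - u k)) has_sum infsum (\<lambda>(k, s). f k s) (UNIV \<times> UNIV)) UNIV"
      by (rule has_sum_SigmaD[OF has_sum_infsum[OF sum2]]) (use inner1 in simp)
    have sum2': "(\<lambda>(s, k). f k s) summable_on (UNIV \<times> UNIV)"
      using sum2 by (subst summable_on_swap) (simp add: case_prod_unfold)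
    have "infsum (\<lambda>(s, k). f k s) (UNIV \<times> UNIV) = infsum (\<lambda>(k, s). f k s) (UNIV \<times> UNIV)"
      by (rule infsum_reindex_bij_witness[of _ prod.swap prod.swap]) auto
    then have o2: "((\<lambda>s. of_real (qzeta q (2 * Suc s)) / of_nat (Suc s) * w ^ Suc s) has_sum
        infsum (\<lambda>(k, s). f k s) (UNIV \<times> UNIV)) UNIV"
      using has_sum_SigmaD[OF has_sum_infsum[OF sum2'], of "\<lambda>s. of_real (qzeta q (2 * Suc s)) / of_nat (Suc s) * w ^ Suc s"]
        inner2 by simp
    have s1: "(\<lambda>k. - Ln (1 - u k)) sums infsum (\<lambda>(k, s). f k s) (UNIV \<times> UNIV)"
      using o1 by (rule has_sum_imp_sums)
    have "(\<lambda>s. fps_nth (log_series q) (Suc s) * w ^ Suc s) sums infsum (\<lambda>(k, s). f k s) (UNIV \<times> UNIV)"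
      using has_sum_imp_sums[OF o2] by (simp add: log_series_def del: of_nat_Suc power_Suc mult_Suc_right)
    then have "(\<lambda>s. fps_nth (log_series q) s * w ^ s) sums infsum (\<lambda>(k, s). f k s) (UNIV \<times> UNIV)"
      by (subst (asm) sums_Suc_iff) simp
    then show ?thesis using s1 ne unfolding u_def by (auto simp: sums_iff)
  qed
  define L where "L w = suminf (\<lambda>k. - Ln (1 - of_real (xcoef q k) * w))" for w
  have ev: "eventually (\<lambda>w::complex. norm w < 1 / X) (nhds 0)"
    using eventually_nhds_in_open[of "ball (0::complex) (1 / X)" 0] X0 by (simp add: dist_norm)
  have "L has_fps_expansion log_series q"
    by (rule has_fps_expansionI, rule eventually_mono[OF ev]) (use main in \<open>auto simp: L_def\<close>)
  then have "(exp \<circ> L) has_fps_expansion hseries q"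
    unfolding hseries_def by (intro fps_expansion_intros) auto
  moreover have "eventually (\<lambda>w. (exp \<circ> L) w = 1 / prodinf (\<lambda>k. 1 - of_real (xcoef q k) * w)) (nhds 0)"
    using ev
  proof eventually_elim
    case (elim w)
    let ?g = "\<lambda>k. Ln (1 - of_real (xcoef q k) * w)"
    have sm: "summable ?g" using main[OF elim] by (simp add: summable_minus_iff)
    have "prodinf (\<lambda>k. 1 - of_real (xcoef q k) * w) = prodinf (\<lambda>k. exp (?g k))"
      using main[OF elim] by simp
    also have "\<dots> = exp (suminf ?g)" by (rule prodinf_exp[OF sm])
    also have "suminf ?g = - L w" unfolding L_def using suminf_minus[OF sm] by simp
    finally have "prodinf (\<lambda>k. 1 - of_real (xcoef q k) * w) = inverse (exp (L w))"
      by (simp add: exp_minus)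
    then show ?case by (simp only: o_def) (simp add: divide_inverse)
  qed
  ultimately show ?thesis by (subst (asm) has_fps_expansion_cong[OF _ refl])
qed

section \<open>Positivity in top degree\<close>

text \<open>
  Some even coefficient of index at most \<open>0\<close> is positive in exact degree. The bound on the index is
  what survives multiplication; with the double pole of the kernel the index becomes at most \<open>-2\<close>, where it
  is seen by the residue.
\<close>

definition lfam_lead :: "nat \<Rightarrow> int \<Rightarrow> (real \<Rightarrow> complex list \<Rightarrow> complex fls) \<Rightarrow> bool" where
  "lfam_lead n d G \<longleftrightarrow>
     (\<exists>i. even i \<and> - d \<le> i \<and> i \<le> 0 \<and> vspan_pos n (d + i) (\<lambda>q zs. G q zs $$ i))"

lemma lfam_lead_add:
  assumes "lfam_lead n d F" "lfam n d G"
  shows "lfam_lead n d (\<lambda>q zs. F q zs + G q zs)"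
proof -
  obtain i where i: "even i" "- d \<le> i" "i \<le> 0" "vspan_pos n (d + i) (\<lambda>q zs. F q zs $$ i)"
    using assms(1) unfolding lfam_lead_def by blast
  have "vspan n (d + i) (\<lambda>q zs. G q zs $$ i)" using assms(2) i(1) by (simp add: lfam_def)
  from vspan_pos_add[OF i(4) this] show ?thesis
    unfolding lfam_lead_def using i by (intro exI[of _ i]) simp
qed

lemma lfam_lead_sum:
  assumes "finite A" "x \<in> A" "lfam_lead n d (G x)" "\<And>y. y \<in> A \<Longrightarrow> lfam n d (G y)"
  shows "lfam_lead n d (\<lambda>q zs. \<Sum>y\<in>A. G y q zs)"
proof -
  have "(\<lambda>q zs. \<Sum>y\<in>A. G y q zs) = (\<lambda>q zs. G x q zs + (\<Sum>y\<in>A - {x}. G y q zs))"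
    using assms(1,2) by (simp add: sum.remove)
  then show ?thesis
    using lfam_lead_add[OF assms(3) lfam_sum[of "A - {x}" n d G]] assms(4) by simp
qed

lemma lfam_lead_mult:
  assumes n1: "\<And>zs :: complex list. length zs = n \<Longrightarrow> length (nths zs I) = n1"
    and n2: "\<And>zs :: complex list. length zs = n \<Longrightarrow> length (nths zs (- I)) = n2"
    and "lfam n1 d1 F" "lfam_even n2 d2 G" "lfam_lead n1 d1 F" "lfam_lead n2 d2 G"
  shows "lfam_lead n (d1 + d2) (\<lambda>q zs. F q (nths zs I) * G q (nths zs (- I)))"
proof -
  obtain i where i: "even i" "- d1 \<le> i" "i \<le> 0" "vspan_pos n1 (d1 + i) (\<lambda>q zs. F q zs $$ i)"
    using assms(5) unfolding lfam_lead_def by blast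
  obtain j where j: "even j" "- d2 \<le> j" "j \<le> 0" "vspan_pos n2 (d2 + j) (\<lambda>q zs. G q zs $$ j)"
    using assms(6) unfolding lfam_lead_def by blast
  show ?thesis
    using lfam_mult_leading[OF n1 n2 assms(3,4) i(1) j(1) i(2) j(2) i(4) j(4)] i j
    unfolding lfam_lead_def by (intro exI[of _ "i + j"]) auto
qed

lemma lfam_lead_mult_const:
  assumes "lfam_even 0 d1 F" "lfam n d2 G" "vspan_pos 0 (d1 + i) (\<lambda>q zs. F q zs $$ i)"
    "even i" "- d1 \<le> i" "i \<le> 0" "lfam_lead n d2 G"
  shows "\<exists>j. even j \<and> - (d1 + d2) \<le> j \<and> j \<le> i \<and>
     vspan_pos n (d1 + d2 + j) (\<lambda>q zs. (F q [] * G q zs) $$ j)"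
proof -
  obtain j where j: "even j" "- d2 \<le> j" "j \<le> 0" "vspan_pos n (d2 + j) (\<lambda>q zs. G q zs $$ j)"
    using assms(7) unfolding lfam_lead_def by blast
  show ?thesis
    using lfam_mult_const_leading[OF assms(1,2,4) j(1) assms(5) j(2) assms(3) j(4)] j assms
    by (intro exI[of _ "i + j"]) auto
qed

lemma lfam_lead_const:
  assumes "vspan_pos n d \<Phi>" "0 \<le> d"
  shows "lfam_lead n d (\<lambda>q zs. fls_const (\<Phi> q zs))"
  unfolding lfam_lead_def using assms by (intro exI[of _ 0]) auto

section \<open>Expansion of the stable differentials at the branch points\<close>

abbreviation point :: "bool \<Rightarrow> complex \<Rightarrow> complex \<Rightarrow> complex" where
  "point a s t \<equiv> sg a * exp (s * t)"

lemma point_ne_pm1: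
  assumes "s \<in> {1, -1}" "t \<in> ball 0 1 - {0}"
  shows "point a s t \<noteq> 1" "point a s t \<noteq> -1"
proof -
  have "s * t \<in> ball 0 1 - {0}" using assms by auto
  from exp_ne_pm1[OF this] show "point a s t \<noteq> 1" "point a s t \<noteq> -1"
    by (cases a; auto simp: minus_equation_iff)+
qed

lemma adm_point:
  assumes "adm n q zs" "s \<in> {1, -1}" "t \<in> ball 0 1 - {0}"
  shows "adm (Suc n) q (point a s t # zs)"
proof -
  have "1 \<noteq> point a s t" "-1 \<noteq> point a s t" using point_ne_pm1[OF assms(2,3), of a] by metis+
  then show ?thesis using assms(1) by (simp add: adm_def)
qed

text \<open>
  A choice of the expansion provided by \<open>kfun_laurent\<close>; by that lemma it does not depend on the
  sheet \<open>s = \<plusminus>1\<close>, that is, it is invariant under the involution.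
\<close>

definition slot_factor :: "bool \<Rightarrow> bool \<times> nat \<Rightarrow> complex fls" where
  "slot_factor a p = (SOME F. \<exists>r. evrat_fls (2 * snd p + 2) r F \<and> 0 \<le> r \<and> (a = fst p \<longrightarrow> 0 < r) \<and>
     (\<forall>s\<in>{1, -1}. (\<lambda>t. point a s t * psi (fst p) (2 * snd p) (point a s t)) has_laurent_expansion F))"

lemma slot_factor_ex:
  "\<exists>r. evrat_fls (2 * k + 2) r (slot_factor a (b, k)) \<and> 0 \<le> r \<and> (a = b \<longrightarrow> 0 < r) \<and>
     (\<forall>s\<in>{1, -1}. (\<lambda>t. point a s t * psi b (2 * k) (point a s t)) has_laurent_expansion slot_factor a (b, k))"
proof -
  have "\<exists>F. \<exists>r. evrat_fls (2 * k + 2) r F \<and> 0 \<le> r \<and> (a = b \<longrightarrow> 0 < r) \<and>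
     (\<forall>s\<in>{1, -1}. (\<lambda>t. point a s t * psi b (2 * k) (point a s t)) has_laurent_expansion F)"
    unfolding psi_local by (rule kfun_laurent)
  then show ?thesis
    unfolding slot_factor_def fst_conv snd_conv by (rule someI_ex)
qed

lemma slot_factor:
  shows "s \<in> {1, -1} \<Longrightarrow> (\<lambda>t. point a s t * psi b (2 * k) (point a s t)) has_laurent_expansion slot_factor a (b, k)"
    and "lfam_even 0 (2 * int k + 2) (\<lambda>q zs. slot_factor a (b, k))"
    and "a = b \<Longrightarrow> vspan_pos 0 (2 * int k + 2 + - (2 * int k + 2)) (\<lambda>q zs. slot_factor a (b, k) $$ (- (2 * int k + 2)))"
proof -
  obtain r where r: "evrat_fls (2 * k + 2) r (slot_factor a (b, k))" "0 \<le> r" "a = b \<longrightarrow> 0 < r"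
    "\<forall>s\<in>{1, -1}. (\<lambda>t. point a s t * psi b (2 * k) (point a s t)) has_laurent_expansion slot_factor a (b, k)"
    using slot_factor_ex[of k a b] by blast
  show "s \<in> {1, -1} \<Longrightarrow> (\<lambda>t. point a s t * psi b (2 * k) (point a s t)) has_laurent_expansion slot_factor a (b, k)"
    using r(4) by blast
  have D: "int (2 * k + 2) = 2 * int k + 2" by simp
  show "lfam_even 0 (2 * int k + 2) (\<lambda>q zs. slot_factor a (b, k))"
    using evrat_fls_lfam[OF r(1,2)] unfolding D .
  show "a = b \<Longrightarrow> vspan_pos 0 (2 * int k + 2 + - (2 * int k + 2)) (\<lambda>q zs. slot_factor a (b, k) $$ (- (2 * int k + 2)))"
    using evrat_fls_leading[OF r(1)] r(3) unfolding D by blast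
qed

lemma slot_factor_lfam:
  assumes "lfam_even n d G"
  shows "lfam_even n (d + 2 * int k + 2) (\<lambda>q zs. slot_factor a (b, k) * G q zs)"
  using lfam_even_mult_const[OF slot_factor(2)[of k a b] assms] by (simp add: algebra_simps)

lemma slot_factor_lead:
  assumes "lfam_even n d G" "lfam_lead n d G"
  shows "lfam_lead n (d + 2 * int k + 2) (\<lambda>q zs. slot_factor a (a, k) * G q zs)"
proof -
  have "\<exists>j. even j \<and> - (2 * int k + 2 + d) \<le> j \<and> j \<le> - (2 * int k + 2) \<and>
     vspan_pos n (2 * int k + 2 + d + j) (\<lambda>q zs. (slot_factor a (a, k) * G q zs) $$ j)"
    by (rule lfam_lead_mult_const[OF slot_factor(2)[of k a a] _ slot_factor(3)[OF refl]])
       (use assms in \<open>auto simp: lfam_even_def\<close>)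
  then obtain j where "even j" "- (2 * int k + 2 + d) \<le> j" "j \<le> - (2 * int k + 2)"
     "vspan_pos n (2 * int k + 2 + d + j) (\<lambda>q zs. (slot_factor a (a, k) * G q zs) $$ j)" by blast
  then show ?thesis unfolding lfam_lead_def by (intro exI[of _ j]) (auto simp: algebra_simps)
qed

lemma admissible_term_Cons:
  assumes "admissible_term (Suc n) d (r, m, (b, k) # \<kappa>)"
  shows "admissible_term n (d - 2 * int k) (r, m, \<kappa>)"
  using assms by auto

lemma leading_term_Cons:
  assumes "leading_term (Suc n) d (r, m, (b, k) # \<kappa>)"
  shows "leading_term n (d - 2 * int k) (r, m, \<kappa>)" "b"
  using assms by auto

lemma leading_term_nonneg: "leading_term n d t \<Longrightarrow> 0 \<le> d"
  by (cases t) auto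

text \<open>
  The flag \<open>a\<close> says whether positivity is claimed; it holds at the branch point \<open>1\<close> only.
\<close>

definition expands ::
    "bool \<Rightarrow> nat \<Rightarrow> int \<Rightarrow> (real \<Rightarrow> complex list \<Rightarrow> complex \<Rightarrow> complex) \<Rightarrow> (real \<Rightarrow> complex list \<Rightarrow> complex fls) \<Rightarrow> bool" where
  "expands a n d f G \<longleftrightarrow> lfam n d G \<and> (a \<longrightarrow> lfam_lead n d G) \<and>
     (\<forall>q zs. adm n q zs \<longrightarrow> f q zs has_laurent_expansion G q zs)"

lemma expands_0: "\<not> a \<Longrightarrow> expands a n d (\<lambda>q zs u. 0) (\<lambda>q zs. 0)"
  by (simp add: expands_def)

lemma expands_add:
  assumes "expands a n d f F" "expands False n d h H"
    "\<And>q zs u. adm n q zs \<Longrightarrow> u \<in> ball 0 1 - {0} \<Longrightarrow> k q zs u = f q zs u + h q zs u"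
  shows "expands a n d k (\<lambda>q zs. F q zs + H q zs)"
  unfolding expands_def
proof (intro conjI allI impI)
  show "lfam n d (\<lambda>q zs. F q zs + H q zs)" "a \<Longrightarrow> lfam_lead n d (\<lambda>q zs. F q zs + H q zs)"
    using assms(1,2) by (auto simp: expands_def intro: lfam_add lfam_lead_add)
  fix q zs assume adm: "adm n q zs"
  show "k q zs has_laurent_expansion F q zs + H q zs"
  proof (rule iffD1[OF has_laurent_expansion_cong[OF eventually_mono[OF eventually_punctured] refl]])
    show "(\<lambda>u. f q zs u + h q zs u) has_laurent_expansion F q zs + H q zs"
      using assms(1,2) adm by (intro has_laurent_expansion_add) (auto simp: expands_def)
  qed (simp add: assms(3)[OF adm])
qed

lemma expands_sum:
  assumes "finite A" "\<And>x. x \<in> A \<Longrightarrow> expands (b x) n d (f x) (G x)" "a \<Longrightarrow> \<exists>x\<in>A. b x"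
  shows "expands a n d (\<lambda>q zs u. \<Sum>x\<in>A. f x q zs u) (\<lambda>q zs. \<Sum>x\<in>A. G x q zs)"
  unfolding expands_def
proof (intro conjI allI impI)
  show "lfam n d (\<lambda>q zs. \<Sum>x\<in>A. G x q zs)"
    using assms(2) by (intro lfam_sum) (auto simp: expands_def)
  show "lfam_lead n d (\<lambda>q zs. \<Sum>x\<in>A. G x q zs)" if a
  proof -
    obtain x where "x \<in> A" "b x" using assms(3) \<open>a\<close> by blast
    then show ?thesis using assms(2) by (intro lfam_lead_sum[OF assms(1)]) (auto simp: expands_def)
  qed
  show "(\<lambda>u. \<Sum>x\<in>A. f x q zs u) has_laurent_expansion (\<Sum>x\<in>A. G x q zs)" if "adm n q zs" for q zs
    using assms(2) that by (intro has_laurent_expansion_sum) (auto simp: expands_def)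
qed

text \<open>
  Expansions of single terms suffice. Besides the expansion of one variable this covers that of
  two variables exchanged by the involution, through the choice of \<open>pts\<close> and of the Jacobian \<open>c\<close>.
\<close>

lemma vspan_expands:
  assumes pts: "\<And>q zs u. adm n q zs \<Longrightarrow> u \<in> ball 0 1 - {0} \<Longrightarrow> adm N q (pts u zs)"
    and "term": "\<And>t. admissible_term N d t \<Longrightarrow> \<exists>G. lfam_even n e G \<and>
      expands (a \<and> leading_term N d t) n e (\<lambda>q zs u. c u * term_value q (pts u zs) t) G"
    and "vspan_pos N d \<Phi>"
  shows "\<exists>G. lfam_even n e G \<and> expands a n e (\<lambda>q zs u. c u * \<Phi> q (pts u zs)) G"
proof -
  have span: "\<exists>G. lfam_even n e G \<and> expands False n e (\<lambda>q zs u. c u * \<Phi> q (pts u zs)) G"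
    if "vspan N d \<Phi>" for \<Phi>
    using that
  proof induction
    case (zero \<Phi>)
    have "expands False n e (\<lambda>q zs u. c u * \<Phi> q (pts u zs)) (\<lambda>q zs. 0 + 0)"
      by (rule expands_add[OF expands_0 expands_0]) (simp_all add: zero pts)
    then show ?case by (intro exI[of _ "\<lambda>q zs. 0"]) simp
  next
    case (add_term \<Phi> t \<Phi>')
    then obtain F where F: "lfam_even n e F" "expands False n e (\<lambda>q zs u. c u * \<Phi> q (pts u zs)) F" by blast
    obtain H where H: "lfam_even n e H"
      "expands (a \<and> leading_term N d t) n e (\<lambda>q zs u. c u * term_value q (pts u zs) t) H"
      using "term"[OF \<open>admissible_term N d t\<close>] by blast
    have "expands False n e (\<lambda>q zs u. c u * term_value q (pts u zs) t) H"
      using H(2) by (simp add: expands_def)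
    from expands_add[OF F(2) this, of "\<lambda>q zs u. c u * \<Phi>' q (pts u zs)"]
    have "expands False n e (\<lambda>q zs u. c u * \<Phi>' q (pts u zs)) (\<lambda>q zs. F q zs + H q zs)"
      by (simp add: add_term.hyps(3)[OF pts] distrib_left)
    then show ?case using lfam_even_add[OF F(1) H(1)] by blast
  qed
  obtain \<Phi>0 t where *: "vspan N d \<Phi>0" "leading_term N d t"
    "\<forall>q zs. adm N q zs \<longrightarrow> \<Phi> q zs = \<Phi>0 q zs + term_value q zs t"
    using assms(3) unfolding vspan_pos_def by blast
  have ok: "admissible_term N d t" using *(2) by (cases t) simp
  obtain F where F: "lfam_even n e F" "expands False n e (\<lambda>q zs u. c u * \<Phi>0 q (pts u zs)) F"
    using span[OF *(1)] by blast
  obtain H where H: "lfam_even n e H" "expands a n e (\<lambda>q zs u. c u * term_value q (pts u zs) t) H"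
    using "term"[OF ok] *(2) by auto
  from expands_add[OF H(2) F(2), of "\<lambda>q zs u. c u * \<Phi> q (pts u zs)"]
  have "expands a n e (\<lambda>q zs u. c u * \<Phi> q (pts u zs)) (\<lambda>q zs. H q zs + F q zs)"
    using *(3) pts by (simp add: algebra_simps)
  then show ?thesis using lfam_even_add[OF H(1) F(1)] by blast
qed

lemma slot_factor_expands:
  assumes "s \<in> {1, -1}" "lfam_even n d G" "b \<Longrightarrow> lfam_lead n d G" "b \<Longrightarrow> a = a'"
    and "\<And>q zs. adm n q zs \<Longrightarrow> f q zs has_laurent_expansion G q zs"
  shows "lfam_even n (d + 2 * int k + 2) (\<lambda>q zs. slot_factor a (a', k) * G q zs)"
    "expands b n (d + 2 * int k + 2) (\<lambda>q zs u. point a s u * psi a' (2 * k) (point a s u) * f q zs u)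
       (\<lambda>q zs. slot_factor a (a', k) * G q zs)"
proof -
  show even: "lfam_even n (d + 2 * int k + 2) (\<lambda>q zs. slot_factor a (a', k) * G q zs)"
    by (rule slot_factor_lfam[OF assms(2)])
  have "lfam_lead n (d + 2 * int k + 2) (\<lambda>q zs. slot_factor a (a', k) * G q zs)" if b
    using slot_factor_lead[OF assms(2,3)] assms(4) that by auto
  then show "expands b n (d + 2 * int k + 2) (\<lambda>q zs u. point a s u * psi a' (2 * k) (point a s u) * f q zs u)
       (\<lambda>q zs. slot_factor a (a', k) * G q zs)"
    unfolding expands_def using even assms(5)
    by (auto simp: lfam_even_def intro!: has_laurent_expansion_mult slot_factor(1)[OF assms(1)])
qed

lemma term_expands_const:
  assumes "admissible_term n d t"
  shows "lfam_even n d (\<lambda>q zs. fls_const (term_value q zs t))"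
    "leading_term n d t \<Longrightarrow> lfam_lead n d (\<lambda>q zs. fls_const (term_value q zs t))"
    "(\<lambda>u. term_value q zs t) has_laurent_expansion fls_const (term_value q zs t)"
  using assms
  by (auto intro!: lfam_even_const vspan_term lfam_lead_const vspan_pos_term leading_term_nonneg)

text \<open>
  The factor of the expanded variable contributes degree \<open>2k + 2\<close> instead of \<open>2k\<close>, hence the shift by two.
\<close>

lemma expansion_one_variable:
  assumes "vspan_pos (Suc n) d \<Phi>" "s \<in> {1, -1}"
  shows "\<exists>G. lfam_even n (d + 2) G \<and> expands a n (d + 2) (\<lambda>q zs u. point a s u * \<Phi> q (point a s u # zs)) G"
proof (rule vspan_expands[OF _ _ assms(1)])
  show "adm (Suc n) q (point a s u # zs)" if "adm n q zs" "u \<in> ball 0 1 - {0}" for q zs u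
    by (rule adm_point[OF that(1) assms(2) that(2)])
  fix t assume ok: "admissible_term (Suc n) d t"
  then obtain r m b k \<kappa> where t: "t = (r, m, (b, k) # \<kappa>)"
    by (cases t) (auto simp: length_Suc_conv)
  let ?t = "(r, m, \<kappa>)" let ?d = "d - 2 * int k"
  have ok': "admissible_term n ?d ?t" using ok unfolding t by (rule admissible_term_Cons)
  have lt: "leading_term n ?d ?t \<and> b" if "leading_term (Suc n) d t"
    using leading_term_Cons[OF that[unfolded t]] by blast
  note * = slot_factor_expands[OF assms(2) term_expands_const(1)[OF ok'], of "a \<and> leading_term (Suc n) d t" a b
      "\<lambda>q zs u. term_value q zs ?t" k]
  have eq: "(\<lambda>q zs u. point a s u * psi b (2 * k) (point a s u) * term_value q zs ?t) =
      (\<lambda>q zs u. point a s u * term_value q (point a s u # zs) t)"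
    by (simp add: t psi_prod_Cons fun_eq_iff mult_ac)
  have d: "?d + 2 * int k + 2 = d + 2" by simp
  show "\<exists>G. lfam_even n (d + 2) G \<and> expands (a \<and> leading_term (Suc n) d t) n (d + 2)
      (\<lambda>q zs u. point a s u * term_value q (point a s u # zs) t) G"
    using * lt term_expands_const[OF ok'] unfolding eq d by blast
qed

text \<open>
  The coordinates of two points exchanged by the involution are inverse to each other, so that the
  Jacobians of the two factors in the recursion cancel.
\<close>

lemma point_cancel: "point a 1 u * x * (point a (-1) u * y) = x * y"
proof -
  have "point a 1 u * point a (-1) u = 1" by (simp add: algebra_simps exp_minus)
  then show ?thesis by (metis (no_types, opaque_lifting) mult.assoc mult.commute mult_1)
qed

lemma expansion_two_variables:
  assumes "vspan_pos (Suc (Suc n)) d \<Phi>"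
  shows "\<exists>G. expands a n (d + 4) (\<lambda>q zs u. \<Phi> q (point a 1 u # point a (-1) u # zs)) G"
proof -
  have "\<exists>G. lfam_even n (d + 4) G \<and> expands a n (d + 4) (\<lambda>q zs u. 1 * \<Phi> q (point a 1 u # point a (-1) u # zs)) G"
  proof (rule vspan_expands[OF _ _ assms])
    show "adm (Suc (Suc n)) q (point a 1 u # point a (-1) u # zs)" if "adm n q zs" "u \<in> ball 0 1 - {0}" for q zs u
      by (rule adm_point[OF adm_point[OF that(1) _ that(2)] _ that(2)]) auto
    fix t assume ok: "admissible_term (Suc (Suc n)) d t"
    then obtain r m b k b' k' \<kappa> where t: "t = (r, m, (b, k) # (b', k') # \<kappa>)"
      by (cases t) (auto simp: length_Suc_conv)
    let ?t = "(r, m, \<kappa>)" let ?d = "d - 2 * int k - 2 * int k'" let ?l = "a \<and> leading_term (Suc (Suc n)) d t"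
    have ok': "admissible_term n ?d ?t" using ok unfolding t by (intro admissible_term_Cons)
    have lt: "leading_term n ?d ?t \<and> b \<and> b'" if "leading_term (Suc (Suc n)) d t"
    proof -
      note * = leading_term_Cons[OF that[unfolded t]]
      show ?thesis using leading_term_Cons[OF *(1)] *(2) by auto
    qed
    define G where "G q zs = slot_factor a (b', k') * fls_const (term_value q zs ?t)" for q zs
    let ?f = "\<lambda>q zs u. point a (-1) u * psi b' (2 * k') (point a (-1) u) * term_value q zs ?t"
    have "lfam_even n (?d + 2 * int k' + 2) G \<and> expands ?l n (?d + 2 * int k' + 2) ?f G"
      using slot_factor_expands[of "-1" n ?d "\<lambda>q zs. fls_const (term_value q zs ?t)" ?l a b' "\<lambda>q zs u. term_value q zs ?t" k']
        lt term_expands_const[OF ok'] unfolding G_def by blast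
    then have G: "lfam_even n (?d + 2 * int k' + 2) G" "?l \<Longrightarrow> lfam_lead n (?d + 2 * int k' + 2) G"
      "\<And>q zs. adm n q zs \<Longrightarrow> ?f q zs has_laurent_expansion G q zs"
      by (auto simp: expands_def)
    note * = slot_factor_expands[of 1, OF _ G(1), of ?l a b ?f k]
    have eq: "(\<lambda>q zs u. point a 1 u * psi b (2 * k) (point a 1 u) * ?f q zs u) =
        (\<lambda>q zs u. 1 * term_value q (point a 1 u # point a (-1) u # zs) t)"
      unfolding mult.assoc[of "point a (-1) u" for u] point_cancel by (simp add: t psi_prod_Cons fun_eq_iff mult_ac)
    have d: "?d + 2 * int k' + 2 + 2 * int k + 2 = d + 4" by simp
    show "\<exists>G. lfam_even n (d + 4) G \<and> expands ?l n (d + 4) (\<lambda>q zs u. 1 * term_value q (point a 1 u # point a (-1) u # zs) t) G"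
      using * lt G(2,3) unfolding eq d by blast
  qed
  then show ?thesis by auto
qed

lemma of_rat_fact: "of_rat (fact n) = (fact n :: complex)"
  by (metis of_rat_of_nat_eq of_nat_fact)

section \<open>Expansion of the Bergman kernel\<close>

text \<open>
  Up to the sign of \<open>t\<close> the expansion of \<open>\<omega>\<^sub>0\<^sub>,\<^sub>2\<close> at a branch point is that of \<open>kfun\<close> with index \<open>0\<close>, whose even Taylor
  coefficients are basis functions of the other variable. The odd ones are not, so this is
  an \<open>lfam\<close> but not an \<open>lfam_even\<close>.
\<close>

lemma W02_local:
  "\<exists>G. expands a 1 0 (\<lambda>q zs u. point a s u * W02 (point a s u) (hd zs)) G"
  if s: "s \<in> {1, -1}"
proof -
  define E where "E z = (SOME E. kfun (sg a) z 0 has_fps_expansion E \<and>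
      (\<forall>n. fps_nth E n = kfun (sg a) z n 0 / fact n))" for z
  have E: "kfun (sg a) z 0 has_fps_expansion E z" "fps_nth (E z) n = psi a n z / fact n"
    if "sg a * z \<noteq> 1" for z n
  proof -
    have "\<exists>E. kfun (sg a) z 0 has_fps_expansion E \<and> (\<forall>n. fps_nth E n = kfun (sg a) z n 0 / fact n)"
      using kfun_fps[OF that, of 0] by (metis add_0)
    from someI_ex[OF this, folded E_def]
    show "kfun (sg a) z 0 has_fps_expansion E z" "fps_nth (E z) n = psi a n z / fact n"
      by (auto simp: psi_eq_kfun)
  qed
  have ne: "sg a * hd zs \<noteq> 1" if "adm 1 q zs" for q zs
    using that by (cases zs) (auto simp: adm_def sg_def minus_equation_iff)
  define G where "G q zs = fps_to_fls (fps_compose (E (hd zs)) (fps_const (- s) * fps_X))" for q :: real and zs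
  have nth: "G q zs $$ i = (if i < 0 then 0 else (- s) ^ nat i * (psi a (nat i) (hd zs) / fact (nat i)))"
    if "adm 1 q zs" for q zs i
    unfolding G_def using E(2)[OF ne[OF that]] by (simp add: fps_compose_linear)
  have nth_even: "G q zs $$ (2 * int k) = of_rat (1 / fact (2 * k)) * psi a (2 * k) (hd zs)"
    if "adm 1 q zs" for q zs k
  proof -
    have "(- s) ^ (2 * k) = 1" using s by auto
    moreover have "nat (2 * int k) = 2 * k" by simp
    ultimately show ?thesis unfolding nth[OF that] by (simp add: of_rat_divide of_rat_fact)
  qed
  have "lfam 1 0 G"
    unfolding lfam_def
  proof (intro conjI allI impI)
    fix i :: int assume "even i"
    show "vspan 1 (0 + i) (\<lambda>q zs. G q zs $$ i)"
    proof (cases "i < 0")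
      case True
      then show ?thesis by (intro vspan.zero) (auto simp: nth)
    next
      case False
      with \<open>even i\<close> obtain k where i: "i = 2 * int k"
        by (metis dvd_def linorder_not_le nonneg_int_cases not_less zero_le_mult_iff zero_less_numeral linorder_not_less)
      show ?thesis
        unfolding i add_0 by (rule vspan_cong[OF vspan_psi(1)[of "1 / fact (2 * k)"]]) (auto simp: nth_even)
    qed
  qed (auto simp: nth)
  moreover have "lfam_lead 1 0 G" if a
    unfolding lfam_lead_def
  proof (intro exI[of _ 0] conjI)
    show "vspan_pos 1 (0 + 0) (\<lambda>q zs. G q zs $$ 0)"
      using vspan_pos_cong[OF vspan_psi(2)[of "1 / fact (2 * 0)" a 0], of "\<lambda>q zs. G q zs $$ 0"] that nth_even[of _ _ 0] by auto
  qed auto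
  moreover have "(\<lambda>u. point a s u * W02 (point a s u) (hd zs)) has_laurent_expansion G q zs"
    if "adm 1 q zs" for q zs
  proof -
    have "(kfun (sg a) (hd zs) 0 \<circ> (\<lambda>u. - s * u)) has_fps_expansion fps_compose (E (hd zs)) (fps_const (- s) * fps_X)"
      by (intro has_fps_expansion_compose E(1) ne[OF that] fps_expansion_intros) auto
    from has_laurent_expansion_fps[OF this]
    have "(\<lambda>u. kfun (sg a) (hd zs) 0 (- s * u)) has_laurent_expansion G q zs"
      by (simp add: G_def o_def)
    moreover have "kfun (sg a) w 0 (- s * u) = point a s u * W02 (point a s u) w" for u w
    proof -
      define e where "e = exp (s * u)"
      have e: "e \<noteq> 0" "exp (- s * u) = inverse e" by (simp_all add: e_def exp_minus)
      have "e - sg a * w = sg a * (sg a * e - w)" by (simp add: algebra_simps)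
      then have "(e - sg a * w)\<^sup>2 = (sg a * e - w)\<^sup>2" by (simp add: power_mult_distrib)
      moreover have "1 - sg a * inverse e * w = (e - sg a * w) / e" using e by (simp add: field_simps)
      ultimately have "(1 / (1 - sg a * inverse e * w))\<^sup>2 = e\<^sup>2 / (sg a * e - w)\<^sup>2"
        by (simp add: power_divide)
      then have "kfun (sg a) w 0 (- s * u) = sg a * inverse e * (e\<^sup>2 / (sg a * e - w)\<^sup>2)"
        unfolding kfun_def e by simp
      also have "\<dots> = point a s u * W02 (point a s u) w"
        using e(1) by (simp add: W02_def power2_eq_square flip: e_def)
      finally show ?thesis .
    qed
    ultimately show ?thesis by simp
  qed
  ultimately show ?thesis unfolding expands_def by blast
qed

lemma W02_diagonal_local:
  "(\<lambda>u. W02 (point a 1 u) (point a (-1) u)) has_laurent_expansion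
     fls_shift 2 (fps_to_fls ((inverse (sinhc 1))\<^sup>2))"
proof -
  have "W02 (point a 1 u) (point a (-1) u) = 1 / (exp (1 * u) - exp (- 1 * u))\<^sup>2" for u
    by (simp add: W02_def power_mult_distrib flip: right_diff_distrib)
  then show ?thesis using inverse_sinh_square_laurent[of 1] by simp
qed

section \<open>The recursion kernel near a branch point\<close>

lemma okuyama_y_product:
  assumes "0 < q" "q < 1" "z \<noteq> 0"
  shows "okuyama_y q z = 1 / 2 * (z - inverse z) * prodinf (\<lambda>k. 1 - of_real (xcoef q k) * (z - inverse z)\<^sup>2)"
proof -
  have "(1 - of_real q ^ Suc k * z\<^sup>2) * (1 - of_real q ^ Suc k * inverse (z\<^sup>2)) / (1 - of_real q ^ Suc k)\<^sup>2 =
      1 - of_real (xcoef q k) * (z - inverse z)\<^sup>2" for k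
  proof -
    define Q where "Q = complex_of_real (q ^ Suc k)"
    have "q ^ Suc k < 1" using assms(1,2) by (intro power_Suc_less_one) auto
    then have "Q \<noteq> 1" unfolding Q_def by (metis less_irrefl of_real_eq_1_iff)
    then have Q: "(1 - Q)\<^sup>2 \<noteq> 0" by simp
    have "(1 - Q * z\<^sup>2) * (1 - Q * inverse (z\<^sup>2)) = (1 - Q)\<^sup>2 - Q * (z - inverse z)\<^sup>2"
      using assms(3) by (simp add: field_simps power2_eq_square)
    then have "(1 - Q * z\<^sup>2) * (1 - Q * inverse (z\<^sup>2)) / (1 - Q)\<^sup>2 = 1 - Q / (1 - Q)\<^sup>2 * (z - inverse z)\<^sup>2"
      using Q by (simp add: diff_divide_distrib)
    moreover have "of_real (xcoef q k) = Q / (1 - Q)\<^sup>2" by (simp add: xcoef_def Q_def)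
    ultimately show ?thesis by (simp add: Q_def)
  qed
  then show ?thesis unfolding okuyama_y_def by presburger
qed

lemma deriv_inverse: "deriv inverse z = - inverse (z\<^sup>2)" if "z \<noteq> 0" for z :: complex
  using DERIV_inverse[OF that] by (simp add: DERIV_imp_deriv numeral_2_eq_2 power_inverse)

lemma deriv_okuyama_x: "deriv okuyama_x z = 1 - inverse (z\<^sup>2)" if "z \<noteq> 0"
proof -
  have "(okuyama_x has_field_derivative 1 - inverse (z\<^sup>2)) (at z)"
    unfolding okuyama_x_def [abs_def] using that
    by (auto intro!: derivative_eq_intros simp: power2_eq_square)
  then show ?thesis by (rule DERIV_imp_deriv)
qed

text \<open>
  The kernel together with the derivative of the involution, which belongs to the pull-back in
  the second argument of the bracket.
\<close>

definition kernel_density :: "real \<Rightarrow> complex \<Rightarrow> complex \<Rightarrow> complex \<Rightarrow> complex" where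
  "kernel_density q \<alpha> z1 z =
     recursion_kernel okuyama_x (okuyama_y q) (\<lambda>\<alpha> z. inverse z) \<alpha> z1 z * deriv inverse z"

lemma contour_integral_W02:
  assumes "z1 \<notin> closed_segment z w"
  shows "contour_integral (linepath z w) (W02 z1) = 1 / (z1 - w) - 1 / (z1 - z)"
proof -
  have "((\<lambda>w. 1 / (z1 - w)) has_field_derivative W02 z1 x) (at x within - {z1})" if "x \<in> - {z1}" for x
    unfolding W02_def using that
    by (auto intro!: derivative_eq_intros simp: power2_eq_square)
  from contour_integral_primitive[OF this, of "linepath z w"]
  have "(W02 z1 has_contour_integral 1 / (z1 - w) - 1 / (z1 - z)) (linepath z w)"
    using assms by auto
  then show ?thesis by (rule contour_integral_unique)
qed

text \<open>
  Since \<open>y(1/z) = - y(z)\<close>, the denominator of the kernel is \<open>2 y(z) dx(z)\<close>; the factor \<open>z\<close> on the left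
  is the Jacobian of \<open>z = \<alpha> e^t\<close>.
\<close>

lemma kernel_density_eq:
  assumes q: "0 < q" "q < 1" and z: "z \<noteq> 0" "z1 \<notin> closed_segment z (inverse z)"
  shows "kernel_density q \<alpha> z1 z * z =
    1 / 2 * (z / (1 - z * z1) - inverse z / (1 - inverse z * z1)) *
    (1 / (z - inverse z)\<^sup>2 * (1 / prodinf (\<lambda>k. 1 - of_real (xcoef q k) * (z - inverse z)\<^sup>2)))"
proof -
  define P where "P = prodinf (\<lambda>k. 1 - of_real (xcoef q k) * (z - inverse z)\<^sup>2)"
  define d where "d = z - inverse z"
  have ne: "z1 \<noteq> z" "z1 \<noteq> inverse z" using z(2) by auto
  have y: "okuyama_y q z = 1 / 2 * d * P"
    using okuyama_y_product[OF q z(1)] by (simp add: P_def d_def)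
  have "inverse z - z = - d" by (simp add: d_def)
  then have y': "okuyama_y q (inverse z) = - (1 / 2 * d * P)"
    using okuyama_y_product[OF q, of "inverse z"] z(1) by (simp add: P_def flip: d_def)
  have x: "(1 - inverse (z\<^sup>2)) = d * inverse z"
    using z(1) by (simp add: d_def field_simps power2_eq_square)
  have x': "(1 - z\<^sup>2) * inverse (z\<^sup>2) = - (d * inverse z)"
    using z(1) by (simp add: d_def field_simps power2_eq_square)
  have den: "W01 okuyama_x (okuyama_y q) z - W01 okuyama_x (okuyama_y q) (inverse z) * deriv inverse z = d\<^sup>2 * P * inverse z"
  proof -
    have "W01 okuyama_x (okuyama_y q) z = 1 / 2 * d * P * (d * inverse z)"
      by (simp add: W01_def y deriv_okuyama_x[OF z(1)] x)
    moreover have "W01 okuyama_x (okuyama_y q) (inverse z) * deriv inverse z =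
        (1 / 2 * d * P) * ((1 - z\<^sup>2) * inverse (z\<^sup>2))"
    proof -
      have "deriv okuyama_x (inverse z) = 1 - z\<^sup>2" using z(1) by (simp add: deriv_okuyama_x power_inverse)
      moreover have "- u * v * - w = u * (v * w)" for u v w :: complex by simp
      ultimately show ?thesis unfolding W01_def y' deriv_inverse[OF z(1)] by (simp only:)
    qed
    ultimately have "W01 okuyama_x (okuyama_y q) z - W01 okuyama_x (okuyama_y q) (inverse z) * deriv inverse z =
        1 / 2 * d * P * (d * inverse z) - 1 / 2 * d * P * (- (d * inverse z))"
      unfolding x' by (simp only:)
    also have "\<dots> = d\<^sup>2 * P * inverse z" by (simp add: power2_eq_square algebra_simps)
    finally show ?thesis .
  qed
  have "kernel_density q \<alpha> z1 z * z =
     1 / 2 * (1 / (z1 - inverse z) - 1 / (z1 - z)) / (d\<^sup>2 * P * inverse z) * (- inverse (z\<^sup>2)) * z"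
    unfolding kernel_density_def recursion_kernel_def
    unfolding den contour_integral_W02[OF z(2)]
    unfolding deriv_inverse[OF z(1)] by simp
  also have "\<dots> = 1 / 2 * (1 / (z1 - z) - 1 / (z1 - inverse z)) * (1 / d\<^sup>2 * (1 / P))"
  proof -
    have "- inverse (z\<^sup>2) * z / inverse z = - 1" using z(1) by (simp add: field_simps power2_eq_square)
    then have "1 / 2 * A / (d\<^sup>2 * P * inverse z) * (- inverse (z\<^sup>2)) * z = 1 / 2 * (- A) * (1 / d\<^sup>2 * (1 / P))" for A
      using z(1) by (simp add: divide_simps power2_eq_square)
    from this[of "1 / (z1 - inverse z) - 1 / (z1 - z)"] show ?thesis by simp
  qed
  also have "1 / (z1 - z) = - (inverse z / (1 - inverse z * z1))"
  proof -
    have "1 - inverse z * z1 = - inverse z * (z1 - z)" using z(1) by (simp add: algebra_simps)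
    then show ?thesis using z(1) ne by (simp add: divide_simps)
  qed
  also have "1 / (z1 - inverse z) = - (z / (1 - z * z1))"
  proof -
    have "z / (- z * w) = - (1 / w)" for w using z(1) by simp
    moreover have "1 - z * z1 = - z * (z1 - inverse z)" using z(1) by (simp add: algebra_simps)
    ultimately show ?thesis by (metis minus_minus)
  qed
  finally show ?thesis by (simp add: P_def d_def)
qed

lemma source_fps:
  assumes "c * z1 \<noteq> 1"
  obtains E where "(\<lambda>t. 1 / 2 * (c * exp t / (1 - c * exp t * z1) - c * exp (- t) / (1 - c * exp (- t) * z1))) has_fps_expansion E"
    "\<And>n. even n \<Longrightarrow> fps_nth E n = 0" "\<And>k. fps_nth E (2 * k + 1) = kfun c z1 (2 * k) 0 / fact (2 * k + 1)"
proof -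
  let ?f = "\<lambda>t. c * exp t / (1 - c * exp t * z1)"
  have "?f analytic_on {0}" using assms by (intro analytic_intros) auto
  then have E: "?f has_fps_expansion fps_expansion ?f 0" (is "_ has_fps_expansion ?E")
    by (rule analytic_at_imp_has_fps_expansion_0)
  have ev: "eventually (\<lambda>t. c * exp t * z1 \<noteq> 1) (nhds 0)"
  proof -
    have "isCont (\<lambda>t. c * exp t * z1) 0" by (intro continuous_intros)
    then have "((\<lambda>t. c * exp t * z1) \<longlongrightarrow> c * z1) (nhds 0)"
      by (simp add: isCont_def tendsto_nhds_iff)
    from this assms show ?thesis by (rule tendsto_imp_eventually_ne)
  qed
  have "deriv ?f has_fps_expansion fps_deriv ?E" by (intro fps_expansion_intros E)
  moreover have "eventually (\<lambda>t. deriv ?f t = kfun c z1 0 t) (nhds 0)"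
    using ev by eventually_elim (intro DERIV_imp_deriv kfun_deriv_source)
  ultimately have D: "kfun c z1 0 has_fps_expansion fps_deriv ?E"
    by (subst (asm) has_fps_expansion_cong[OF _ refl])
  obtain E0 where E0: "kfun c z1 0 has_fps_expansion E0" "\<And>n. fps_nth E0 n = kfun c z1 (0 + n) 0 / fact n"
    using kfun_fps[OF assms, of 0] by blast
  have dE: "fps_deriv ?E = E0" by (rule fps_expansion_unique_complex[OF D E0(1)])
  have "of_nat (Suc n) * fps_nth ?E (Suc n) = kfun c z1 n 0 / fact n" for n
  proof -
    have "fps_nth (fps_deriv ?E) n = kfun c z1 n 0 / fact n"
      unfolding dE using E0(2)[of n] by simp
    then show ?thesis unfolding fps_deriv_nth by simp
  qed
  then have coeff: "fps_nth ?E (Suc n) = kfun c z1 n 0 / fact (Suc n)" for n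
    by (simp add: field_simps del: of_nat_Suc)
  have "(?f \<circ> (\<lambda>t. - 1 * t)) has_fps_expansion fps_compose ?E (fps_const (- 1) * fps_X)"
    by (intro has_fps_expansion_compose E fps_expansion_intros) auto
  then have "(\<lambda>t. c * exp (- t) / (1 - c * exp (- t) * z1)) has_fps_expansion fps_compose ?E (fps_const (- 1) * fps_X)"
    by (simp add: o_def)
  from has_fps_expansion_cmult_left[OF has_fps_expansion_diff[OF E this], of "1 / 2"]
  show ?thesis
  proof (rule that)
    fix n :: nat assume "even n"
    then show "fps_nth (fps_const (1 / 2) * (?E - fps_compose ?E (fps_const (- 1) * fps_X))) n = 0"
      by (simp add: fps_compose_linear del: fps_const_neg)
  next
    fix k :: nat
    show "fps_nth (fps_const (1 / 2) * (?E - fps_compose ?E (fps_const (- 1) * fps_X))) (2 * k + 1) =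
        kfun c z1 (2 * k) 0 / fact (2 * k + 1)"
      using coeff[of "2 * k"] by (simp add: fps_compose_linear del: fps_const_neg fact_Suc)
  qed
qed

lemma kernel_fls_expansion:
  assumes "0 < q" "q < 1"
  shows "(\<lambda>t. 1 / (exp t - exp (- t))\<^sup>2 * (1 / prodinf (\<lambda>k. 1 - of_real (xcoef q k) * (exp t - exp (- t))\<^sup>2)))
     has_laurent_expansion kernel_fls q"
proof -
  have S: "(\<lambda>t. (exp (1 * t) - exp (- 1 * t))\<^sup>2) has_fps_expansion (fps_X * sinhc 1)\<^sup>2"
    by (intro fps_expansion_intros exp_minus_exp_fps)
  have "((\<lambda>w. 1 / prodinf (\<lambda>k. 1 - of_real (xcoef q k) * w)) \<circ> (\<lambda>t. (exp (1 * t) - exp (- 1 * t))\<^sup>2))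
      has_fps_expansion fps_compose (hseries q) ((fps_X * sinhc 1)\<^sup>2)"
    by (rule has_fps_expansion_compose[OF theta_expansion[OF assms] S]) (simp add: power2_eq_square)
  from has_laurent_expansion_fps[OF this]
  have "(\<lambda>t. 1 / prodinf (\<lambda>k. 1 - of_real (xcoef q k) * (exp (1 * t) - exp (- 1 * t))\<^sup>2)) has_laurent_expansion theta_fls q"
    by (simp add: o_def theta_fls_def)
  from has_laurent_expansion_mult[OF inverse_sinh_square_laurent[of 1] this]
  show ?thesis by (simp add: kernel_fls_def)
qed

section \<open>The residues in the recursion\<close>

text \<open>
  Against an odd power series only the even pole coefficients of \<open>G\<close> contribute to the residue.
\<close>

lemma residue_odd_times:
  fixes K :: "complex fps" and G :: "complex fls"
  assumes "\<And>n. even n \<Longrightarrow> fps_nth K n = 0" "\<And>i. i < - int D \<Longrightarrow> G $$ i = 0"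
  shows "(fps_to_fls K * G) $$ (- 1) = (\<Sum>k<D. fps_nth K (2 * k + 1) * G $$ (- 2 * int k - 2))"
proof -
  let ?f = "\<lambda>i. fps_to_fls K $$ i * G $$ (- 1 - i)"
  have "(fps_to_fls K * G) $$ (- 1) = (\<Sum>i\<in>{- 0..- 1 + (2 * int D + 1)}. ?f i)"
    by (rule fls_times_nth_interval) (use assms(2) in auto)
  also have "\<dots> = (\<Sum>i\<in>(\<lambda>k. 2 * int k + 1) ` {..<D}. ?f i)"
  proof (rule sum.mono_neutral_right)
    show "\<forall>i\<in>{- 0..- 1 + (2 * int D + 1)} - (\<lambda>k. 2 * int k + 1) ` {..<D}. ?f i = 0"
    proof
      fix i assume i: "i \<in> {- 0..- 1 + (2 * int D + 1)} - (\<lambda>k. 2 * int k + 1) ` {..<D}"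
      have "even i"
      proof (rule ccontr)
        assume "odd i"
        then obtain j where j: "i = 2 * j + 1" by (rule oddE)
        then have "i = 2 * int (nat j) + 1" "nat j < D" using i by auto
        then show False using i by blast
      qed
      then have "even (nat i)" using i by (auto simp: even_nat_iff)
      then show "?f i = 0" using assms(1) i by auto
    qed
  qed auto
  also have "\<dots> = (\<Sum>k<D. ?f (2 * int k + 1))"
    by (rule sum.reindex_cong[of "\<lambda>k. 2 * int k + 1"]) (auto simp: inj_on_def)
  also have "\<dots> = (\<Sum>k<D. fps_nth K (2 * k + 1) * G $$ (- 2 * int k - 2))"
  proof (rule sum.cong[OF refl])
    fix k
    have "nat (2 * int k + 1) = 2 * k + 1" "- 1 - (2 * int k + 1) = - 2 * int k - 2" by auto
    then show "?f (2 * int k + 1) = fps_nth K (2 * k + 1) * G $$ (- 2 * int k - 2)" by (simp only: fps_to_fls_nth) simp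
  qed
  finally show ?thesis .
qed

text \<open>
  This is where a new variable appears: pole coefficients become coefficients of basis functions
  of \<open>z1\<close>.
\<close>

lemma residue_kernel:
  assumes adm: "adm (Suc n) q (z1 # zs)"
    and S: "(\<lambda>t. f (point a 1 t)) has_laurent_expansion S"
    and low: "\<And>i. i < - int D \<Longrightarrow> (kernel_fls q * S) $$ i = 0"
  shows "residue (\<lambda>z. kernel_density q (sg a) z1 z * f z) (sg a) =
    (\<Sum>k<D. of_rat (1 / fact (2 * k + 1)) * psi a (2 * k) z1 * (kernel_fls q * S) $$ (- 2 * int k - 2))"
proof -
  have q: "0 < q" "q < 1" using adm by (auto simp: adm_def)
  have z1: "z1 \<noteq> sg a" "sg a * z1 \<noteq> 1" using adm by (auto simp: adm_def sg_def minus_equation_iff split: if_splits)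
  obtain K where K: "(\<lambda>t. 1 / 2 * (sg a * exp t / (1 - sg a * exp t * z1) - sg a * exp (- t) / (1 - sg a * exp (- t) * z1))) has_fps_expansion K"
    "\<And>n. even n \<Longrightarrow> fps_nth K n = 0" "\<And>k. fps_nth K (2 * k + 1) = kfun (sg a) z1 (2 * k) 0 / fact (2 * k + 1)"
    using source_fps[OF z1(2)] by blast
  have lim: "((\<lambda>t. point a s t) \<longlongrightarrow> sg a) (at 0)" for s
  proof -
    have "isCont (\<lambda>t. point a s t) 0" by (intro continuous_intros)
    then show ?thesis by (simp add: isCont_def)
  qed
  \<comment> \<open>near the branch point the segment from \<open>z\<close> to \<open>1/z\<close> stays in a ball that omits \<open>z1\<close>\<close>
  have "eventually (\<lambda>t. point a s t \<in> ball (sg a) (dist (sg a) z1)) (at 0)" for s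
    by (rule topological_tendstoD[OF lim]) (use z1(1) in auto)
  from eventually_conj[OF this[of 1] this[of "-1"]]
  have ev: "eventually (\<lambda>t. z1 \<notin> closed_segment (point a 1 t) (inverse (point a 1 t))) (at 0)"
  proof eventually_elim
    case (elim t)
    have "inverse (point a 1 t) = point a (-1) t" by (simp add: exp_minus)
    with elim have "closed_segment (point a 1 t) (inverse (point a 1 t)) \<subseteq> ball (sg a) (dist (sg a) z1)"
      by (intro closed_segment_subset convex_ball) auto
    then show ?case by auto
  qed
  have "(\<lambda>t. (1 / 2 * (sg a * exp t / (1 - sg a * exp t * z1) - sg a * exp (- t) / (1 - sg a * exp (- t) * z1))) *
     ((1 / (exp t - exp (- t))\<^sup>2 * (1 / prodinf (\<lambda>k. 1 - of_real (xcoef q k) * (exp t - exp (- t))\<^sup>2))) *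
      f (point a 1 t))) has_laurent_expansion fps_to_fls K * (kernel_fls q * S)"
    by (intro has_laurent_expansion_mult has_laurent_expansion_fps K(1) kernel_fls_expansion q S)
  then have "(\<lambda>t. kernel_density q (sg a) z1 (sg a * exp t) * f (sg a * exp t) * (sg a * exp t)) has_laurent_expansion
      fps_to_fls K * (kernel_fls q * S)"
  proof (rule iffD1[OF has_laurent_expansion_cong[OF _ refl], rotated])
    show "\<forall>\<^sub>F t in at 0. (1 / 2 * (sg a * exp t / (1 - sg a * exp t * z1) - sg a * exp (- t) / (1 - sg a * exp (- t) * z1))) *
     ((1 / (exp t - exp (- t))\<^sup>2 * (1 / prodinf (\<lambda>k. 1 - of_real (xcoef q k) * (exp t - exp (- t))\<^sup>2))) *
      f (point a 1 t)) = kernel_density q (sg a) z1 (sg a * exp t) * f (sg a * exp t) * (sg a * exp t)"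
      using ev
    proof eventually_elim
      case (elim t)
      define z where "z = sg a * exp t"
      have inv: "inverse z = sg a * exp (- t)" by (simp add: z_def exp_minus)
      have sq: "(z - inverse z)\<^sup>2 = (exp t - exp (- t))\<^sup>2"
        unfolding inv unfolding z_def by (simp add: power_mult_distrib flip: right_diff_distrib)
      have "z \<noteq> 0" by (simp add: z_def)
      moreover have "z1 \<notin> closed_segment z (inverse z)" using elim by (simp add: z_def)
      ultimately have eq: "kernel_density q (sg a) z1 z * z = 1 / 2 * (z / (1 - z * z1) - inverse z / (1 - inverse z * z1)) *
          (1 / (exp t - exp (- t))\<^sup>2 * (1 / prodinf (\<lambda>k. 1 - of_real (xcoef q k) * (exp t - exp (- t))\<^sup>2)))"
        unfolding sq[symmetric] by (rule kernel_density_eq[OF q])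
      show ?case
        using arg_cong[OF eq, of "\<lambda>x. x * f z"]
        unfolding mult_1 inv[symmetric] z_def[symmetric] by (simp only: mult_ac)
    qed
  qed
  from residue_exp_coordinate[OF _ this]
  have "residue (\<lambda>z. kernel_density q (sg a) z1 z * f z) (sg a) = (fps_to_fls K * (kernel_fls q * S)) $$ (- 1)"
    by simp
  also have "\<dots> = (\<Sum>k<D. fps_nth K (2 * k + 1) * (kernel_fls q * S) $$ (- 2 * int k - 2))"
    by (rule residue_odd_times[OF K(2) low])
  also have "\<dots> = (\<Sum>k<D. of_rat (1 / fact (2 * k + 1)) * psi a (2 * k) z1 * (kernel_fls q * S) $$ (- 2 * int k - 2))"
    by (rule sum.cong[OF refl]) (simp only: K(3), simp add: psi_eq_kfun of_rat_divide of_rat_fact del: fact_Suc)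
  finally show ?thesis .
qed

text \<open>
  The expression in square brackets of the recursion, with the derivative of the involution removed.
\<close>

definition bracket :: "real \<Rightarrow> nat \<Rightarrow> complex \<Rightarrow> complex list \<Rightarrow> complex" where
  "bracket q g z zs = (if g = 0 then 0 else okuyama_W q (g - 1) (z # inverse z # zs)) +
     (\<Sum>g1\<in>{..g}. \<Sum>I\<in>Pow {..<length zs}.
        (if g1 = 0 \<and> I = {} \<or> g - g1 = 0 \<and> I = {..<length zs} then 0
         else okuyama_W q g1 (z # nths zs I) * okuyama_W q (g - g1) (inverse z # nths zs (- I))))"

lemma okuyama_W_unstable:
  "okuyama_W q 0 [z1, z2] = W02 z1 z2"
  unfolding okuyama_W_def by simp

lemma okuyama_W_stable:
  assumes "\<not> (g = 0 \<and> length zs \<le> 1)"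
  shows "okuyama_W q g (z1 # zs) =
    (\<Sum>a\<in>UNIV. residue (\<lambda>z. kernel_density q (sg a) z1 z * bracket q g z zs) (sg a))"
proof -
  have "okuyama_W q g (z1 # zs) =
    (\<Sum>\<alpha>\<in>{1, - 1}. residue (\<lambda>z. kernel_density q \<alpha> z1 z * bracket q g z zs) \<alpha>)"
  proof -
    have "\<not> (g = 0 \<and> length zs = 0)" "\<not> (g = 0 \<and> length zs = 1)" using assms by auto
    then show ?thesis
      unfolding okuyama_W_def kernel_density_def bracket_def by (subst TR.simps(2)) (simp only: if_False)
  qed
  then show ?thesis by (simp add: UNIV_bool add.commute)
qed

section \<open>The recursion preserves the span\<close>

abbreviation stable_deg :: "nat \<Rightarrow> nat \<Rightarrow> int" where
  "stable_deg g n \<equiv> 6 * int g - 6 + 2 * int n"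

text \<open>
  The unstable case \<open>(g, p) = (0, 1)\<close>, which is \<open>\<omega>\<^sub>0\<^sub>,\<^sub>2\<close>, fits the same degree formula; only evenness is lost.
\<close>

lemma factor_expansion:
  assumes "(g, p) \<noteq> (0, 0)" "s \<in> {1, -1}"
    and stable: "(g, p) \<noteq> (0, 1) \<Longrightarrow> vspan_pos (Suc p) (stable_deg g (Suc p)) (\<lambda>q zs. okuyama_W q g zs)"
  shows "\<exists>G. ((g, p) \<noteq> (0, 1) \<longrightarrow> lfam_even p (stable_deg g (Suc p) + 2) G) \<and>
    expands a p (stable_deg g (Suc p) + 2) (\<lambda>q zs u. point a s u * okuyama_W q g (point a s u # zs)) G"
proof (cases "(g, p) = (0, 1)")
  case True
  obtain G where G: "expands a 1 0 (\<lambda>q zs u. point a s u * W02 (point a s u) (hd zs)) G"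
    using W02_local[OF assms(2), of a] by blast
  have "(\<lambda>u. point a s u * okuyama_W q 0 (point a s u # zs)) = (\<lambda>u. point a s u * W02 (point a s u) (hd zs))"
    if "adm 1 q zs" for q zs
    using that by (auto simp: adm_def length_Suc_conv okuyama_W_unstable)
  then have "expands a 1 0 (\<lambda>q zs u. point a s u * okuyama_W q 0 (point a s u # zs)) G"
    using G unfolding expands_def by simp
  then show ?thesis using True by (intro exI[of _ G]) auto
next
  case False
  then show ?thesis using expansion_one_variable[OF stable[OF False] assms(2), of a] by blast
qed

text \<open>
  The terms that contain \<open>\<omega>\<^sub>0\<^sub>,\<^sub>1\<close>.
\<close>

definition excluded :: "nat \<Rightarrow> nat \<Rightarrow> nat \<Rightarrow> nat set \<Rightarrow> bool" where
  "excluded g n g1 I \<longleftrightarrow> g1 = 0 \<and> I = {} \<or> g - g1 = 0 \<and> I = {..<n}"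

lemma length_nths_subset:
  assumes "I \<subseteq> {..<n}" "length zs = n"
  shows "length (nths zs I) = card I" "length (nths zs (- I)) = n - card I"
proof -
  have "{i. i < length zs \<and> i \<in> I} = I" using assms by auto
  then show "length (nths zs I) = card I" by (simp add: length_nths)
  have "{i. i < length zs \<and> i \<in> - I} = {..<n} - I" using assms by auto
  then show "length (nths zs (- I)) = n - card I"
    using assms finite_subset[OF assms(1)] by (simp add: length_nths card_Diff_subset)
qed

lemma card_subset_lessThan:
  assumes "I \<subseteq> {..<n}"
  shows "card I \<le> n" "card I = 0 \<longleftrightarrow> I = {}" "card I = n \<longleftrightarrow> I = {..<n}"
proof -
  have fin: "finite I" using assms finite_subset by blast
  show "card I \<le> n" using card_mono[OF _ assms] by simp
  show "card I = 0 \<longleftrightarrow> I = {}" using fin by simp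
  show "card I = n \<longleftrightarrow> I = {..<n}" using card_subset_eq[OF _ assms] by auto
qed

lemma product_factors:
  assumes stable: "\<And>g' n'. 2 * g' + n' < 2 * g + n \<Longrightarrow> (g', n') \<notin> {(0, 0), (0, 1)} \<Longrightarrow>
      vspan_pos (Suc n') (stable_deg g' (Suc n')) (\<lambda>q zs. okuyama_W q g' zs)"
    and I: "g1 \<le> g" "I \<subseteq> {..<n}" "\<not> excluded g n g1 I"
  defines "d1 \<equiv> stable_deg g1 (Suc (card I)) + 2" and "d2 \<equiv> stable_deg (g - g1) (Suc (n - card I)) + 2"
  obtains F G where
      "(g1, card I) \<noteq> (0, 1) \<Longrightarrow> lfam_even (card I) d1 F"
      "lfam (card I) d1 F" "a \<Longrightarrow> lfam_lead (card I) d1 F"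
      "(g - g1, n - card I) \<noteq> (0, 1) \<Longrightarrow> lfam_even (n - card I) d2 G"
      "lfam (n - card I) d2 G" "a \<Longrightarrow> lfam_lead (n - card I) d2 G"
      "\<And>q zs. adm n q zs \<Longrightarrow>
        (\<lambda>u. okuyama_W q g1 (point a 1 u # nths zs I) * okuyama_W q (g - g1) (point a (-1) u # nths zs (- I)))
          has_laurent_expansion F q (nths zs I) * G q (nths zs (- I))"
proof -
  note c = card_subset_lessThan[OF I(2)]
  have ne1: "(g1, card I) \<noteq> (0, 0)" and ne2: "(g - g1, n - card I) \<noteq> (0, 0)"
    using I c unfolding excluded_def by auto
  have lt: "2 * g1 + card I < 2 * g + n" "2 * (g - g1) + (n - card I) < 2 * g + n"
    using ne1 ne2 c(1) I(1) by auto
  obtain F where F: "(g1, card I) \<noteq> (0, 1) \<longrightarrow> lfam_even (card I) d1 F"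
      "expands a (card I) d1 (\<lambda>q zs u. point a 1 u * okuyama_W q g1 (point a 1 u # zs)) F"
    using factor_expansion[OF ne1, of 1 a] stable[OF lt(1)] ne1 unfolding d1_def by auto
  obtain G where G: "(g - g1, n - card I) \<noteq> (0, 1) \<longrightarrow> lfam_even (n - card I) d2 G"
      "expands a (n - card I) d2 (\<lambda>q zs u. point a (-1) u * okuyama_W q (g - g1) (point a (-1) u # zs)) G"
    using factor_expansion[OF ne2, of "-1" a] stable[OF lt(2)] ne2 unfolding d2_def by auto
  show ?thesis
  proof (rule that[of F G])
    fix q zs assume adm: "adm n q zs"
    have "(\<lambda>u. (point a 1 u * okuyama_W q g1 (point a 1 u # nths zs I)) *
        (point a (-1) u * okuyama_W q (g - g1) (point a (-1) u # nths zs (- I))))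
          has_laurent_expansion F q (nths zs I) * G q (nths zs (- I))"
      using F(2) G(2) adm_nths[OF adm length_nths_subset(1)[OF I(2)]] adm_nths[OF adm length_nths_subset(2)[OF I(2)]]
      by (intro has_laurent_expansion_mult) (auto simp: expands_def)
    then show "(\<lambda>u. okuyama_W q g1 (point a 1 u # nths zs I) * okuyama_W q (g - g1) (point a (-1) u # nths zs (- I)))
          has_laurent_expansion F q (nths zs I) * G q (nths zs (- I))" unfolding point_cancel .
  qed (use F G in \<open>auto simp: expands_def\<close>)
qed

abbreviation summand :: "nat \<Rightarrow> bool \<Rightarrow> nat \<Rightarrow> nat \<Rightarrow> nat set \<Rightarrow> real \<Rightarrow> complex list \<Rightarrow> complex \<Rightarrow> complex" where
  "summand n a g g1 I q zs u \<equiv> (if excluded g n g1 I then 0 else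
     okuyama_W q g1 (point a 1 u # nths zs I) * okuyama_W q (g - g1) (point a (-1) u # nths zs (- I)))"

text \<open>
  At most one of the two factors can be \<open>\<omega>\<^sub>0\<^sub>,\<^sub>2\<close> unless the bracket belongs to \<open>\<omega>\<^sub>0\<^sub>,\<^sub>3\<close>; the other one is even, which
  is what the product of families needs.
\<close>

lemma product_expansion:
  assumes stable: "\<And>g' n'. 2 * g' + n' < 2 * g + n \<Longrightarrow> (g', n') \<notin> {(0, 0), (0, 1)} \<Longrightarrow>
      vspan_pos (Suc n') (stable_deg g' (Suc n')) (\<lambda>q zs. okuyama_W q g' zs)"
    and I: "g1 \<le> g" "I \<subseteq> {..<n}" and gn: "(g, n) \<noteq> (0, 2)"
  shows "\<exists>G. expands (a \<and> \<not> excluded g n g1 I) n (stable_deg g (Suc n)) (summand n a g g1 I) G"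
proof (cases "excluded g n g1 I")
  case True
  then show ?thesis using expands_0[of False] by auto
next
  case False
  let ?d1 = "stable_deg g1 (Suc (card I)) + 2" and ?d2 = "stable_deg (g - g1) (Suc (n - card I)) + 2"
  obtain F G where *: "(g1, card I) \<noteq> (0, 1) \<Longrightarrow> lfam_even (card I) ?d1 F"
      "lfam (card I) ?d1 F" "a \<Longrightarrow> lfam_lead (card I) ?d1 F"
      "(g - g1, n - card I) \<noteq> (0, 1) \<Longrightarrow> lfam_even (n - card I) ?d2 G"
      "lfam (n - card I) ?d2 G" "a \<Longrightarrow> lfam_lead (n - card I) ?d2 G"
      "\<And>q zs. adm n q zs \<Longrightarrow>
        (\<lambda>u. okuyama_W q g1 (point a 1 u # nths zs I) * okuyama_W q (g - g1) (point a (-1) u # nths zs (- I)))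
          has_laurent_expansion F q (nths zs I) * G q (nths zs (- I))"
    by (rule product_factors[OF stable I False, where a = a]) blast+
  have le: "card I \<le> n" by (rule card_subset_lessThan(1)[OF I(2)])
  have deg: "?d1 + ?d2 = stable_deg g (Suc n)" "?d2 + ?d1 = stable_deg g (Suc n)"
    using I(1) le by (auto simp: of_nat_diff)
  note len = length_nths_subset[OF I(2)]
  have len': "\<And>zs :: complex list. length zs = n \<Longrightarrow> length (nths zs (- (- I))) = card I"
    using len(1) by simp
  define P where "P q zs = F q (nths zs I) * G q (nths zs (- I))" for q zs
  have "lfam n (stable_deg g (Suc n)) P \<and> (a \<longrightarrow> lfam_lead n (stable_deg g (Suc n)) P)"
  proof (cases "(g - g1, n - card I) = (0, 1)")
    case False
    note even = *(4)[OF False]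
    have "lfam n (?d1 + ?d2) P"
      unfolding P_def by (rule lfam_mult[OF len *(2) even])
    moreover have "lfam_lead n (?d1 + ?d2) P" if a
      unfolding P_def by (rule lfam_lead_mult[OF len *(2) even *(3,6)[OF that]])
    ultimately show ?thesis unfolding deg by blast
  next
    case True
    have "(g1, card I) \<noteq> (0, 1)" using True gn I(1) le by auto
    note even = *(1)[OF this]
    have P: "P = (\<lambda>q zs. G q (nths zs (- I)) * F q (nths zs (- (- I))))"
      by (simp add: P_def fun_eq_iff mult.commute)
    have "lfam n (?d2 + ?d1) P"
      unfolding P by (rule lfam_mult[OF len(2) len' *(5) even])
    moreover have "lfam_lead n (?d2 + ?d1) P" if a
      unfolding P by (rule lfam_lead_mult[OF len(2) len' *(5) even *(6,3)[OF that]])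
    ultimately show ?thesis unfolding deg by blast
  qed
  then have "expands (a \<and> \<not> excluded g n g1 I) n (stable_deg g (Suc n)) (summand n a g g1 I) P"
    unfolding expands_def using False *(7) by (auto simp: P_def)
  then show ?thesis by blast
qed

text \<open>
  For \<open>\<omega>\<^sub>1\<^sub>,\<^sub>1\<close> the term is \<open>\<omega>\<^sub>0\<^sub>,\<^sub>2\<close> on the graph of the involution, \<open>1 / (e^t - e^(-t))^2\<close>; otherwise it is stable.
\<close>

lemma handle_expansion:
  assumes stable: "\<And>g' n'. 2 * g' + n' < 2 * g + n \<Longrightarrow> (g', n') \<notin> {(0, 0), (0, 1)} \<Longrightarrow>
      vspan_pos (Suc n') (stable_deg g' (Suc n')) (\<lambda>q zs. okuyama_W q g' zs)"
    and "g \<noteq> 0"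
  shows "\<exists>G. expands a n (stable_deg g (Suc n)) (\<lambda>q zs u. okuyama_W q (g - 1) (point a 1 u # point a (-1) u # zs)) G"
proof (cases "g = 1 \<and> n = 0")
  case True
  let ?G = "fls_shift 2 (fps_to_fls ((inverse (sinhc 1))\<^sup>2)) :: complex fls"
  have "lfam_lead 0 2 (\<lambda>q zs. ?G)"
    unfolding lfam_lead_def using inverse_sinh_square_leading by (intro exI[of _ "- 2"]) auto
  moreover have "(\<lambda>u. okuyama_W q 0 (point a 1 u # point a (-1) u # zs)) has_laurent_expansion ?G"
    if "adm 0 q zs" for q zs
    using W02_diagonal_local[of a] that by (simp add: adm_def okuyama_W_unstable del: fls_shift_nth)
  ultimately show ?thesis using True lfam_inverse_sinh_square
    by (intro exI[of _ "\<lambda>q zs. ?G"]) (auto simp: expands_def lfam_even_def)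
next
  case False
  have "vspan_pos (Suc (Suc n)) (stable_deg (g - 1) (Suc (Suc n))) (\<lambda>q zs. okuyama_W q (g - 1) zs)"
    using stable[of "g - 1" "Suc n"] False assms(2) by auto
  from expansion_two_variables[OF this, of a]
  have "\<exists>G. expands a n (stable_deg (g - 1) (Suc (Suc n)) + 4)
      (\<lambda>q zs u. okuyama_W q (g - 1) (point a 1 u # point a (-1) u # zs)) G" .
  moreover have "stable_deg (g - 1) (Suc (Suc n)) + 4 = stable_deg g (Suc n)"
    using assms(2) by (simp add: of_nat_diff)
  ultimately show ?thesis by simp
qed

text \<open>
  In genus zero positivity comes from splitting off \<open>\<omega>\<^sub>0\<^sub>,\<^sub>2\<close> with the first of at least two variables; in
  higher genus it comes from the term with \<open>g - 1\<close>.
\<close>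

lemma ex_included:
  assumes "(g, n) \<notin> {(0, 0), (0, 1)}" "g = 0"
  shows "\<exists>I\<subseteq>{..<n}. \<not> excluded g n 0 I"
proof (intro exI[of _ "{0}"] conjI)
  have n: "2 \<le> n" using assms by (cases n; cases "n - 1") auto
  then show "{0} \<subseteq> {..<n}" by auto
  have "1 \<in> {..<n}" using n by auto
  then show "\<not> excluded g n 0 {0}" unfolding excluded_def by auto
qed

lemma bracket_point:
  "bracket q g (point a 1 u) zs = (if g = 0 then 0 else okuyama_W q (g - 1) (point a 1 u # point a (-1) u # zs)) +
     (\<Sum>g1\<in>{..g}. \<Sum>I\<in>Pow {..<length zs}. summand (length zs) a g g1 I q zs u)"
proof -
  have "inverse (point a 1 u) = point a (-1) u" by (simp add: exp_minus)
  then show ?thesis unfolding bracket_def excluded_def by presburger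
qed

lemma bracket_expansion:
  assumes stable: "\<And>g' n'. 2 * g' + n' < 2 * g + n \<Longrightarrow> (g', n') \<notin> {(0, 0), (0, 1)} \<Longrightarrow>
      vspan_pos (Suc n') (stable_deg g' (Suc n')) (\<lambda>q zs. okuyama_W q g' zs)"
    and gn: "(g, n) \<notin> {(0, 0), (0, 1), (0, 2)}"
  shows "\<exists>S. expands a n (stable_deg g (Suc n)) (\<lambda>q zs u. bracket q g (point a 1 u) zs) S"
proof -
  let ?d = "stable_deg g (Suc n)"
  define A where "A = {..g} \<times> Pow {..<n}"
  have "\<forall>p\<in>A. \<exists>G. expands (a \<and> \<not> excluded g n (fst p) (snd p)) n ?d (summand n a g (fst p) (snd p)) G"
    using gn by (intro ballI product_expansion stable) (auto simp: A_def)
  from bchoice[OF this] obtain G where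
    G: "\<And>p. p \<in> A \<Longrightarrow> expands (a \<and> \<not> excluded g n (fst p) (snd p)) n ?d (summand n a g (fst p) (snd p)) (G p)"
    by blast
  have finA: "finite A" by (simp add: A_def)
  have bracket: "bracket q g (point a 1 u) zs = (if g = 0 then 0 else okuyama_W q (g - 1) (point a 1 u # point a (-1) u # zs)) +
     (\<Sum>p\<in>A. summand n a g (fst p) (snd p) q zs u)" if "adm n q zs" for q zs u
  proof -
    have len: "length zs = n" using that by (simp add: adm_def)
    show ?thesis unfolding bracket_point len A_def by (simp add: sum.cartesian_product case_prod_unfold)
  qed
  show ?thesis
  proof (cases "g = 0")
    case True
    have "\<exists>p\<in>A. a \<and> \<not> excluded g n (fst p) (snd p)" if a
    proof -
      obtain I where "I \<subseteq> {..<n}" "\<not> excluded g n 0 I" using ex_included gn True by blast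
      then show ?thesis using that by (intro bexI[of _ "(0, I)"]) (auto simp: A_def)
    qed
    from expands_add[OF expands_sum[OF finA G this] expands_0, where k = "\<lambda>q zs u. bracket q g (point a 1 u) zs"]
    show ?thesis using True bracket by auto
  next
    case False
    obtain H where H: "expands a n ?d (\<lambda>q zs u. okuyama_W q (g - 1) (point a 1 u # point a (-1) u # zs)) H"
      using handle_expansion[of g n a, OF stable False] by blast
    have "expands False n ?d (\<lambda>q zs u. \<Sum>p\<in>A. summand n a g (fst p) (snd p) q zs u) (\<lambda>q zs. \<Sum>p\<in>A. G p q zs)"
      by (rule expands_sum[OF finA G]) auto
    from expands_add[OF H this, where k = "\<lambda>q zs u. bracket q g (point a 1 u) zs"]
    show ?thesis using False bracket by auto
  qed
qed

abbreviation residue_at :: "nat \<Rightarrow> bool \<Rightarrow> real \<Rightarrow> complex list \<Rightarrow> complex" where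
  "residue_at g a q zs \<equiv> residue (\<lambda>z. kernel_density q (sg a) (hd zs) z * bracket q g z (tl zs)) (sg a)"

text \<open>
  The coefficient at \<open>t^(-2k-2)\<close> of the product of kernel and bracket has degree \<open>d - 2k\<close>, and the basis function
  that replaces this power has degree \<open>2k\<close>. A single positive coefficient suffices for positivity of
  the sum.
\<close>

lemma residues_vspan:
  assumes d: "d \<ge> 0" and low: "\<And>i q zs. adm n q zs \<Longrightarrow> i < - (d + 2) \<Longrightarrow> (kernel_fls q * S q zs) $$ i = 0"
    and coeff: "\<And>k. vspan n (d - 2 * int k) (\<lambda>q zs. (kernel_fls q * S q zs) $$ (- 2 * int k - 2))"
    and S: "\<And>q zs. adm n q zs \<Longrightarrow> (\<lambda>u. bracket q g (point a 1 u) zs) has_laurent_expansion S q zs"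
  shows "vspan (Suc n) d (residue_at g a)"
    and "a \<Longrightarrow> vspan_pos n (d - 2 * int k) (\<lambda>q zs. (kernel_fls q * S q zs) $$ (- 2 * int k - 2)) \<Longrightarrow>
      vspan_pos (Suc n) d (residue_at g a)"
proof -
  define D where "D = nat (d + 2) + k"
  define T where "T k q zs = of_rat (1 / fact (2 * k + 1)) * psi a (2 * k) (hd zs) * (kernel_fls q * S q (tl zs)) $$ (- 2 * int k - 2)"
    for k q zs
  have eq: "residue_at g a q zs = (\<Sum>k<D. T k q zs)"
    if adm: "adm (Suc n) q zs" for q zs
  proof -
    obtain w ws where zs: "zs = w # ws" using adm by (cases zs) (auto simp: adm_def)
    have adm': "adm n q ws" using adm by (simp add: zs adm_def)
    show ?thesis
      unfolding zs list.sel T_def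
    proof (rule residue_kernel)
      show "adm (Suc n) q (w # ws)" using adm by (simp add: zs)
      show "(\<lambda>t. bracket q g (point a 1 t) ws) has_laurent_expansion S q ws" by (rule S[OF adm'])
      show "(kernel_fls q * S q ws) $$ i = 0" if "i < - int D" for i
        using low[OF adm', of i] that d by (simp add: D_def)
    qed
  qed
  have T: "vspan (Suc n) d (T k)" for k
  proof -
    have "0 < (1 / fact (2 * k + 1) :: rat)" by simp
    from vspan_Cons[OF this coeff[of k], where k = k and a = a] show ?thesis by (simp add: T_def[abs_def])
  qed
  have "vspan (Suc n) d (\<lambda>q zs. \<Sum>k<D. T k q zs)" by (intro vspan_sum T)
  then show "vspan (Suc n) d (residue_at g a)"
    by (rule vspan_cong) (rule eq)
  assume a and pos: "vspan_pos n (d - 2 * int k) (\<lambda>q zs. (kernel_fls q * S q zs) $$ (- 2 * int k - 2))"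
  have "vspan_pos (Suc n) d (T k)"
  proof -
    have "0 < (1 / fact (2 * k + 1) :: rat)" by simp
    from vspan_pos_Cons[OF this pos, where k = k] show ?thesis using \<open>a\<close> by (simp add: T_def[abs_def])
  qed
  moreover have "k \<in> {..<D}" using d by (simp add: D_def)
  ultimately have "vspan_pos (Suc n) d (\<lambda>q zs. \<Sum>k<D. T k q zs)"
    using T by (intro vspan_pos_sum[of _ k]) auto
  then show "vspan_pos (Suc n) d (residue_at g a)"
    by (rule vspan_pos_cong) (rule eq)
qed

text \<open>
  For \<open>\<omega>\<^sub>0\<^sub>,\<^sub>3\<close> both factors are \<open>\<omega>\<^sub>0\<^sub>,\<^sub>2\<close>, and products of their odd coefficients leave the span. They
  enter only at \<open>t^2\<close> and beyond, whereas against the double pole of the kernel only the constant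
  coefficient matters.
\<close>

lemma bracket_expansion_03:
  "\<exists>S. (\<forall>q zs. adm 2 q zs \<longrightarrow> (\<lambda>u. bracket q 0 (point a 1 u) zs) has_laurent_expansion S q zs) \<and>
    (\<forall>q zs i. adm 2 q zs \<longrightarrow> i < 0 \<longrightarrow> S q zs $$ i = 0) \<and>
    vspan 2 0 (\<lambda>q zs. S q zs $$ 0) \<and> (a \<longrightarrow> vspan_pos 2 0 (\<lambda>q zs. S q zs $$ 0))"
proof -
  define good where "good I G \<longleftrightarrow> (\<forall>q zs i. adm 2 q zs \<longrightarrow> i < 0 \<longrightarrow> G q zs $$ i = 0) \<and>
    vspan 2 0 (\<lambda>q zs. G q zs $$ 0) \<and> (a \<and> \<not> excluded 0 2 0 I \<longrightarrow> vspan_pos 2 0 (\<lambda>q zs. G q zs $$ 0)) \<and>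
    (\<forall>q zs. adm 2 q zs \<longrightarrow> summand 2 a 0 0 I q zs has_laurent_expansion G q zs)" for I and G :: "real \<Rightarrow> complex list \<Rightarrow> complex fls"
  have "\<exists>G. good I G" if I: "I \<subseteq> {..<2}" for I
  proof (cases "excluded 0 2 0 I")
    case True
    then show ?thesis unfolding good_def by (intro exI[of _ "\<lambda>q zs. 0"]) auto
  next
    case False
    then have cI: "card I = 1" using card_subset_lessThan[OF I] unfolding excluded_def by fastforce
    have "vspan_pos (Suc n') (stable_deg g' (Suc n')) (\<lambda>q zs. okuyama_W q g' zs)"
      if "2 * g' + n' < 2 * 0 + 2" "(g', n') \<notin> {(0, 0), (0, 1)}" for g' n' :: nat
      using that by auto
    then obtain F G where FG: "lfam 1 0 F" "a \<Longrightarrow> lfam_lead 1 0 F" "lfam 1 0 G" "a \<Longrightarrow> lfam_lead 1 0 G"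
      "\<And>q zs. adm 2 q zs \<Longrightarrow>
        (\<lambda>u. okuyama_W q 0 (point a 1 u # nths zs I) * okuyama_W q (0 - 0) (point a (-1) u # nths zs (- I)))
          has_laurent_expansion F q (nths zs I) * G q (nths zs (- I))"
      by (rule product_factors[of 0 2 0 I, OF _ _ I False, where a = a]) (auto simp: cI)
    have len: "length (nths zs I) = 1" "length (nths zs (- I)) = 1" if "length zs = 2" for zs :: "complex list"
      using length_nths_subset[OF I that] cI by auto
    have nth: "(F q (nths zs I) * G q (nths zs (- I))) $$ m = (\<Sum>i\<in>{- 0..m + 0}. F q (nths zs I) $$ i * G q (nths zs (- I)) $$ (m - i))"
      if adm: "adm 2 q zs" for q zs m
      by (rule fls_times_nth_interval) (use FG adm_nths[OF adm len(1)] adm_nths[OF adm len(2)] in \<open>auto simp: lfam_def\<close>)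
    have v: "vspan 1 0 (\<lambda>q zs. F q zs $$ 0)" "vspan 1 0 (\<lambda>q zs. G q zs $$ 0)"
      using FG(1,3) unfolding lfam_def by (metis add_0 even_zero)+
    have vp: "vspan_pos 1 0 (\<lambda>q zs. F q zs $$ 0)" "vspan_pos 1 0 (\<lambda>q zs. G q zs $$ 0)" if a
      using FG(2,4)[OF that] unfolding lfam_lead_def by (metis add_0 order_antisym minus_zero)+
    have "vspan 2 0 (\<lambda>q zs. (F q (nths zs I) * G q (nths zs (- I))) $$ 0)"
      using vspan_cong[OF vspan_mult[OF len v]] nth[of _ _ 0] by simp
    moreover have "vspan_pos 2 0 (\<lambda>q zs. (F q (nths zs I) * G q (nths zs (- I))) $$ 0)" if a
      using vspan_pos_cong[OF vspan_pos_mult[OF len vp[OF that]]] nth[of _ _ 0] by simp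
    ultimately show ?thesis using FG(5) nth False unfolding good_def
      by (intro exI[of _ "\<lambda>q zs. F q (nths zs I) * G q (nths zs (- I))"]) auto
  qed
  then have "\<forall>I\<in>Pow {..<2}. \<exists>G. good I G" by blast
  from bchoice[OF this] obtain G where G: "\<And>I. I \<in> Pow {..<2} \<Longrightarrow> good I (G I)" by blast
  define S where "S q zs = (\<Sum>I\<in>Pow {..<2}. G I q zs)" for q zs
  have "vspan 2 0 (\<lambda>q zs. S q zs $$ 0)"
    unfolding S_def fls_nth_sum using G by (intro vspan_sum) (auto simp: good_def)
  moreover have "vspan_pos 2 0 (\<lambda>q zs. S q zs $$ 0)" if a
  proof -
    obtain I where I: "I \<subseteq> {..<2}" "\<not> excluded 0 2 0 I" using ex_included[of 0 2] by auto
    show ?thesis unfolding S_def fls_nth_sum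
      by (rule vspan_pos_sum[of _ I]) (use I that G in \<open>auto simp: good_def\<close>)
  qed
  moreover have "S q zs $$ i = 0" if "adm 2 q zs" "i < 0" for q zs i
    unfolding S_def fls_nth_sum using G that by (simp add: good_def)
  moreover have "(\<lambda>u. bracket q 0 (point a 1 u) zs) has_laurent_expansion S q zs" if adm: "adm 2 q zs" for q zs
  proof -
    have len: "length zs = 2" using adm by (simp add: adm_def)
    have "(\<lambda>u. \<Sum>I\<in>Pow {..<2}. summand 2 a 0 0 I q zs u) has_laurent_expansion S q zs"
      unfolding S_def by (rule has_laurent_expansion_sum) (use G adm good_def in blast)
    then show ?thesis unfolding bracket_point len atMost_0 diff_0_eq_0 by simp
  qed
  ultimately show ?thesis by blast
qed

lemma residue_vspan_stable:
  assumes stable: "\<And>g' n'. 2 * g' + n' < 2 * g + n \<Longrightarrow> (g', n') \<notin> {(0, 0), (0, 1)} \<Longrightarrow>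
      vspan_pos (Suc n') (stable_deg g' (Suc n')) (\<lambda>q zs. okuyama_W q g' zs)"
    and gn: "(g, n) \<notin> {(0, 0), (0, 1)}"
  defines "R \<equiv> \<lambda>a q zs. residue (\<lambda>z. kernel_density q (sg a) (hd zs) z * bracket q g z (tl zs)) (sg a)"
  shows "vspan (Suc n) (stable_deg g (Suc n)) (R a)" "a \<Longrightarrow> vspan_pos (Suc n) (stable_deg g (Suc n)) (R a)"
proof -
  let ?d = "stable_deg g (Suc n)"
  have d: "0 \<le> ?d" using gn by (cases g; cases n; cases "n - 1") auto
  have "vspan (Suc n) ?d (R a) \<and> (a \<longrightarrow> vspan_pos (Suc n) ?d (R a))"
  proof (cases "(g, n) = (0, 2)")
    case False
    then have "(g, n) \<notin> {(0, 0), (0, 1), (0, 2)}" using gn by auto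
    from bracket_expansion[OF stable this, of a] obtain S where S: "lfam n ?d S" "a \<longrightarrow> lfam_lead n ?d S"
      "\<forall>q zs. adm n q zs \<longrightarrow> (\<lambda>u. bracket q g (point a 1 u) zs) has_laurent_expansion S q zs"
      unfolding expands_def by blast
    have kS: "lfam n (2 + ?d) (\<lambda>q zs. kernel_fls q * S q zs)"
      by (rule lfam_mult_const[OF lfam_kernel S(1)])
    have low: "(kernel_fls q * S q zs) $$ i = 0" if "adm n q zs" "i < - (?d + 2)" for i q zs
      using kS that unfolding lfam_def by (simp add: add.commute)
    have coeff: "vspan n (?d - 2 * int k) (\<lambda>q zs. (kernel_fls q * S q zs) $$ (- 2 * int k - 2))" for k
    proof -
      have "vspan n (2 + ?d + (- 2 * int k - 2)) (\<lambda>q zs. (kernel_fls q * S q zs) $$ (- 2 * int k - 2))"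
      proof -
        have "even (- 2 * int k - 2)" by simp
        then show ?thesis using kS unfolding lfam_def by blast
      qed
      moreover have "2 + ?d + (- 2 * int k - 2) = ?d - 2 * int k" by simp
      ultimately show ?thesis by (simp only:)
    qed
    have "vspan_pos (Suc n) ?d (R a)" if a
    proof -
      from lfam_lead_mult_const[OF lfam_kernel S(1) kernel_leading] S(2) that
      obtain j where j: "even j" "- (2 + ?d) \<le> j" "j \<le> - 2"
        "vspan_pos n (2 + ?d + j) (\<lambda>q zs. (kernel_fls q * S q zs) $$ j)" by auto
      define k where "k = nat ((- 2 - j) div 2)"
      have jk: "j = - 2 * int k - 2" using j(1,3) by (auto simp: k_def elim!: evenE)
      have "2 + ?d + j = ?d - 2 * int k" by (simp add: jk)
      with j(4) have "vspan_pos n (?d - 2 * int k) (\<lambda>q zs. (kernel_fls q * S q zs) $$ (- 2 * int k - 2))"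
        by (simp only: jk)
      then show ?thesis unfolding R_def using S(3) that
        by (intro residues_vspan(2)[OF d low coeff, of g a k]) auto
    qed
    moreover have "vspan (Suc n) ?d (R a)"
      unfolding R_def using S(3) by (intro residues_vspan(1)[OF d low coeff]) auto
    ultimately show ?thesis by blast
  next
    case True
    then have g: "g = 0" and n: "n = 2" by auto
    have d0: "?d = 0" using g n by simp
    obtain S where S: "\<forall>q zs. adm 2 q zs \<longrightarrow> (\<lambda>u. bracket q 0 (point a 1 u) zs) has_laurent_expansion S q zs"
      "\<forall>q zs i. adm 2 q zs \<longrightarrow> i < 0 \<longrightarrow> S q zs $$ i = 0"
      "vspan 2 0 (\<lambda>q zs. S q zs $$ 0)" "a \<longrightarrow> vspan_pos 2 0 (\<lambda>q zs. S q zs $$ 0)"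
      using bracket_expansion_03[of a] by blast
    have nth: "(kernel_fls q * S q zs) $$ m = (\<Sum>i\<in>{- 2..m + 0}. kernel_fls q $$ i * S q zs $$ (m - i))"
      if adm: "adm 2 q zs" for q zs m
    proof (rule fls_times_nth_interval)
      have "adm 0 q []" using adm by (simp add: adm_def)
      then show "kernel_fls q $$ i = 0" if "i < - 2" for i
        using lfam_kernel that unfolding lfam_even_def lfam_def by blast
      show "S q zs $$ i = 0" if "i < - 0" for i using S(2) adm that by simp
    qed
    have low: "(kernel_fls q * S q zs) $$ i = 0" if "adm 2 q zs" "i < - (0 + 2)" for i q zs
      using nth[OF that(1), of i] that(2) by simp
    have k2: "vspan 0 0 (\<lambda>q zs. kernel_fls q $$ (- 2))" "vspan_pos 0 0 (\<lambda>q zs. kernel_fls q $$ (- 2))"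
      using vspan_pos_imp_vspan[OF kernel_leading] kernel_leading by simp_all
    have first: "(kernel_fls q * S q zs) $$ (- 2) = kernel_fls q $$ (- 2) * S q zs $$ 0" if "adm 2 q zs" for q zs
      using nth[OF that, of "- 2"] by simp
    have "vspan 2 (0 + 0) (\<lambda>q zs. (kernel_fls q * S q zs) $$ (- 2))"
      by (rule vspan_cong[OF vspan_mult_const[OF k2(1) S(3)]]) (rule first)
    then have coeff: "vspan 2 (0 - 2 * int k) (\<lambda>q zs. (kernel_fls q * S q zs) $$ (- 2 * int k - 2))" for k
    proof (cases "k = 0")
      case False
      then show ?thesis by (intro vspan.zero low) auto
    qed simp
    have "vspan_pos 2 (0 + 0) (\<lambda>q zs. (kernel_fls q * S q zs) $$ (- 2))" if a
      by (rule vspan_pos_cong[OF vspan_pos_mult_const[OF k2(2)]]) (use S(4) that first in auto)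
    then have "a \<Longrightarrow> vspan_pos (Suc 2) 0 (R a)"
      unfolding R_def g using S(1) by (intro residues_vspan(2)[OF order_refl low coeff, of 0 a 0]) auto
    moreover have "vspan (Suc 2) 0 (R a)"
      unfolding R_def g using S(1) by (intro residues_vspan(1)[OF order_refl low coeff]) auto
    moreover have "stable_deg g (Suc 2) = 0" using g by simp
    ultimately show ?thesis unfolding n by metis
  qed
  then show "vspan (Suc n) ?d (R a)" "a \<Longrightarrow> vspan_pos (Suc n) ?d (R a)" by blast+
qed

text \<open>
  Only the residue at \<open>1\<close> is known to be positive, but that at \<open>-1\<close> lies in the span and hence has nonnegative
  coefficients in top degree.
\<close>

theorem okuyama_W_vspan_pos:
  assumes "(g, n) \<notin> {(0, 0), (0, 1)}"
  shows "vspan_pos (Suc n) (stable_deg g (Suc n)) (\<lambda>q zs. okuyama_W q g zs)"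
  using assms
proof (induction "2 * g + n" arbitrary: g n rule: less_induct)
  case less
  define R where "R = (\<lambda>a q zs. residue (\<lambda>z. kernel_density q (sg a) (hd zs) z * bracket q g z (tl zs)) (sg a))"
  have stable: "vspan_pos (Suc n') (stable_deg g' (Suc n')) (\<lambda>q zs. okuyama_W q g' zs)"
    if "2 * g' + n' < 2 * g + n" "(g', n') \<notin> {(0, 0), (0, 1)}" for g' n'
    using less.hyps that by blast
  have R: "vspan (Suc n) (stable_deg g (Suc n)) (R a)" "a \<Longrightarrow> vspan_pos (Suc n) (stable_deg g (Suc n)) (R a)" for a
    unfolding R_def using residue_vspan_stable[of g n, OF stable less.prems] by auto
  have "vspan_pos (Suc n) (stable_deg g (Suc n)) (\<lambda>q zs. \<Sum>a\<in>UNIV. R a q zs)"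
    by (rule vspan_pos_sum[of _ True]) (use R R(2)[of True] in auto)
  then show ?case
  proof (rule vspan_pos_cong)
    fix q zs assume adm: "adm (Suc n) q zs"
    then obtain w ws where zs: "zs = w # ws" "length ws = n" by (cases zs) (auto simp: adm_def)
    have "\<not> (g = 0 \<and> length ws \<le> 1)" using less.prems zs(2) by (cases n; cases "n - 1") auto
    from okuyama_W_stable[OF this, of q w]
    show "okuyama_W q g zs = (\<Sum>a\<in>UNIV. R a q zs)" by (simp add: R_def zs(1))
  qed
qed

section \<open>Power series of the basis functions\<close>

text \<open>
  On power series \<open>f \<mapsto> (z f)'\<close> multiplies the coefficient of \<open>z^(b-1)\<close> by \<open>b\<close>, which is the passage from
  \<open>j\<close> to \<open>j + 1\<close>.
\<close>

lemma psi_times_deriv: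
  assumes "sg a * z \<noteq> 1"
  shows "((\<lambda>z. z * psi a j z) has_field_derivative psi a (Suc j) z) (at z)"
proof -
  define V where "V z = 1 / (1 - sg a * z)" for z
  have dV: "(V has_field_derivative sg a * (V z)\<^sup>2) (at z)"
    unfolding V_def [abs_def] using assms
    by (auto intro!: derivative_eq_intros simp: power2_eq_square)
  have ev: "eventually (\<lambda>w. sg a * w \<noteq> 1) (nhds z)"
  proof -
    have "((\<lambda>w. sg a * w) \<longlongrightarrow> sg a * z) (nhds z)" by (intro tendsto_intros filterlim_ident)
    from this assms show ?thesis by (rule tendsto_imp_eventually_ne)
  qed
  have eq: "w * psi a j w = ((V w)\<^sup>2 - V w) * poly (eul j) (V w)" if "sg a * w \<noteq> 1" for w
  proof -
    have "sg a * w * V w = V w - 1" using that by (simp add: V_def field_simps)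
    then have "(sg a * w * V w) * V w * poly (eul j) (V w) = (V w - 1) * V w * poly (eul j) (V w)" by simp
    then show ?thesis unfolding psi_def V_def[symmetric] by (simp add: power2_eq_square algebra_simps)
  qed
  have "((\<lambda>w. ((V w)\<^sup>2 - V w) * poly (eul j) (V w)) has_field_derivative
      (2 * V z - 1) * (sg a * (V z)\<^sup>2) * poly (eul j) (V z) +
      ((V z)\<^sup>2 - V z) * (poly (pderiv (eul j)) (V z) * (sg a * (V z)\<^sup>2))) (at z)"
    using dV by (auto intro!: derivative_eq_intros DERIV_chain2[OF poly_DERIV] simp: algebra_simps)
  also have "(2 * V z - 1) * (sg a * (V z)\<^sup>2) * poly (eul j) (V z) +
      ((V z)\<^sup>2 - V z) * (poly (pderiv (eul j)) (V z) * (sg a * (V z)\<^sup>2)) = psi a (Suc j) z"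
    unfolding psi_def V_def[symmetric] poly_eul_Suc by (simp add: algebra_simps)
  finally show ?thesis
    by (rule DERIV_cong_ev[OF refl _ refl, THEN iffD2, rotated]) (use ev eq in \<open>auto elim: eventually_mono\<close>)
qed

lemma psi_sums:
  assumes "norm z < 1"
  shows "(\<lambda>n. sg a ^ Suc n * of_nat (Suc n) ^ Suc j * z ^ n) sums psi a j z"
  using assms
proof (induction j arbitrary: z)
  case 0
  have "norm (sg a * z) < 1" using 0 by (simp add: norm_mult sg_def)
  from sums_mult[OF geometric_deriv_sums[OF this], of "sg a"] show ?case
    by (simp add: psi_def power_mult_distrib power_divide mult_ac)
next
  case (Suc j)
  define c where "c n = (case n of 0 \<Rightarrow> 0 | Suc m \<Rightarrow> sg a ^ Suc m * of_nat (Suc m) ^ Suc j)" for n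
  have ne: "sg a * w \<noteq> 1" if "norm w < 1" for w
  proof -
    have "norm (sg a * w) < 1" using that by (simp add: norm_mult sg_def)
    then show ?thesis by force
  qed
  have sums: "(\<lambda>n. c n * w ^ n) sums (w * psi a j w)" if "norm w < 1" for w
  proof -
    have "(\<lambda>n. w * (sg a ^ Suc n * of_nat (Suc n) ^ Suc j * w ^ n)) sums (w * psi a j w)"
      by (intro sums_mult Suc.IH that)
    then have "(\<lambda>n. c (Suc n) * w ^ Suc n) sums (w * psi a j w)"
      by (simp add: c_def mult_ac del: of_nat_Suc)
    then show ?thesis by (subst (asm) sums_Suc_iff) (simp add: c_def)
  qed
  from termdiffs_sums_strong[OF sums psi_times_deriv[OF ne[OF Suc.prems]] Suc.prems]
  have "(\<lambda>n. diffs c n * z ^ n) sums psi a (Suc j) z" by simp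
  then show ?case by (simp add: diffs_def c_def mult_ac del: of_nat_Suc)
qed

lemma psi_has_sum:
  assumes "norm z < 1"
  shows "((\<lambda>b. sg a ^ b * of_nat b ^ Suc j * z ^ (b - 1)) has_sum psi a j z) {0<..}"
proof -
  have "((\<lambda>n. sg a ^ Suc n * of_nat (Suc n) ^ Suc j * z ^ n) has_sum psi a j z) UNIV"
  proof (rule norm_summable_imp_has_sum[OF _ psi_sums[OF assms]])
    obtain r where r: "norm z < r" "r < 1" using assms dense by blast
    have r': "0 < r" using r(1) norm_ge_zero[of z] by linarith
    have "summable (\<lambda>n. sg a ^ Suc n * of_nat (Suc n) ^ Suc j * (of_real r :: complex) ^ n)"
      using psi_sums[of "of_real r" a j] r r' by (auto simp: sums_iff)
    then show "summable (\<lambda>n. norm (sg a ^ Suc n * of_nat (Suc n) ^ Suc j * z ^ n))"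
      by (rule powser_insidea) (use r r' in simp)
  qed
  then show ?thesis
    by (subst has_sum_reindex_bij_witness[of _ Suc "\<lambda>b. b - 1" UNIV _ _ _ "psi a j z"]) (auto simp: gr0_conv_Suc)
qed

section \<open>Series over tuples\<close>

lemma pos_tuples_0 [simp]: "pos_tuples 0 = {[]}"
  by (auto simp: pos_tuples_def)

lemma bij_betw_pos_tuples_Suc: "bij_betw (\<lambda>(b, bs). b # bs) ({0<..} \<times> pos_tuples n) (pos_tuples (Suc n))"
  by (rule bij_betwI[of _ _ _ "\<lambda>bs. (hd bs, tl bs)"]) (auto simp: pos_tuples_def length_Suc_conv)

lemma has_sum_product:
  fixes f :: "'a \<Rightarrow> complex" and h :: "'b \<Rightarrow> complex"
  assumes "(f has_sum x) A" "(h has_sum y) C"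
  shows "((\<lambda>(a, c). f a * h c) has_sum x * y) (A \<times> C)"
proof (rule has_sum_SigmaI)
  show "((\<lambda>c. case (a, c) of (a, c) \<Rightarrow> f a * h c) has_sum f a * y) C" for a
    using has_sum_cmult_right[OF assms(2)] by simp
  show "((\<lambda>a. f a * y) has_sum x * y) A" by (rule has_sum_cmult_left[OF assms(1)])
  have f: "(\<lambda>a. norm (f a)) summable_on A" and h: "(\<lambda>c. norm (h c)) summable_on C"
    using assms summable_on_iff_abs_summable_on_complex[of f A] summable_on_iff_abs_summable_on_complex[of h C]
    by (auto simp: summable_on_def)
  have "(\<lambda>(a, c). norm (f a) * norm (h c)) summable_on (A \<times> C)"
  proof (rule summable_on_SigmaI)
    show "((\<lambda>c. case (a, c) of (a, c) \<Rightarrow> norm (f a) * norm (h c)) has_sum norm (f a) * infsum (\<lambda>c. norm (h c)) C) C" for a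
      using has_sum_cmult_right[OF has_sum_infsum[OF h]] by simp
    show "(\<lambda>a. norm (f a) * infsum (\<lambda>c. norm (h c)) C) summable_on A"
      by (rule summable_on_cmult_left[OF f])
  qed auto
  then have "(\<lambda>p. norm (case p of (a, c) \<Rightarrow> f a * h c)) summable_on (A \<times> C)"
    by (simp add: case_prod_unfold norm_mult)
  then show "(\<lambda>(a, c). f a * h c) summable_on (A \<times> C)" by (rule abs_summable_summable)
qed

lemma psi_prod_has_sum:
  assumes "length \<kappa> = n" "length zs = n" "\<forall>z\<in>set zs. norm z < 1"
  shows "((\<lambda>bs. \<Prod>i<n. sg (fst (\<kappa> ! i)) ^ (bs ! i) * of_nat (bs ! i) ^ Suc (2 * snd (\<kappa> ! i)) * (zs ! i) ^ (bs ! i - 1))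
     has_sum psi_prod \<kappa> zs) (pos_tuples n)"
  using assms
proof (induction n arbitrary: \<kappa> zs)
  case 0
  then show ?case using has_sum_finite[of "{[] :: nat list}" "\<lambda>_. 1 :: complex"] by (simp add: psi_prod_def)
next
  case (Suc n)
  obtain a k \<kappa>' where \<kappa>: "\<kappa> = (a, k) # \<kappa>'" "length \<kappa>' = n" using Suc.prems(1) by (auto simp: length_Suc_conv)
  obtain z ws where zs: "zs = z # ws" "length ws = n" using Suc.prems(2) by (auto simp: length_Suc_conv)
  have "((\<lambda>(b, bs). (sg a ^ b * of_nat b ^ Suc (2 * k) * z ^ (b - 1)) *
      (\<Prod>i<n. sg (fst (\<kappa>' ! i)) ^ (bs ! i) * of_nat (bs ! i) ^ Suc (2 * snd (\<kappa>' ! i)) * (ws ! i) ^ (bs ! i - 1)))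
     has_sum psi a (2 * k) z * psi_prod \<kappa>' ws) ({0<..} \<times> pos_tuples n)"
    using Suc.prems(3) by (intro has_sum_product psi_has_sum Suc.IH \<kappa>(2) zs(2)) (auto simp: zs)
  moreover have "psi a (2 * k) z * psi_prod \<kappa>' ws = psi_prod \<kappa> zs"
    by (simp add: \<kappa>(1) zs(1) psi_prod_Cons)
  ultimately have "((\<lambda>(b, bs). (sg a ^ b * of_nat b ^ Suc (2 * k) * z ^ (b - 1)) *
      (\<Prod>i<n. sg (fst (\<kappa>' ! i)) ^ (bs ! i) * of_nat (bs ! i) ^ Suc (2 * snd (\<kappa>' ! i)) * (ws ! i) ^ (bs ! i - 1)))
     has_sum psi_prod \<kappa> zs) ({0<..} \<times> pos_tuples n)" by (simp only:)
  then have "((\<lambda>x. (\<lambda>bs. \<Prod>i<Suc n. sg (fst (\<kappa> ! i)) ^ (bs ! i) * of_nat (bs ! i) ^ Suc (2 * snd (\<kappa> ! i)) * (zs ! i) ^ (bs ! i - 1))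
      (case x of (b, bs) \<Rightarrow> b # bs)) has_sum psi_prod \<kappa> zs) ({0<..} \<times> pos_tuples n)"
    by (rule has_sum_cong[THEN iffD1, rotated])
       (auto simp: \<kappa>(1) zs(1) prod.lessThan_Suc_shift simp del: power_Suc prod.lessThan_Suc)
  then show ?case
    by (subst (asm) has_sum_reindex_bij_betw[OF bij_betw_pos_tuples_Suc])
qed

abbreviation tuple_monomial :: "nat \<Rightarrow> complex list \<Rightarrow> nat list \<Rightarrow> complex" where
  "tuple_monomial n zs bs \<equiv> (\<Prod>i<n. of_nat (bs ! i) * (zs ! i) ^ (bs ! i - 1))"

text \<open>
  Induction on the number of variables: for fixed values of the others, the sums over the tuples with
  a given first entry are the coefficients of a power series in the first variable that
  vanishes near \<open>0\<close>.
\<close>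

lemma tuple_series_zero:
  assumes "r > 0"
    and "\<And>zs. length zs = n \<Longrightarrow> (\<forall>z\<in>set zs. norm z < r) \<Longrightarrow>
      ((\<lambda>bs. N bs * tuple_monomial n zs bs) has_sum (0 :: complex)) (pos_tuples n)"
    and "bs \<in> pos_tuples n"
  shows "N bs = 0"
  using assms(2,3)
proof (induction n arbitrary: N bs)
  case 0
  have "((\<lambda>bs. N bs) has_sum 0) {[]}" using 0(1)[of "[]"] by simp
  moreover have "((\<lambda>bs. N bs) has_sum N []) {[]}"
    using has_sum_finite[of "{[]}" N] by simp
  ultimately have "N [] = 0" by (rule has_sum_unique[symmetric])
  then show ?case using 0(2) by simp
next
  case (Suc n)
  let ?P = "\<lambda>zs bs. \<Prod>i<n. of_nat (bs ! i) * (zs ! i) ^ (bs ! i - 1) :: complex"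
  have slice: "((\<lambda>bs. N (b # bs) * ?P ws bs) has_sum 0) (pos_tuples n)"
    if ws: "length ws = n" "\<forall>w\<in>set ws. norm w < r" and b: "b > 0" for b ws
  proof -
    have sum: "((\<lambda>(b, bs). (of_nat b * z ^ (b - 1)) * (N (b # bs) * ?P ws bs)) has_sum 0) ({0<..} \<times> pos_tuples n)"
      if "norm z < r" for z
    proof -
      have "((\<lambda>bs. N bs * (\<Prod>i<Suc n. of_nat (bs ! i) * ((z # ws) ! i) ^ (bs ! i - 1))) has_sum 0) (pos_tuples (Suc n))"
        by (rule Suc.prems(1)) (use ws that in auto)
      then have "((\<lambda>x. (\<lambda>bs. N bs * (\<Prod>i<Suc n. of_nat (bs ! i) * ((z # ws) ! i) ^ (bs ! i - 1))) (case x of (b, bs) \<Rightarrow> b # bs)) has_sum 0)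
          ({0<..} \<times> pos_tuples n)"
        by (subst has_sum_reindex_bij_betw[OF bij_betw_pos_tuples_Suc])
      then show ?thesis
        by (rule has_sum_cong[THEN iffD1, rotated]) (auto simp: prod.lessThan_Suc_shift simp del: prod.lessThan_Suc)
    qed
    have summ: "(\<lambda>bs. N (b # bs) * ?P ws bs) summable_on pos_tuples n" if b: "b > 0" for b
    proof -
      \<comment> \<open>a nonzero value of the first variable within the radius shows that the slice is summable\<close>
      define z where "z = complex_of_real (r / 2)"
      have z: "z \<noteq> 0" "norm z < r" using assms(1) by (auto simp: z_def)
      have "(\<lambda>(b, bs). (of_nat b * z ^ (b - 1)) * (N (b # bs) * ?P ws bs)) summable_on ({0<..} \<times> pos_tuples n)"
        using sum[OF z(2)] by (auto simp: summable_on_def)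
      from summable_on_SigmaD1[OF this, of b]
      have "(\<lambda>bs. (of_nat b * z ^ (b - 1)) * (N (b # bs) * ?P ws bs)) summable_on pos_tuples n"
        using b by simp
      moreover define e where "e = of_nat b * z ^ (b - 1)"
      ultimately have "(\<lambda>bs. e * (N (b # bs) * ?P ws bs)) summable_on pos_tuples n" by simp
      from summable_on_cmult_right[OF this, of "inverse e"]
      have "(\<lambda>bs. inverse e * (e * (N (b # bs) * ?P ws bs))) summable_on pos_tuples n" .
      moreover have "e \<noteq> 0" using z(1) b by (simp add: e_def)
      then have "inverse e * (e * x) = x" for x by (simp flip: mult.assoc)
      ultimately show ?thesis by (simp only:)
    qed
    define c where "c b = infsum (\<lambda>bs. N (b # bs) * ?P ws bs) (pos_tuples n)" for b
    have c: "((\<lambda>bs. N (b # bs) * ?P ws bs) has_sum c b) (pos_tuples n)" if "b > 0" for b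
      unfolding c_def by (rule has_sum_infsum[OF summ[OF that]])
    have "(\<lambda>b. of_nat b * c b * z ^ b) sums 0" if z: "norm z < r" for z
    proof -
      have "((\<lambda>b. (of_nat b * z ^ (b - 1)) * c b) has_sum 0) {0<..}"
        by (rule has_sum_SigmaD[OF sum[OF z]]) (use c in \<open>auto intro: has_sum_cmult_right\<close>)
      \<comment> \<open>the factor \<open>z\<close> removes the exponents \<open>b - 1\<close>, so that \<open>z = 0\<close> needs no separate argument\<close>
      from has_sum_cmult_right[OF this, of z]
      have "((\<lambda>b. z * ((of_nat b * z ^ (b - 1)) * c b)) has_sum 0) {0<..}" by simp
      also have "?this \<longleftrightarrow> ((\<lambda>b. of_nat b * c b * z ^ b) has_sum 0) UNIV"
        by (rule has_sum_cong_neutral) (auto simp: power_eq_if)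
      finally show ?thesis by (rule has_sum_imp_sums)
    qed
    then have "(\<lambda>z. 0) has_fps_expansion Abs_fps (\<lambda>b. of_nat b * c b)"
      using assms(1) eventually_nhds_in_open[of "ball (0::complex) r" 0]
      by (intro has_fps_expansionI) (auto elim!: eventually_mono)
    from fps_expansion_unique_complex[OF this has_fps_expansion_0]
    have "of_nat b * c b = 0" by (metis fps_nth_Abs_fps fps_zero_nth)
    then show ?thesis using c[OF b] b by simp
  qed
  obtain b bs' where bs: "bs = b # bs'" "b > 0" "bs' \<in> pos_tuples n"
    using Suc.prems(2) by (auto simp: pos_tuples_def length_Suc_conv)
  show ?case unfolding bs(1)
    by (rule Suc.IH[of "\<lambda>bs. N (b # bs)", OF slice bs(3)]) (use bs(2) in auto)
qed

lemma discrete_volume_eqI: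
  assumes "is_volume_expansion q g n N" "bs \<in> pos_tuples n"
  shows "discrete_volume q g bs = N bs"
proof -
  have len: "length bs = n" using assms(2) by (simp add: pos_tuples_def)
  define M where "M = (SOME N. is_volume_expansion q g n N)"
  have M: "is_volume_expansion q g n M" unfolding M_def by (rule someI[of "is_volume_expansion q g n", OF assms(1)])
  obtain r where r: "r > 0" "\<And>zs. length zs = n \<Longrightarrow> (\<forall>z\<in>set zs. norm z < r) \<Longrightarrow>
        ((\<lambda>bs. N bs * tuple_monomial n zs bs) has_sum okuyama_W q g zs) (pos_tuples n)"
    using assms(1) unfolding is_volume_expansion_def by blast
  obtain s where s: "s > 0" "\<And>zs. length zs = n \<Longrightarrow> (\<forall>z\<in>set zs. norm z < s) \<Longrightarrow>
        ((\<lambda>bs. M bs * tuple_monomial n zs bs) has_sum okuyama_W q g zs) (pos_tuples n)"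
    using M unfolding is_volume_expansion_def by blast
  have "M bs - N bs = 0"
  proof (rule tuple_series_zero[of "min r s" n "\<lambda>bs. M bs - N bs", OF _ _ assms(2)])
    show "0 < min r s" using r(1) s(1) by simp
    fix zs :: "complex list" assume "length zs = n" "\<forall>z\<in>set zs. norm z < min r s"
    then have "((\<lambda>bs. M bs * tuple_monomial n zs bs +
        - (N bs * tuple_monomial n zs bs)) has_sum okuyama_W q g zs + - okuyama_W q g zs) (pos_tuples n)"
      by (intro has_sum_add has_sum_uminus[THEN iffD2]) (use r(2) s(2) in auto)
    then show "((\<lambda>bs. (M bs - N bs) * tuple_monomial n zs bs) has_sum 0) (pos_tuples n)"
      by (simp add: left_diff_distrib)
  qed
  then show ?thesis by (simp add: discrete_volume_def len M_def)
qed

section \<open>The quasi-polynomials\<close>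

lemma monomial_value_sum: "monomial_value q bs (sum f A) = (\<Prod>x\<in>A. monomial_value q bs (f x))"
  by (induction A rule: infinite_finite_induct) (auto simp: monomial_value_add)

lemma monomial_degree_sum: "monomial_degree (sum f A) = (\<Sum>x\<in>A. monomial_degree (f x))"
  by (induction A rule: infinite_finite_induct) (auto simp: monomial_degree_add)

lemma poly_value_eq:
  assumes "finite A" "Poly_Mapping.keys P \<subseteq> A"
  shows "poly_value q bs P = (\<Sum>m\<in>A. of_rat (Poly_Mapping.lookup P m) * monomial_value q bs m)"
  unfolding poly_value_def monomial_value_def
  by (rule sum.mono_neutral_left) (use assms in \<open>auto simp: in_keys_iff\<close>)

lemma poly_value_add: "poly_value q bs (P + Q) = poly_value q bs P + poly_value q bs Q"
proof -
  let ?A = "Poly_Mapping.keys P \<union> Poly_Mapping.keys Q"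
  have "Poly_Mapping.keys (P + Q) \<subseteq> ?A" by (rule keys_add)
  then show ?thesis
    by (simp add: poly_value_eq[of ?A] lookup_add of_rat_add distrib_right sum.distrib)
qed

lemma poly_value_single: "poly_value q bs (Poly_Mapping.single m c) = of_rat c * monomial_value q bs m"
  by (subst poly_value_eq[of "{m}"]) auto

text \<open>
  The product of the even powers \<open>B\<^sub>i^(2 k\<^sub>i)\<close> prescribed by the slots.
\<close>

definition length_monomial :: "(bool \<times> nat) list \<Rightarrow> monomial" where
  "length_monomial \<kappa> = (\<Sum>i<length \<kappa>. Poly_Mapping.single (B i) (2 * snd (\<kappa> ! i)))"

lemma length_monomial:
  "monomial_value q bs (length_monomial \<kappa>) = (\<Prod>i<length \<kappa>. real (bs ! i) ^ (2 * snd (\<kappa> ! i)))"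
  "int (monomial_degree (length_monomial \<kappa>)) = 2 * int (sum_list (map snd \<kappa>))"
  "Poly_Mapping.keys (length_monomial \<kappa>) \<subseteq> B ` {..<length \<kappa>}"
  "even (Poly_Mapping.lookup (length_monomial \<kappa>) v)"
proof -
  have "monomial_value q bs (Poly_Mapping.single (B i) e) = real (bs ! i) ^ e" for i e
    by (cases "e = 0") (simp_all add: monomial_value_def)
  then show "monomial_value q bs (length_monomial \<kappa>) = (\<Prod>i<length \<kappa>. real (bs ! i) ^ (2 * snd (\<kappa> ! i)))"
    by (simp add: length_monomial_def monomial_value_sum)
  have "monomial_degree (Poly_Mapping.single (B i) e) = e" for i e
    by (cases "e = 0") (simp_all add: monomial_degree_def)
  then have "monomial_degree (length_monomial \<kappa>) = (\<Sum>i<length \<kappa>. 2 * snd (\<kappa> ! i))"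
    by (simp add: length_monomial_def monomial_degree_sum)
  then show "int (monomial_degree (length_monomial \<kappa>)) = 2 * int (sum_list (map snd \<kappa>))"
    by (simp add: sum_list_sum_nth atLeast0LessThan sum_distrib_left)
  show "Poly_Mapping.keys (length_monomial \<kappa>) \<subseteq> B ` {..<length \<kappa>}"
    unfolding length_monomial_def by (rule order.trans[OF keys_sum]) (auto split: if_splits)
  show "even (Poly_Mapping.lookup (length_monomial \<kappa>) v)"
    unfolding length_monomial_def lookup_sum by (intro dvd_sum) (auto simp: lookup_single when_def)
qed

text \<open>
  The product of the signs \<open>\<alpha>\<^sub>i^(b\<^sub>i)\<close>, which depends only on the parities of the \<open>b\<^sub>i\<close>.
\<close>

definition parity_sign :: "(bool \<times> nat) list \<Rightarrow> bool list \<Rightarrow> rat" where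
  "parity_sign \<kappa> \<epsilon> = (\<Prod>i<length \<kappa>. if fst (\<kappa> ! i) \<or> \<not> \<epsilon> ! i then 1 else -1)"

fun term_poly :: "vterm \<Rightarrow> bool list \<Rightarrow> polynomial" where
  "term_poly (r, m, \<kappa>) \<epsilon> = Poly_Mapping.single (m + length_monomial \<kappa>) (r * parity_sign \<kappa> \<epsilon>)"

text \<open>
  The sign condition is imposed in the class of all even tuples only: there no term changes its
  sign, so nonnegativity in top degree is inherited from the terms.
\<close>

definition quasi_poly :: "nat \<Rightarrow> int \<Rightarrow> (bool list \<Rightarrow> polynomial) \<Rightarrow> bool" where
  "quasi_poly n d P \<longleftrightarrow> (\<forall>\<epsilon>. P \<epsilon> \<in> square_polys n \<and>
      (\<forall>m\<in>Poly_Mapping.keys (P \<epsilon>). int (monomial_degree m) \<le> d)) \<and>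
     (\<forall>m. int (monomial_degree m) = d \<longrightarrow> 0 \<le> Poly_Mapping.lookup (P (replicate n False)) m)"

definition represents :: "nat \<Rightarrow> (bool list \<Rightarrow> polynomial) \<Rightarrow> (real \<Rightarrow> complex list \<Rightarrow> complex) \<Rightarrow> bool" where
  "represents n P \<Phi> \<longleftrightarrow> (\<forall>q zs. 0 < q \<longrightarrow> q < 1 \<longrightarrow> length zs = n \<longrightarrow> (\<forall>z\<in>set zs. norm z < 1) \<longrightarrow>
     ((\<lambda>bs. of_real (poly_value q bs (P (map odd bs))) * tuple_monomial n zs bs)
       has_sum \<Phi> q zs) (pos_tuples n))"

lemma quasi_poly_add:
  assumes "quasi_poly n d P" "quasi_poly n d Q"
  shows "quasi_poly n d (\<lambda>\<epsilon>. P \<epsilon> + Q \<epsilon>)"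
proof -
  have keys: "Poly_Mapping.keys (P \<epsilon> + Q \<epsilon>) \<subseteq> Poly_Mapping.keys (P \<epsilon>) \<union> Poly_Mapping.keys (Q \<epsilon>)" for \<epsilon>
    by (rule keys_add)
  have "P \<epsilon> + Q \<epsilon> \<in> square_polys n" for \<epsilon>
    using assms keys[of \<epsilon>] unfolding quasi_poly_def square_polys_def by blast
  moreover have "int (monomial_degree m) \<le> d" if "m \<in> Poly_Mapping.keys (P \<epsilon> + Q \<epsilon>)" for \<epsilon> m
    using assms keys[of \<epsilon>] that unfolding quasi_poly_def by blast
  moreover have "0 \<le> Poly_Mapping.lookup (P (replicate n False) + Q (replicate n False)) m"
    if "int (monomial_degree m) = d" for m
    using assms that unfolding quasi_poly_def lookup_add by simp
  ultimately show ?thesis unfolding quasi_poly_def by blast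
qed

lemma represents_add:
  assumes "represents n P \<Phi>" "represents n Q \<Psi>"
    "\<And>q zs. adm n q zs \<Longrightarrow> \<Theta> q zs = \<Phi> q zs + \<Psi> q zs"
  shows "represents n (\<lambda>\<epsilon>. P \<epsilon> + Q \<epsilon>) \<Theta>"
  unfolding represents_def
proof (intro allI impI)
  fix q :: real and zs :: "complex list"
  assume *: "0 < q" "q < 1" "length zs = n" "\<forall>z\<in>set zs. norm z < 1"
  then have adm: "adm n q zs" by (auto simp: adm_def)
  let ?m = "\<lambda>bs. \<Prod>i<n. of_nat (bs ! i) * (zs ! i) ^ (bs ! i - 1) :: complex"
  have "((\<lambda>bs. of_real (poly_value q bs (P (map odd bs))) * ?m bs + of_real (poly_value q bs (Q (map odd bs))) * ?m bs)
       has_sum \<Phi> q zs + \<Psi> q zs) (pos_tuples n)"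
    using assms(1,2) * unfolding represents_def by (intro has_sum_add) auto
  then show "((\<lambda>bs. of_real (poly_value q bs (P (map odd bs) + Q (map odd bs))) * ?m bs) has_sum \<Theta> q zs) (pos_tuples n)"
    by (simp add: poly_value_add distrib_right assms(3)[OF adm])
qed

lemma parity_sign_False: "length \<kappa> = n \<Longrightarrow> parity_sign \<kappa> (replicate n False) = 1"
  by (simp add: parity_sign_def)

lemma quasi_poly_term:
  assumes "admissible_term n d t"
  shows "quasi_poly n d (term_poly t)"
proof -
  obtain r m \<kappa> where t: "t = (r, m, \<kappa>)" by (cases t)
  let ?M = "m + length_monomial \<kappa>"
  have \<kappa>: "length \<kappa> = n" and km: "Poly_Mapping.keys m \<subseteq> Z ` {1..}" using assms t by auto
  have deg: "int (monomial_degree ?M) = term_degree t"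
    by (simp add: t monomial_degree_add length_monomial(2))
  have keys: "Poly_Mapping.keys ?M \<subseteq> B ` {..<n} \<union> Z ` {1..}"
    using keys_add[of m "length_monomial \<kappa>"] length_monomial(3)[of \<kappa>] km unfolding \<kappa> by blast
  have "Poly_Mapping.lookup m (B i) = 0" for i
  proof -
    have "B i \<notin> Poly_Mapping.keys m" using km by auto
    then show ?thesis by (simp add: in_keys_iff)
  qed
  then have even: "even (Poly_Mapping.lookup ?M (B i))" for i
    by (simp add: lookup_add length_monomial(4))
  have *: "term_degree t \<le> d" "term_degree t = d \<longrightarrow> 0 \<le> r" "length \<kappa> = n" using assms t by auto
  show ?thesis
    unfolding quasi_poly_def
  proof (intro conjI allI impI ballI)
    show "term_poly t \<epsilon> \<in> square_polys n" for \<epsilon>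
      using keys even by (auto simp: square_polys_def t)
    show "int (monomial_degree k) \<le> d" if "k \<in> Poly_Mapping.keys (term_poly t \<epsilon>)" for k \<epsilon>
      using that deg *(1) by (auto simp: t split: if_splits)
    show "0 \<le> Poly_Mapping.lookup (term_poly t (replicate n False)) k" if "int (monomial_degree k) = d" for k
      using that deg * by (auto simp: t lookup_single when_def parity_sign_False)
  qed
qed

lemma of_real_of_rat: "complex_of_real (of_rat x) = of_rat x"
  by (cases x rule: Rat_cases) (simp add: Fract_of_int_quotient of_rat_divide)

lemma represents_term:
  assumes "admissible_term n d t"
  shows "represents n (term_poly t) (\<lambda>q zs. term_value q zs t)"
  unfolding represents_def
proof (intro allI impI)
  fix q :: real and zs :: "complex list"
  assume *: "0 < q" "q < 1" "length zs = n" "\<forall>z\<in>set zs. norm z < 1"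
  obtain r m \<kappa> where t: "t = (r, m, \<kappa>)" by (cases t)
  have \<kappa>: "length \<kappa> = n" and m: "Poly_Mapping.keys m \<subseteq> Z ` {1..}" using assms t by auto
  have mv: "monomial_value q bs m = monomial_value q [] m" for bs
    unfolding monomial_value_def by (rule prod.cong[OF refl]) (use m in auto)
  have "((\<lambda>bs. of_rat r * of_real (monomial_value q [] m) *
      (\<Prod>i<n. sg (fst (\<kappa> ! i)) ^ (bs ! i) * of_nat (bs ! i) ^ Suc (2 * snd (\<kappa> ! i)) * (zs ! i) ^ (bs ! i - 1)))
      has_sum term_value q zs t) (pos_tuples n)"
    unfolding t term_value.simps by (intro has_sum_cmult_right psi_prod_has_sum \<kappa> *)
  also have "?this \<longleftrightarrow> ((\<lambda>bs. of_real (poly_value q bs (term_poly t (map odd bs))) * tuple_monomial n zs bs)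
       has_sum term_value q zs t) (pos_tuples n)"
  proof (rule has_sum_cong)
    fix bs assume bs: "bs \<in> pos_tuples n"
    have sign: "of_rat (parity_sign \<kappa> (map odd bs)) = (\<Prod>i<n. sg (fst (\<kappa> ! i)) ^ (bs ! i))"
      unfolding parity_sign_def \<kappa> of_rat_prod
      by (rule prod.cong[OF refl]) (use bs in \<open>auto simp: sg_def pos_tuples_def of_rat_minus\<close>)
    have "complex_of_real (poly_value q bs (term_poly t (map odd bs))) =
       of_rat (r * parity_sign \<kappa> (map odd bs)) * of_real (monomial_value q [] m) * (\<Prod>i<n. of_nat (bs ! i) ^ (2 * snd (\<kappa> ! i)))"
    proof -
      have "poly_value q bs (term_poly t (map odd bs)) = of_rat (r * parity_sign \<kappa> (map odd bs)) *
          (monomial_value q [] m * (\<Prod>i<n. real (bs ! i) ^ (2 * snd (\<kappa> ! i))))"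
        by (simp only: t term_poly.simps poly_value_single monomial_value_add mv[of bs] length_monomial(1) \<kappa>)
      then show ?thesis by (simp add: of_real_of_rat)
    qed
    then show "of_rat r * of_real (monomial_value q [] m) *
      (\<Prod>i<n. sg (fst (\<kappa> ! i)) ^ (bs ! i) * of_nat (bs ! i) ^ Suc (2 * snd (\<kappa> ! i)) * (zs ! i) ^ (bs ! i - 1)) =
      of_real (poly_value q bs (term_poly t (map odd bs))) * tuple_monomial n zs bs"
      by (simp add: of_rat_mult sign prod.distrib mult_ac)
  qed
  finally show "((\<lambda>bs. of_real (poly_value q bs (term_poly t (map odd bs))) * tuple_monomial n zs bs)
       has_sum term_value q zs t) (pos_tuples n)" .
qed

lemma vspan_quasi_poly:
  assumes "vspan n d \<Phi>"
  shows "\<exists>P. quasi_poly n d P \<and> represents n P \<Phi>"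
  using assms
proof induction
  case (zero \<Phi>)
  have "quasi_poly n d (\<lambda>\<epsilon>. 0)" by (simp add: quasi_poly_def square_polys_def)
  moreover have "represents n (\<lambda>\<epsilon>. 0) \<Phi>"
    unfolding represents_def
  proof (intro allI impI)
    fix q :: real and zs :: "complex list"
    assume *: "0 < q" "q < 1" "length zs = n" "\<forall>z\<in>set zs. norm z < 1"
    then have "adm n q zs" by (auto simp: adm_def)
    then show "((\<lambda>bs. of_real (poly_value q bs 0) * tuple_monomial n zs bs)
       has_sum \<Phi> q zs) (pos_tuples n)"
      by (simp add: zero poly_value_def)
  qed
  ultimately show ?case by blast
next
  case (add_term \<Phi> t \<Phi>')
  then obtain P where P: "quasi_poly n d P" "represents n P \<Phi>" by blast
  note t = \<open>admissible_term n d t\<close>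
  show ?case
    using quasi_poly_add[OF P(1) quasi_poly_term[OF t]]
      represents_add[OF P(2) represents_term[OF t] add_term.hyps(3)] by blast
qed

text \<open>
  The monomial of a leading term occurs in the polynomial of the even class with a positive
  coefficient, since all other contributions to that coefficient are nonnegative.
\<close>

lemma vspan_pos_quasi_poly:
  assumes "vspan_pos n d \<Phi>"
  shows "\<exists>P. quasi_poly n d P \<and> represents n P \<Phi> \<and>
     (\<exists>m. int (monomial_degree m) = d \<and> m \<in> Poly_Mapping.keys (P (replicate n False)))"
proof -
  obtain \<Phi>0 t where *: "vspan n d \<Phi>0" "leading_term n d t"
    "\<forall>q zs. adm n q zs \<longrightarrow> \<Phi> q zs = \<Phi>0 q zs + term_value q zs t"
    using assms unfolding vspan_pos_def by blast
  obtain P where P: "quasi_poly n d P" "represents n P \<Phi>0" using vspan_quasi_poly[OF *(1)] by blast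
  obtain r m \<kappa> where t: "t = (r, m, \<kappa>)" by (cases t)
  have ok: "admissible_term n d t" using *(2) t by simp
  let ?M = "m + length_monomial \<kappa>"
  have lt: "length \<kappa> = n" "term_degree t = d" "0 < r" using *(2) t by auto
  have deg: "int (monomial_degree ?M) = d"
    using lt(2) by (simp add: t monomial_degree_add length_monomial(2))
  then have "0 \<le> Poly_Mapping.lookup (P (replicate n False)) ?M"
    using P(1) unfolding quasi_poly_def by blast
  then have "0 < Poly_Mapping.lookup (P (replicate n False) + term_poly t (replicate n False)) ?M"
    using lt by (simp add: lookup_add t parity_sign_False)
  then have "?M \<in> Poly_Mapping.keys (P (replicate n False) + term_poly t (replicate n False))"
    by (simp add: in_keys_iff)
  then show ?thesis
    using quasi_poly_add[OF P(1) quasi_poly_term[OF ok]]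
      represents_add[OF P(2) represents_term[OF ok], of \<Phi>] *(3) deg by blast
qed

section \<open>The discrete volumes\<close>

unbundle no fps_syntax

theorem theorem1p1:
  fixes g n :: nat
  assumes "n \<ge> 1" and "(g, n) \<noteq> (0, 1)" and "(g, n) \<noteq> (0, 2)"
  shows "\<exists>P :: bool list \<Rightarrow> polynomial.
    (\<forall>\<epsilon>\<in>parity_classes n. P \<epsilon> \<in> square_polys n \<and>
       (\<forall>q bs. 0 < q \<and> q < 1 \<and> bs \<in> pos_tuples n \<and> map odd bs = \<epsilon> \<longrightarrow>
          discrete_volume q g bs = complex_of_real (poly_value q bs (P \<epsilon>)))) \<and>
    (MAX \<epsilon>\<in>parity_classes n. poly_degree (P \<epsilon>)) = ereal (6 * real g - 6 + 2 * real n)"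
proof -
  obtain k where n: "n = Suc k" using assms(1) by (cases n) auto
  have "vspan_pos n (stable_deg g n) (\<lambda>q zs. okuyama_W q g zs)"
    unfolding n by (rule okuyama_W_vspan_pos) (use assms n in auto)
  from vspan_pos_quasi_poly[OF this] obtain P m where
    P: "quasi_poly n (stable_deg g n) P" "represents n P (\<lambda>q zs. okuyama_W q g zs)" and
    m: "int (monomial_degree m) = stable_deg g n" "m \<in> Poly_Mapping.keys (P (replicate n False))" by blast
  have vol: "discrete_volume q g bs = complex_of_real (poly_value q bs (P (map odd bs)))"
    if "0 < q" "q < 1" "bs \<in> pos_tuples n" for q bs
  proof (rule discrete_volume_eqI[where N = "\<lambda>bs. complex_of_real (poly_value q bs (P (map odd bs)))", OF _ that(3)])
    show "is_volume_expansion q g n (\<lambda>bs. complex_of_real (poly_value q bs (P (map odd bs))))"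
      unfolding is_volume_expansion_def using P(2) that(1,2) unfolding represents_def
      by (intro exI[of _ 1]) auto
  qed
  have real_deg: "real (monomial_degree m') \<le> 6 * real g - 6 + 2 * real n \<longleftrightarrow> int (monomial_degree m') \<le> stable_deg g n" for m'
    by linarith
  have "(MAX \<epsilon>\<in>parity_classes n. poly_degree (P \<epsilon>)) = ereal (6 * real g - 6 + 2 * real n)"
  proof (rule antisym)
    have fin: "finite (parity_classes n)"
      unfolding parity_classes_def using finite_lists_length_eq[of "UNIV :: bool set" n] by simp
    have zero: "replicate n False \<in> parity_classes n" by (simp add: parity_classes_def)
    have "poly_degree (P \<epsilon>) \<le> ereal (6 * real g - 6 + 2 * real n)" for \<epsilon>
      unfolding poly_degree_def
    proof (rule SUP_least)
      fix m' assume "m' \<in> Poly_Mapping.keys (P \<epsilon>)"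
      then have "int (monomial_degree m') \<le> stable_deg g n" using P(1) unfolding quasi_poly_def by blast
      then show "ereal (real (monomial_degree m')) \<le> ereal (6 * real g - 6 + 2 * real n)"
        using real_deg by simp
    qed
    then show "(MAX \<epsilon>\<in>parity_classes n. poly_degree (P \<epsilon>)) \<le> ereal (6 * real g - 6 + 2 * real n)"
      using fin zero by (subst Max_le_iff) auto
    have "real (monomial_degree m) = 6 * real g - 6 + 2 * real n" using m(1) by linarith
    then have "ereal (6 * real g - 6 + 2 * real n) \<le> poly_degree (P (replicate n False))"
      unfolding poly_degree_def using m(2) by (intro SUP_upper2[OF m(2)]) simp
    also have "\<dots> \<le> (MAX \<epsilon>\<in>parity_classes n. poly_degree (P \<epsilon>))"
      using fin zero by (intro Max_ge) auto
    finally show "ereal (6 * real g - 6 + 2 * real n) \<le> (MAX \<epsilon>\<in>parity_classes n. poly_degree (P \<epsilon>))" .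
  qed
  then show ?thesis
    using P(1) vol unfolding quasi_poly_def by (intro exI[of _ P]) auto
qed

end
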